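(* There is a constant $C>0$ depending only on $\sigma$ and $d$ such that, in the recovering bandits model, the $d$-step multiple play lookahead Bayesian regret of $d$RGP-TS (run on multiple play trees) satisfies $$\mathbb E[\mathrm{Reg}_T^{(d,m)}]\le C\sqrt{KT\gamma_T\log((K|\mathcal Z|)^dT)}.$$
   Context: Recovering bandits model: $K$ arms, horizon $T$, $\mathcal Z=\{0,\dots,z_{\max}\}$, $T\ge K|\mathcal Z|$. The recovery functions $f_1,\dots,f_K:\mathcal Z\to\mathbb R$ are drawn independently from a zero-mean Gaussian process with known kernel $k$ satisfying $k(z,z)\le1$. The state at round $t$ is $\mathbf Z_t=(Z_{1,t},\dots,Z_{K,t})\in\mathcal Z^K$ (given initial state); if arm $J_t$ is played then $Z_{j,t+1}=0$ for $j=J_t$ and $Z_{j,t+1}=\min\{z_{\max},Z_{j,t}+1\}$ otherwise, and one observes $Y_t=f_{J_t}(Z_{J_t,t})+\epsilon_t$ with $\epsilon_t$ i.i.d. $\mathcal N(0,\sigma^2)$, $\sigma$ known. Each arm's posterior is the standard GP posterior given that arm's past observations. Multiple play lookahead tree: from a root state $\mathbf Z$, a leaf $i$ is any sequence $(j_0,\dots,j_{d-1})\in\{1,\dots,K\}^d$; along it states are updated by the rule above, giving the $z$-value $z_\ell$ of arm $j_\ell$ at step $\ell$. $M_i(\mathbf Z)=\sum_{\ell=0}^{d-1}f_{j_\ell}(z_\ell)$, $M^*(\mathbf Z)=\max_iM_i(\mathbf Z)$. $d$RGP-TS: at each round $t\in\{1,d+1,2d+1,\dots\}$, $t<T$, for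 every arm $j$ draw a sample $\tilde f_j$ from the current posterior of $f_j$ (jointly at all $z$-values reachable in the lookahead), set $\tilde\eta_t(i)=\sum_\ell\tilde f_{j_\ell}(z_\ell)$ for each leaf $i$ of the tree rooted at $\mathbf Z_t$, choose $I_t\in\arg\max_i\tilde\eta_t(i)$, play its $d$ arms in rounds $t,\dots,t+d-1$ (no posterior update within the block), then update the posteriors. Regret: $\mathbb E[\mathrm{Reg}_T^{(d,m)}]=\sum_{h=0}^{\lfloor T/d\rfloor}\mathbb E[M^*(\mathbf Z_{hd+1})-M_{I_{hd+1}}(\mathbf Z_{hd+1})]$, expectation over the $f_j$, noise and algorithm. Maximal information gain: $\gamma_N=\max_{z_1,\dots,z_N\in\mathcal Z}\frac12\log\det(I_N+\sigma^{-2}[k(z_a,z_b)]_{a,b=1}^N)$. *)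

theory Defs
  imports "HOL-Probability.Probability" "Jordan_Normal_Form.Determinant"
begin

(* Arms are indexed 0..K-1, z-values 0..zmax.  A state is a function nat => nat
   (Zs j = current z-value of arm j).  Kernels / matrices over Z are functions
   nat => nat => real (only the entries in {0..zmax} matter). *)

definition rb_step :: "nat \<Rightarrow> (nat \<Rightarrow> nat) \<Rightarrow> nat \<Rightarrow> (nat \<Rightarrow> nat)" where
  "rb_step zmax Zs j = (\<lambda>i. if i = j then 0 else min zmax (Zs i + 1))"

fun leaf_val :: "nat \<Rightarrow> (nat \<Rightarrow> nat \<Rightarrow> real) \<Rightarrow> (nat \<Rightarrow> nat) \<Rightarrow> nat list \<Rightarrow> real" where
  "leaf_val zmax f Zs [] = 0"
| "leaf_val zmax f Zs (j # js) = f j (Zs j) + leaf_val zmax f (rb_step zmax Zs j) js"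

definition leaves :: "nat \<Rightarrow> nat \<Rightarrow> nat list set" where
  "leaves K d = {js. length js = d \<and> set js \<subseteq> {..<K}}"

definition Mstar :: "nat \<Rightarrow> nat \<Rightarrow> nat \<Rightarrow> (nat \<Rightarrow> nat \<Rightarrow> real) \<Rightarrow> (nat \<Rightarrow> nat) \<Rightarrow> real" where
  "Mstar K d zmax f Zs = Max (leaf_val zmax f Zs ` leaves K d)"

(* a square root A (A A^T = S) of a (psd) matrix over Z; N(m,S) is obtained as m + A u,
   u a vector of iid standard normals *)
definition mat_sqrt :: "nat \<Rightarrow> (nat \<Rightarrow> nat \<Rightarrow> real) \<Rightarrow> (nat \<Rightarrow> nat \<Rightarrow> real)" where
  "mat_sqrt zmax S = (SOME A. \<forall>a\<le>zmax. \<forall>b\<le>zmax. (\<Sum>c\<le>zmax. A a c * A b c) = S a b)"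

definition valid_kernel :: "nat \<Rightarrow> (nat \<Rightarrow> nat \<Rightarrow> real) \<Rightarrow> bool" where
  "valid_kernel zmax k \<longleftrightarrow> (\<forall>a\<le>zmax. \<forall>b\<le>zmax. k a b = k b a) \<and>
     (\<forall>c :: nat \<Rightarrow> real. (\<Sum>a\<le>zmax. \<Sum>b\<le>zmax. c a * c b * k a b) \<ge> 0)"

(* GP posterior given observations obs = [(z_1,y_1),...,(z_n,y_n)]:
   mean(z)    = k_n(z)^T (K_n + sigma^2 I)^{-1} y
   cov(z,z')  = k(z,z') - k_n(z)^T (K_n + sigma^2 I)^{-1} k_n(z')
   where (K_n + sigma^2 I)^{-1} v is written as the solution of the linear system. *)
definition lin_solve :: "(nat \<Rightarrow> nat \<Rightarrow> real) \<Rightarrow> nat \<Rightarrow> (nat \<Rightarrow> real) \<Rightarrow> (nat \<Rightarrow> real)" where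
  "lin_solve M n v = (SOME x. \<forall>a<n. (\<Sum>b<n. M a b * x b) = v a)"

definition gram_noise :: "(nat \<Rightarrow> nat \<Rightarrow> real) \<Rightarrow> real \<Rightarrow> (nat \<times> real) list \<Rightarrow> nat \<Rightarrow> nat \<Rightarrow> real" where
  "gram_noise k \<sigma> obs a b = k (fst (obs ! a)) (fst (obs ! b)) + (if a = b then \<sigma>\<^sup>2 else 0)"

definition post_mean :: "(nat \<Rightarrow> nat \<Rightarrow> real) \<Rightarrow> real \<Rightarrow> (nat \<times> real) list \<Rightarrow> nat \<Rightarrow> real" where
  "post_mean k \<sigma> obs z =
     (let n = length obs; \<beta> = lin_solve (gram_noise k \<sigma> obs) n (\<lambda>a. snd (obs ! a))
      in \<Sum>a<n. k z (fst (obs ! a)) * \<beta> a)"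

definition post_cov :: "(nat \<Rightarrow> nat \<Rightarrow> real) \<Rightarrow> real \<Rightarrow> (nat \<times> real) list \<Rightarrow> nat \<Rightarrow> nat \<Rightarrow> real" where
  "post_cov k \<sigma> obs z z' =
     (let n = length obs; \<beta> = lin_solve (gram_noise k \<sigma> obs) n (\<lambda>a. k (fst (obs ! a)) z')
      in k z z' - (\<Sum>a<n. k z (fst (obs ! a)) * \<beta> a))"

datatype rnd_idx =
    PriorR nat nat        (* arm j, coordinate c: generates f_j *)
  | NoiseR nat            (* round t: noise eps_t = sigma * N_t *)
  | SampR nat nat nat     (* block h, arm j, coordinate c: TS posterior sample *)

definition std_gauss :: "real measure" where
  "std_gauss = density lborel std_normal_density"

definition rb_space :: "(rnd_idx \<Rightarrow> real) measure" where
  "rb_space = (\<Pi>\<^sub>M i\<in>UNIV. std_gauss)"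

(* recovery functions f_j ~ GP(0,k) on Z, independent over j *)
definition rb_f :: "nat \<Rightarrow> (nat \<Rightarrow> nat \<Rightarrow> real) \<Rightarrow> (rnd_idx \<Rightarrow> real) \<Rightarrow> nat \<Rightarrow> nat \<Rightarrow> real" where
  "rb_f zmax k \<omega> j z = (\<Sum>c\<le>zmax. mat_sqrt zmax k z c * \<omega> (PriorR j c))"

definition ts_sample :: "nat \<Rightarrow> (nat \<Rightarrow> nat \<Rightarrow> real) \<Rightarrow> real \<Rightarrow> (rnd_idx \<Rightarrow> real) \<Rightarrow> nat
     \<Rightarrow> (nat \<Rightarrow> (nat \<times> real) list) \<Rightarrow> nat \<Rightarrow> nat \<Rightarrow> real" where
  "ts_sample zmax k \<sigma> \<omega> h obs j z =
     post_mean k \<sigma> (obs j) z +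
     (\<Sum>c\<le>zmax. mat_sqrt zmax (post_cov k \<sigma> (obs j)) z c * \<omega> (SampR h j c))"

(* playing the leaf js starting in round t0 (0-based) from state Zs: returns final state and
   updated observation lists *)
fun play_leaf :: "nat \<Rightarrow> real \<Rightarrow> (nat \<Rightarrow> nat \<Rightarrow> real) \<Rightarrow> (rnd_idx \<Rightarrow> real) \<Rightarrow> nat
     \<Rightarrow> nat list \<Rightarrow> (nat \<Rightarrow> nat) \<times> (nat \<Rightarrow> (nat \<times> real) list)
     \<Rightarrow> (nat \<Rightarrow> nat) \<times> (nat \<Rightarrow> (nat \<times> real) list)" where
  "play_leaf zmax \<sigma> f \<omega> t0 [] st = st"
| "play_leaf zmax \<sigma> f \<omega> t0 (j # js) (Zs, obs) =
     play_leaf zmax \<sigma> f \<omega> (Suc t0) js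
       (rb_step zmax Zs j,
        obs(j := obs j @ [(Zs j, f j (Zs j) + \<sigma> * \<omega> (NoiseR t0))]))"

definition tie_rule :: "nat \<Rightarrow> nat \<Rightarrow> ((nat \<Rightarrow> nat) \<Rightarrow> (nat list \<Rightarrow> real) \<Rightarrow> nat list) \<Rightarrow> bool" where
  "tie_rule K d sel \<longleftrightarrow> (\<forall>Zs \<eta>. sel Zs \<eta> \<in> leaves K d \<and>
        (\<forall>i\<in>leaves K d. \<eta> i \<le> \<eta> (sel Zs \<eta>))) \<and>
     (\<forall>Zs. (\<lambda>\<eta>. sel Zs \<eta>) \<in> measurable (\<Pi>\<^sub>M i\<in>leaves K d. borel) (count_space UNIV))"

(* chosen leaf at block h (rounds h*d+1 .. h*d+d) given state and posterior data *)
definition ts_choice :: "nat \<Rightarrow> nat \<Rightarrow> nat \<Rightarrow> (nat \<Rightarrow> nat \<Rightarrow> real) \<Rightarrow> real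
     \<Rightarrow> ((nat \<Rightarrow> nat) \<Rightarrow> (nat list \<Rightarrow> real) \<Rightarrow> nat list) \<Rightarrow> (rnd_idx \<Rightarrow> real) \<Rightarrow> nat
     \<Rightarrow> (nat \<Rightarrow> nat) \<times> (nat \<Rightarrow> (nat \<times> real) list) \<Rightarrow> nat list" where
  "ts_choice K d zmax k \<sigma> sel \<omega> h st =
     sel (fst st) (restrict (leaf_val zmax (ts_sample zmax k \<sigma> \<omega> h (snd st)) (fst st)) (leaves K d))"

fun ts_run :: "nat \<Rightarrow> nat \<Rightarrow> nat \<Rightarrow> (nat \<Rightarrow> nat \<Rightarrow> real) \<Rightarrow> real
     \<Rightarrow> ((nat \<Rightarrow> nat) \<Rightarrow> (nat list \<Rightarrow> real) \<Rightarrow> nat list) \<Rightarrow> (nat \<Rightarrow> nat) \<Rightarrow> (rnd_idx \<Rightarrow> real)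
     \<Rightarrow> nat \<Rightarrow> (nat \<Rightarrow> nat) \<times> (nat \<Rightarrow> (nat \<times> real) list)" where
  "ts_run K d zmax k \<sigma> sel Z0 \<omega> 0 = (Z0, \<lambda>_. [])"
| "ts_run K d zmax k \<sigma> sel Z0 \<omega> (Suc h) =
     (let st = ts_run K d zmax k \<sigma> sel Z0 \<omega> h
      in play_leaf zmax \<sigma> (rb_f zmax k \<omega>) \<omega> (h * d)
           (ts_choice K d zmax k \<sigma> sel \<omega> h st) st)"

definition ts_regret :: "nat \<Rightarrow> nat \<Rightarrow> nat \<Rightarrow> (nat \<Rightarrow> nat \<Rightarrow> real) \<Rightarrow> real
     \<Rightarrow> ((nat \<Rightarrow> nat) \<Rightarrow> (nat list \<Rightarrow> real) \<Rightarrow> nat list) \<Rightarrow> (nat \<Rightarrow> nat) \<Rightarrow> nat \<Rightarrow> real" where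
  "ts_regret K d zmax k \<sigma> sel Z0 T =
     (\<Sum>h\<le>T div d. \<integral>\<omega>. (let st = ts_run K d zmax k \<sigma> sel Z0 \<omega> h; f = rb_f zmax k \<omega>
                           in Mstar K d zmax f (fst st)
                              - leaf_val zmax f (fst st) (ts_choice K d zmax k \<sigma> sel \<omega> h st))
                    \<partial>rb_space)"

definition info_gain :: "nat \<Rightarrow> (nat \<Rightarrow> nat \<Rightarrow> real) \<Rightarrow> real \<Rightarrow> nat \<Rightarrow> real" where
  "info_gain zmax k \<sigma> N =
     Max ((\<lambda>zs. (1/2) * ln (Determinant.det (mat N N (\<lambda>(a,b).
              (if a = b then 1 else 0) + k (zs a) (zs b) / \<sigma>\<^sup>2)))) `
          {zs. \<forall>i. (i < N \<longrightarrow> zs i \<le> zmax) \<and> (i \<ge> N \<longrightarrow> zs i = 0)})"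

end

theory Submission
  imports Defs "HOL-Library.Sublist"
begin

text \<open>Every random quantity of the model, once the leaves chosen so far are fixed, is a linear
  functional of independent standard Gaussians, and the joint law of finitely many such functionals
  depends only on their Gram matrix; we realise equality of laws by measure-preserving isometries of
  the probability space. The residual of a recovery function at the posterior mean is orthogonal to
  the observations and has the posterior covariance as Gram matrix. Hence, for each possible history,
  there is an isometry that fixes the history and turns the recovery functions into the posterior
  sample, and one that fixes the history and the chosen leaf and reflects the recovery functions at
  the posterior mean. Gluing these over the finitely many histories shows that the regret of a block
  is the expected excess of the sampled over the posterior mean value of the chosen leaf.

  This excess is a sum of terms \<open>s g\<close> with \<open>s\<close> a posterior deviation and \<open>g\<close> one of \<open>K (zmax + 1)\<close>
  standard normals, and \<open>s g \<le> a s\<^sup>2 / 2 + g\<^sup>2 / (2 a)\<close>. The maximal \<open>g\<^sup>2\<close> is controlled by the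
  exponential moment of \<open>g\<^sup>2 / 4\<close>. For the sum of the \<open>s\<^sup>2\<close> along a run, fix an arm and a position
  inside the blocks and keep only the observations of that arm at that position: this increases the
  posterior variances, and they are now updated after every play, so that they telescope into the
  logarithm of the determinant that defines the information gain. Optimising \<open>a\<close> gives the bound.\<close>


section \<open>Isometries of Gaussian space\<close>

text \<open>The arms are chosen adaptively: which coordinates of \<open>\<omega>\<close> enter the
  data depends on earlier values, so along the actual run the data are not jointly Gaussian. Along a
  fixed arm sequence they are. The event that the run follows that sequence depends only on
  functionals that the isometry fixes, so it is invariant under the isometry, and this is what
  allows maps for different histories to be combined. The combined maps stand in for conditioning on
  the history: equality of conditional laws becomes a swap, and a conditional mean becomes the
  midpoint of a function and its reflection. Deviations are controlled per pair of arm and z-value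
  rather than per leaf, so that one random variable dominates all steps of all leaves. The constant
  \<open>a\<close> is common to all blocks and outcomes; choosing it last has the effect of
  Cauchy-Schwarz over both.\<close>

lemma distr_PiM_lborel_translate:
  fixes v :: "'i \<Rightarrow> real"
  assumes "finite I"
  shows "distr (\<Pi>\<^sub>M i\<in>I. lborel) (\<Pi>\<^sub>M i\<in>I. lborel) (\<lambda>x. \<lambda>i\<in>I. x i + v i) = (\<Pi>\<^sub>M i\<in>I. lborel)"
proof -
  interpret product_sigma_finite "\<lambda>_::'i. lborel :: real measure" by standard
  show ?thesis
  proof (rule PiM_eqI)
    fix A :: "'i \<Rightarrow> real set" assume A: "\<And>i. i \<in> I \<Longrightarrow> A i \<in> sets lborel"
    have [measurable]: "(\<lambda>x. \<lambda>i\<in>I. x i + v i) \<in> (\<Pi>\<^sub>M i\<in>I. lborel) \<rightarrow>\<^sub>M (\<Pi>\<^sub>M i\<in>I. lborel)"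
      by measurable
    have tr: "emeasure lborel ((\<lambda>x. x + v i) -` A i) = emeasure lborel (A i)" if "i \<in> I" for i
    proof -
      have "emeasure lborel (A i) = emeasure (distr lborel borel (\<lambda>x. v i + x)) (A i)"
        by (simp add: lborel_distr_plus)
      also have "\<dots> = emeasure lborel ((\<lambda>x. x + v i) -` A i)"
        using A[OF that] by (subst emeasure_distr) (auto simp: add.commute[of _ "v i"])
      finally show ?thesis by simp
    qed
    have ms: "(\<lambda>x. x + v i) -` A i \<in> sets lborel" if "i \<in> I" for i
      using measurable_sets[of "\<lambda>x. x + v i" lborel lborel "A i"] A[OF that] by simp
    have "emeasure (distr (\<Pi>\<^sub>M i\<in>I. lborel) (\<Pi>\<^sub>M i\<in>I. lborel) (\<lambda>x. \<lambda>i\<in>I. x i + v i)) (Pi\<^sub>E I A)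
        = emeasure (\<Pi>\<^sub>M i\<in>I. lborel) (Pi\<^sub>E I (\<lambda>i. (\<lambda>x. x + v i) -` A i))"
      using A assms
      by (subst emeasure_distr)
         (auto intro!: arg_cong2[where f=emeasure] sets_PiM_I_finite simp: space_PiM PiE_iff)
    also have "\<dots> = (\<Prod>i\<in>I. emeasure lborel ((\<lambda>x. x + v i) -` A i))"
      using assms ms by (subst emeasure_PiM) auto
    finally show "emeasure (distr (\<Pi>\<^sub>M i\<in>I. lborel) (\<Pi>\<^sub>M i\<in>I. lborel) (\<lambda>x. \<lambda>i\<in>I. x i + v i)) (Pi\<^sub>E I A)
        = (\<Prod>i\<in>I. emeasure lborel (A i))"
      using tr by simp
  qed (use assms in auto)
qed

lemma prob_space_std_gauss: "prob_space std_gauss"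
  unfolding std_gauss_def by (intro prob_space_normal_density) simp

lemma sets_std_gauss [simp, measurable_cong]: "sets std_gauss = sets borel"
  by (simp add: std_gauss_def)

lemma space_std_gauss [simp]: "space std_gauss = UNIV"
  by (simp add: std_gauss_def)

lemma PiM_std_gauss_eq_density:
  assumes "finite I"
  shows "(\<Pi>\<^sub>M i\<in>I. std_gauss)
       = density (\<Pi>\<^sub>M i\<in>I. lborel) (\<lambda>x. \<Prod>i\<in>I. ennreal (std_normal_density (x i)))"
proof -
  interpret L: product_sigma_finite "\<lambda>_::'a. lborel :: real measure" by standard
  interpret G: product_prob_space "\<lambda>_::'a. std_gauss" I
    by (intro product_prob_spaceI prob_space_std_gauss)
  have "density (\<Pi>\<^sub>M i\<in>I. lborel) (\<lambda>x. \<Prod>i\<in>I. ennreal (std_normal_density (x i))) = (\<Pi>\<^sub>M i\<in>I. std_gauss)"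
  proof (rule G.PiM_eqI)
    fix A :: "'a \<Rightarrow> real set" assume A: "\<And>i. i \<in> I \<Longrightarrow> A i \<in> sets std_gauss"
    have [measurable]: "Pi\<^sub>E I A \<in> sets (\<Pi>\<^sub>M i\<in>I. lborel)"
      using A assms by (intro sets_PiM_I_finite) auto
    have "emeasure (density (\<Pi>\<^sub>M i\<in>I. lborel) (\<lambda>x. \<Prod>i\<in>I. ennreal (std_normal_density (x i)))) (Pi\<^sub>E I A)
       = (\<integral>\<^sup>+x. (\<Prod>i\<in>I. ennreal (std_normal_density (x i)) * indicator (A i) (x i)) \<partial>(\<Pi>\<^sub>M i\<in>I. lborel))"
    proof (subst emeasure_density)
      show "(\<lambda>x. \<Prod>i\<in>I. ennreal (std_normal_density (x i))) \<in> borel_measurable (\<Pi>\<^sub>M i\<in>I. lborel)"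
        by measurable
      show "(\<integral>\<^sup>+x. (\<Prod>i\<in>I. ennreal (std_normal_density (x i))) * indicator (Pi\<^sub>E I A) x \<partial>(\<Pi>\<^sub>M i\<in>I. lborel))
       = (\<integral>\<^sup>+x. (\<Prod>i\<in>I. ennreal (std_normal_density (x i)) * indicator (A i) (x i)) \<partial>(\<Pi>\<^sub>M i\<in>I. lborel))"
      proof (rule nn_integral_cong)
        fix x assume x: "x \<in> space (\<Pi>\<^sub>M i\<in>I. (lborel::real measure))"
        show "(\<Prod>i\<in>I. ennreal (std_normal_density (x i))) * indicator (Pi\<^sub>E I A) x
          = (\<Prod>i\<in>I. ennreal (std_normal_density (x i)) * indicator (A i) (x i))"
        proof (cases "\<forall>i\<in>I. x i \<in> A i")
          case True
          then have "x \<in> Pi\<^sub>E I A" using x by (auto simp: space_PiM PiE_iff)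
          with True show ?thesis by simp
        next
          case False
          then obtain i where i: "i \<in> I" "x i \<notin> A i" by auto
          then have "x \<notin> Pi\<^sub>E I A" by auto
          moreover have "(\<Prod>i\<in>I. ennreal (std_normal_density (x i)) * indicator (A i) (x i)) = 0"
            using i assms by (intro prod_zero bexI[of _ i]) auto
          ultimately show ?thesis by simp
        qed
      qed
    qed auto
    also have "\<dots> = (\<Prod>i\<in>I. (\<integral>\<^sup>+y. ennreal (std_normal_density y) * indicator (A i) y \<partial>lborel))"
      using A assms by (intro L.product_nn_integral_prod) auto
    also have "\<dots> = (\<Prod>i\<in>I. emeasure std_gauss (A i))"
      using A by (intro prod.cong refl) (auto simp: std_gauss_def emeasure_density)
    finally show "emeasure (density (\<Pi>\<^sub>M i\<in>I. lborel) (\<lambda>x. \<Prod>i\<in>I. ennreal (std_normal_density (x i)))) (Pi\<^sub>E I A)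
        = (\<Prod>i\<in>I. emeasure std_gauss (A i))" .
  next
    show "sets (density (\<Pi>\<^sub>M i\<in>I. lborel) (\<lambda>x. \<Prod>i\<in>I. ennreal (std_normal_density (x i)))) = sets (\<Pi>\<^sub>M i\<in>I. std_gauss)"
      by (simp, intro sets_PiM_cong) auto
  qed (use assms in auto)
  then show ?thesis by simp
qed

section \<open>Inner products over finitely many coordinates, and reflections\<close>

definition ip :: "'i set \<Rightarrow> ('i \<Rightarrow> real) \<Rightarrow> ('i \<Rightarrow> real) \<Rightarrow> real" where
  "ip S a b = (\<Sum>i\<in>S. a i * b i)"

text \<open>Coordinates outside \<open>S\<close> are left alone, so the same formula acts on finite
  and infinite products. If \<open>w\<close> vanishes on \<open>S\<close>, division by zero makes it
  the identity.\<close>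

definition householder :: "'i set \<Rightarrow> ('i \<Rightarrow> real) \<Rightarrow> ('i \<Rightarrow> real) \<Rightarrow> 'i \<Rightarrow> real" where
  "householder S w x = (\<lambda>i. if i \<in> S then x i - 2 * ip S w x / ip S w w * w i else x i)"

lemma ip_add_left: "ip S (\<lambda>i. a i + b i) c = ip S a c + ip S b c"
  by (simp add: ip_def sum.distrib algebra_simps)

lemma ip_diff_left: "ip S (\<lambda>i. a i - b i) c = ip S a c - ip S b c"
  by (simp add: ip_def sum_subtractf algebra_simps)

lemma ip_scale_left: "ip S (\<lambda>i. r * a i) c = r * ip S a c"
  by (simp add: ip_def sum_distrib_left algebra_simps)

lemma ip_commute: "ip S a b = ip S b a"
  by (simp add: ip_def mult.commute)

lemma ip_add_right: "ip S c (\<lambda>i. a i + b i) = ip S c a + ip S c b"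
  by (simp add: ip_def sum.distrib algebra_simps)

lemma ip_diff_right: "ip S c (\<lambda>i. a i - b i) = ip S c a - ip S c b"
  by (simp add: ip_def sum_subtractf algebra_simps)

lemma ip_scale_right: "ip S c (\<lambda>i. r * a i) = r * ip S c a"
  by (simp add: ip_def sum_distrib_left algebra_simps)

lemma ip_sum_left: "ip S (\<lambda>i. \<Sum>n\<in>N. f n i) c = (\<Sum>n\<in>N. ip S (f n) c)"
  unfolding ip_def by (subst sum.swap) (simp add: sum_distrib_right)

lemma ip_sum_right: "ip S c (\<lambda>i. \<Sum>n\<in>N. f n i) = (\<Sum>n\<in>N. ip S c (f n))"
  unfolding ip_def by (subst sum.swap) (simp add: sum_distrib_left)

lemma ip_self_nonneg: "0 \<le> ip S a a"
  by (simp add: ip_def sum_nonneg)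

lemma ip_self_eq_0_iff: "finite S \<Longrightarrow> ip S a a = 0 \<longleftrightarrow> (\<forall>i\<in>S. a i = 0)"
  by (simp add: ip_def sum_nonneg_eq_0_iff)

lemma ip_householder: "ip S a (householder S w x) = ip S a x - 2 * ip S w x / ip S w w * ip S a w"
proof -
  have "ip S a (householder S w x) = ip S a (\<lambda>i. x i - (2 * ip S w x / ip S w w) * w i)"
    unfolding ip_def by (intro sum.cong) (auto simp: householder_def ip_def)
  then show ?thesis by (simp only: ip_diff_right ip_scale_right)
qed

lemma ip_householder_adjoint: "ip S a (householder S w x) = ip S (householder S w a) x"
  by (subst (2) ip_commute) (simp add: ip_householder ip_commute)

lemma ip_householder_householder:
  assumes "finite S"
  shows "ip S (householder S w a) (householder S w b) = ip S a b"
proof (cases "ip S w w = 0")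
  case False
  then show ?thesis
    by (simp add: ip_householder ip_commute[of S "householder S w a"] field_simps)
       (simp add: ip_commute)
next
  case True
  then show ?thesis by (simp add: ip_householder ip_commute[of S "householder S w a"] ip_commute)
qed

text \<open>Stated for any \<open>M\<close> with the Borel sets and any \<open>I\<close> containing
  \<open>S\<close>, to serve Lebesgue and Gaussian products, finite or indexed by a whole
  type.\<close>

lemma measurable_householder [measurable]:
  assumes "finite S" "S \<subseteq> I" "sets M = sets borel"
  shows "householder S w \<in> (\<Pi>\<^sub>M i\<in>I. M) \<rightarrow>\<^sub>M (\<Pi>\<^sub>M i\<in>I. M)"
proof (rule measurable_PiM_single')
  have sp: "space M = (UNIV::real set)" using sets_eq_imp_space_eq[OF assms(3)] by simp
  show "householder S w \<in> space (\<Pi>\<^sub>M i\<in>I. M) \<rightarrow> (\<Pi>\<^sub>E i\<in>I. space M)"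
    using assms(2) by (auto simp: sp space_PiM PiE_iff householder_def extensional_def)
  have c: "(\<lambda>x. x i) \<in> borel_measurable (\<Pi>\<^sub>M i\<in>I. M)" if "i \<in> I" for i
    using measurable_component_singleton[OF that, of "\<lambda>_. M"] assms(3)
      measurable_cong_sets[OF refl assms(3)] by blast
  show "(\<lambda>x. householder S w x i) \<in> (\<Pi>\<^sub>M i\<in>I. M) \<rightarrow>\<^sub>M M" if "i \<in> I" for i
    unfolding measurable_cong_sets[OF refl assms(3)] householder_def ip_def
    using c assms(2) that by (cases "i \<in> S") (auto intro!: borel_measurable_diff borel_measurable_times borel_measurable_divide borel_measurable_sum borel_measurable_const)
qed


text \<open>With \<open>s\<close> the inner product of \<open>w\<close> and \<open>x\<close>, the reflection is a product of three shears: replace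
  one coordinate of \<open>x\<close> by \<open>s\<close>, translate the others by a multiple of \<open>s\<close>, and recover the first
  coordinate from \<open>- s\<close>.\<close>

lemma nn_integral_householder_PiM_lborel:
  fixes F :: "('i \<Rightarrow> real) \<Rightarrow> ennreal"
  assumes S: "finite S"
    and [measurable]: "F \<in> borel_measurable (\<Pi>\<^sub>M i\<in>S. lborel)"
  shows "(\<integral>\<^sup>+x. F (householder S w x) \<partial>(\<Pi>\<^sub>M i\<in>S. lborel)) = (\<integral>\<^sup>+x. F x \<partial>(\<Pi>\<^sub>M i\<in>S. lborel))"
proof (cases "\<exists>c\<in>S. w c \<noteq> 0")
  case False
  then have "householder S w = (\<lambda>x. x)" by (auto simp: householder_def fun_eq_iff)
  then show ?thesis by simp
next
  case True
  then obtain c where c: "c \<in> S" "w c \<noteq> 0" by auto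
  define I where "I = S - {c}"
  have I: "finite I" "c \<notin> I" "S = insert c I" using S c by (auto simp: I_def)
  define N where "N = (\<Pi>\<^sub>M i\<in>I. (lborel :: real measure))"
  define q where "q = ip S w w"
  have qpos: "q \<noteq> 0" using S c unfolding q_def by (subst ip_self_eq_0_iff) auto
  have q_eq: "q = w c * w c + ip I w w" unfolding q_def I(3) using I by (simp add: ip_def)
  define p where "p x = ip I w x" for x
  have [measurable]: "p \<in> borel_measurable N"
    unfolding p_def ip_def N_def by measurable
  \<comment> \<open>\<open>G s x\<close> is \<open>F\<close> at the point whose coordinates in
    \<open>I\<close> are \<open>x\<close> and whose inner product with \<open>w\<close> is
    \<open>- s\<close>: the reflection turns an inner product \<open>s\<close> into
    \<open>- s\<close>.\<close>
  define G where "G s x = F (x(c := (- s - p x) / w c))" for s x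
  interpret product_sigma_finite "\<lambda>_::'i. lborel :: real measure" by standard
  interpret N: sigma_finite_measure N unfolding N_def by (rule sigma_finite[OF I(1)])
  interpret NL: pair_sigma_finite lborel N by standard
  have upd [measurable]: "(\<lambda>(s, x). x(c := (- s - p x) / w c)) \<in> lborel \<Otimes>\<^sub>M N \<rightarrow>\<^sub>M (\<Pi>\<^sub>M i\<in>S. lborel)"
    unfolding split_def
    by (rule measurable_fun_upd[where J=I]) (use I in \<open>auto simp: N_def[symmetric]\<close>)
  have [measurable]: "(\<lambda>(s, x). G s x) \<in> borel_measurable (lborel \<Otimes>\<^sub>M N)"
    using measurable_compose[OF upd assms(2)] by (simp add: G_def split_def)
  define tr where "tr s x = (\<lambda>i\<in>I. x i + (- (2 * s / q)) * w i)" for s and x :: "'i \<Rightarrow> real"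
  have [measurable]: "(\<lambda>(s, x). tr s x) \<in> lborel \<Otimes>\<^sub>M N \<rightarrow>\<^sub>M N"
    unfolding tr_def N_def split_def by measurable
  have tr_space: "x(c := y) \<in> space (\<Pi>\<^sub>M i\<in>S. lborel)" if "x \<in> space N" for x y
    using that I by (auto simp: N_def space_PiM PiE_iff extensional_def)
  have H_eq: "F (householder S w (x(c := y))) = G (w c * y + p x) (tr (w c * y + p x) x)"
    if x: "x \<in> space N" for x y
  proof -
    define s where "s = w c * y + p x"
    have s: "ip S w (x(c := y)) = s"
      unfolding s_def p_def I(3) ip_def using I by (auto intro!: sum.cong)
    have ptr: "p (tr s x) = p x - 2 * s / q * ip I w w"
    proof -
      have "p (tr s x) = ip I w (\<lambda>i. x i - (2 * s / q) * w i)"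
        unfolding p_def ip_def tr_def by (intro sum.cong) auto
      then show ?thesis by (simp only: ip_diff_right ip_scale_right p_def)
    qed
    have "householder S w (x(c := y)) = (tr s x)(c := (- s - p (tr s x)) / w c)"
    proof
      fix i
      consider "i = c" | "i \<in> I" | "i \<notin> S" using I by auto
      then show "householder S w (x(c := y)) i = ((tr s x)(c := (- s - p (tr s x)) / w c)) i"
      proof cases
        case 1
        have e: "ip I w w = q - w c * w c" using q_eq by simp
        have "(- s - p (tr s x)) / w c = y - 2 * s / q * w c"
          unfolding ptr e using c qpos by (simp add: field_simps) (simp add: s_def algebra_simps)
        with 1 c s show ?thesis by (simp add: householder_def q_def)
      next
        case 2
        then show ?thesis using I s by (auto simp: householder_def tr_def q_def)
      next
        case 3
        then show ?thesis using I x by (auto simp: householder_def tr_def N_def space_PiM PiE_iff extensional_def)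
      qed
    qed
    then show ?thesis by (simp add: G_def s_def)
  qed
  have trans: "(\<integral>\<^sup>+x. G s (tr s x) \<partial>N) = (\<integral>\<^sup>+x. G s x \<partial>N)" for s
  proof -
    have "(\<integral>\<^sup>+x. G s x \<partial>N) = (\<integral>\<^sup>+x. G s x \<partial>distr N N (tr s))"
      using distr_PiM_lborel_translate[OF I(1), of "\<lambda>i. - (2 * s / q) * w i"]
      unfolding N_def tr_def by simp
    also have "\<dots> = (\<integral>\<^sup>+x. G s (tr s x) \<partial>N)" by (subst nn_integral_distr) auto
    finally show ?thesis by simp
  qed
  have meas_FH: "(\<lambda>x. \<integral>\<^sup>+y. F (householder S w (x(c := y))) \<partial>lborel) \<in> borel_measurable N"
  proof -
    have "(\<lambda>(x, y). x(c := y)) \<in> N \<Otimes>\<^sub>M lborel \<rightarrow>\<^sub>M (\<Pi>\<^sub>M i\<in>S. lborel)"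
      unfolding split_def
      by (rule measurable_fun_upd[where J=I]) (use I in \<open>auto simp: N_def[symmetric]\<close>)
    from measurable_compose[OF this measurable_compose[OF measurable_householder[OF S subset_refl] assms(2)]]
    have "(\<lambda>(x, y). F (householder S w (x(c := y)))) \<in> borel_measurable (N \<Otimes>\<^sub>M lborel)"
      by (simp add: split_def)
    then show ?thesis
      by (rule sigma_finite_measure.borel_measurable_nn_integral[OF sigma_finite_lborel])
  qed
  have meas_Gtr [measurable]: "(\<lambda>(s, x). G s (tr s x)) \<in> borel_measurable (lborel \<Otimes>\<^sub>M N)"
    by measurable
  \<comment> \<open>The factor \<open>\<bar>w c\<bar>\<close> is the Jacobian of exchanging
    coordinate \<open>c\<close> for the inner product with \<open>w\<close>. It arises on both sides
    and is cancelled at the end.\<close>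
  have "ennreal \<bar>w c\<bar> * (\<integral>\<^sup>+x. F (householder S w x) \<partial>(\<Pi>\<^sub>M i\<in>S. lborel))
      = ennreal \<bar>w c\<bar> * (\<integral>\<^sup>+x. \<integral>\<^sup>+y. F (householder S w (x(c := y))) \<partial>lborel \<partial>N)"
    unfolding I(3) N_def using I
    by (subst product_nn_integral_insert) (auto intro!: measurable_compose[OF measurable_householder] simp: I(3)[symmetric] S)
  also have "\<dots> = (\<integral>\<^sup>+x. ennreal \<bar>w c\<bar> * (\<integral>\<^sup>+y. G (p x + w c * y) (tr (p x + w c * y) x) \<partial>lborel) \<partial>N)"
    using meas_FH by (subst nn_integral_cmult[symmetric]) (auto intro!: nn_integral_cong simp: H_eq add.commute)
  also have "\<dots> = (\<integral>\<^sup>+x. \<integral>\<^sup>+s. G s (tr s x) \<partial>lborel \<partial>N)"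
    using c by (intro nn_integral_cong nn_integral_real_affine[symmetric]) auto
  also have "\<dots> = (\<integral>\<^sup>+s. \<integral>\<^sup>+x. G s (tr s x) \<partial>N \<partial>lborel)"
    by (rule NL.Fubini') simp
  also have "\<dots> = (\<integral>\<^sup>+s. \<integral>\<^sup>+x. G s x \<partial>N \<partial>lborel)" by (simp only: trans)
  also have "\<dots> = (\<integral>\<^sup>+x. \<integral>\<^sup>+s. G s x \<partial>lborel \<partial>N)"
    by (rule NL.Fubini'[symmetric]) simp
  also have "\<dots> = (\<integral>\<^sup>+x. ennreal \<bar>w c\<bar> * (\<integral>\<^sup>+y. F (x(c := y)) \<partial>lborel) \<partial>N)"
  proof (rule nn_integral_cong)
    fix x assume x: "x \<in> space N"
    have [measurable]: "(\<lambda>y. F (x(c := y))) \<in> borel_measurable borel"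
    proof -
      have "(\<lambda>y. x(c := y)) \<in> lborel \<rightarrow>\<^sub>M (\<Pi>\<^sub>M i\<in>S. lborel)"
        by (rule measurable_fun_upd[where J=I]) (use I x in \<open>auto simp: N_def[symmetric]\<close>)
      from measurable_compose[OF this assms(2)] show ?thesis by simp
    qed
    have "(\<integral>\<^sup>+y. F (x(c := y)) \<partial>lborel) = ennreal \<bar>- 1 / w c\<bar> * (\<integral>\<^sup>+s. F (x(c := - p x / w c + (- 1 / w c) * s)) \<partial>lborel)"
      using c by (intro nn_integral_real_affine) auto
    also have "\<dots> = ennreal \<bar>- 1 / w c\<bar> * (\<integral>\<^sup>+s. G s x \<partial>lborel)"
      unfolding G_def by (simp add: diff_divide_distrib algebra_simps)
    finally show "(\<integral>\<^sup>+s. G s x \<partial>lborel) = ennreal \<bar>w c\<bar> * (\<integral>\<^sup>+y. F (x(c := y)) \<partial>lborel)"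
      using c by (simp add: mult.assoc[symmetric] ennreal_mult[symmetric])
  qed
  also have "\<dots> = ennreal \<bar>w c\<bar> * (\<integral>\<^sup>+x. \<integral>\<^sup>+y. F (x(c := y)) \<partial>lborel \<partial>N)"
  proof (rule nn_integral_cmult)
    have "(\<lambda>(x, y). x(c := y)) \<in> N \<Otimes>\<^sub>M lborel \<rightarrow>\<^sub>M (\<Pi>\<^sub>M i\<in>S. lborel)"
      unfolding split_def
      by (rule measurable_fun_upd[where J=I]) (use I in \<open>auto simp: N_def[symmetric]\<close>)
    from measurable_compose[OF this assms(2)]
    have "(\<lambda>(x, y). F (x(c := y))) \<in> borel_measurable (N \<Otimes>\<^sub>M lborel)" by (simp add: split_def)
    then show "(\<lambda>x. \<integral>\<^sup>+y. F (x(c := y)) \<partial>lborel) \<in> borel_measurable N"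
      by (rule sigma_finite_measure.borel_measurable_nn_integral[OF sigma_finite_lborel])
  qed
  also have "\<dots> = ennreal \<bar>w c\<bar> * (\<integral>\<^sup>+x. F x \<partial>(\<Pi>\<^sub>M i\<in>S. lborel))"
    unfolding I(3) N_def using I by (subst product_nn_integral_insert) (auto simp: I(3)[symmetric])
  finally show ?thesis
    using c by (subst (asm) ennreal_mult_cancel_left) auto
qed

text \<open>The Gaussian density is a function of \<open>ip S x x\<close>, which the reflection
  preserves, so invariance of Lebesgue measure suffices.\<close>

lemma distr_householder_finite_gauss:
  assumes S: "finite S"
  shows "distr (\<Pi>\<^sub>M i\<in>S. std_gauss) (\<Pi>\<^sub>M i\<in>S. std_gauss) (householder S w) = (\<Pi>\<^sub>M i\<in>S. std_gauss)"
proof (rule measure_eqI)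
  define D where "D x = (\<Prod>i\<in>S. ennreal (std_normal_density (x i)))" for x
  have [measurable]: "D \<in> borel_measurable (\<Pi>\<^sub>M i\<in>S. lborel)" unfolding D_def by measurable
  have D_eq: "D x = ennreal ((1 / sqrt (2 * pi)) ^ card S * exp (- ip S x x / 2))" for x
    unfolding D_def using S
    by (subst prod_ennreal)
       (auto simp: std_normal_density_def prod.distrib prod_dividef ip_def power2_eq_square
          exp_sum[symmetric] sum_negf sum_divide_distrib power_divide)
  have D_H: "D (householder S w x) = D x" for x
    using S by (simp add: D_eq ip_householder_householder)
  have G: "(\<Pi>\<^sub>M i\<in>S. std_gauss) = density (\<Pi>\<^sub>M i\<in>S. lborel) D"
    unfolding D_def[abs_def] by (rule PiM_std_gauss_eq_density[OF S])
  have [measurable]: "householder S w \<in> (\<Pi>\<^sub>M i\<in>S. lborel) \<rightarrow>\<^sub>M (\<Pi>\<^sub>M i\<in>S. lborel)"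
    using S by (intro measurable_householder) auto
  fix A assume "A \<in> sets (distr (\<Pi>\<^sub>M i\<in>S. std_gauss) (\<Pi>\<^sub>M i\<in>S. std_gauss) (householder S w))"
  then have A [measurable]: "A \<in> sets (\<Pi>\<^sub>M i\<in>S. lborel)" unfolding G by simp
  have "emeasure (distr (\<Pi>\<^sub>M i\<in>S. std_gauss) (\<Pi>\<^sub>M i\<in>S. std_gauss) (householder S w)) A
      = (\<integral>\<^sup>+x. D x * indicator A (householder S w x) \<partial>(\<Pi>\<^sub>M i\<in>S. lborel))"
    unfolding G
    by (subst emeasure_distr, simp, simp, subst emeasure_density)
       (auto intro!: nn_integral_cong split: split_indicator)
  also have "\<dots> = (\<integral>\<^sup>+x. D (householder S w x) * indicator A (householder S w x) \<partial>(\<Pi>\<^sub>M i\<in>S. lborel))"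
    by (simp add: D_H)
  also have "\<dots> = (\<integral>\<^sup>+x. D x * indicator A x \<partial>(\<Pi>\<^sub>M i\<in>S. lborel))"
    by (rule nn_integral_householder_PiM_lborel[OF S]) measurable
  also have "\<dots> = emeasure (\<Pi>\<^sub>M i\<in>S. std_gauss) A"
    unfolding G by (simp add: emeasure_density)
  finally show "emeasure (distr (\<Pi>\<^sub>M i\<in>S. std_gauss) (\<Pi>\<^sub>M i\<in>S. std_gauss) (householder S w)) A
      = emeasure (\<Pi>\<^sub>M i\<in>S. std_gauss) A" .
qed simp

text \<open>The product measure is determined by cylinders. Enlarging the base \<open>J\<close> of a
  cylinder by \<open>S\<close>, with \<open>w\<close> extended by zero, makes the reflection act
  inside finitely many coordinates.\<close>

lemma distr_householder_gauss:
  fixes S :: "'i set"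
  assumes S: "finite S"
  shows "distr (\<Pi>\<^sub>M i\<in>UNIV. std_gauss) (\<Pi>\<^sub>M i\<in>UNIV. std_gauss) (householder S w) = (\<Pi>\<^sub>M i\<in>UNIV. std_gauss)"
proof -
  interpret G: product_prob_space "\<lambda>_::'i. std_gauss" UNIV
    by (intro product_prob_spaceI prob_space_std_gauss)
  have [measurable]: "householder S w \<in> (\<Pi>\<^sub>M i\<in>UNIV. std_gauss) \<rightarrow>\<^sub>M (\<Pi>\<^sub>M i\<in>UNIV. std_gauss)"
    using S by (intro measurable_householder) auto
  show ?thesis
  proof (rule G.PiM_eq)
    fix J :: "'i set" and F assume J: "finite J" and F: "\<And>j. j \<in> J \<Longrightarrow> F j \<in> sets std_gauss"
    define J' where "J' = J \<union> S"
    define w' where "w' i = (if i \<in> S then w i else 0)" for i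
    define B where "B = prod_emb J' (\<lambda>_. std_gauss) J (Pi\<^sub>E J F)"
    have J': "finite J'" using J S by (simp add: J'_def)
    have B [measurable]: "B \<in> sets (\<Pi>\<^sub>M i\<in>J'. std_gauss)"
      unfolding B_def using J F by (intro sets_PiM_I) (auto simp: J'_def)
    have ipw: "ip J' w' y = ip S w y" for y
      unfolding ip_def J'_def w'_def using J S by (intro sum.mono_neutral_cong_right) auto
    have "ip J' w' w' = ip S w w" by (subst ipw) (auto simp: ip_def w'_def)
    then have H: "householder J' w' (restrict x J') i = householder S w x i" if "i \<in> J'" for x i
      using that unfolding householder_def ipw
      by (auto simp: w'_def ip_def J'_def)
    have Hm [measurable]: "householder J' w' \<in> (\<Pi>\<^sub>M i\<in>J'. std_gauss) \<rightarrow>\<^sub>M (\<Pi>\<^sub>M i\<in>J'. std_gauss)"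
      using J' by (intro measurable_householder) auto
    let ?E = "prod_emb UNIV (\<lambda>_. std_gauss) J (Pi\<^sub>E J F)"
    have E: "?E \<in> sets (\<Pi>\<^sub>M i\<in>UNIV. std_gauss)"
      using J F by (intro sets_PiM_I) auto
    have "emeasure (distr (\<Pi>\<^sub>M i\<in>UNIV. std_gauss) (\<Pi>\<^sub>M i\<in>UNIV. std_gauss) (householder S w)) ?E
        = emeasure (\<Pi>\<^sub>M i\<in>UNIV. std_gauss) (householder S w -` ?E)"
      using E by (subst emeasure_distr) (auto simp: space_PiM)
    also have "householder S w -` ?E = (\<lambda>x. restrict x J') -` (householder J' w' -` B \<inter> space (\<Pi>\<^sub>M i\<in>J'. std_gauss))"
      using H by (auto simp: B_def prod_emb_def space_PiM PiE_iff J'_def householder_def extensional_def restrict_def fun_eq_iff)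
    also have "emeasure (\<Pi>\<^sub>M i\<in>UNIV. std_gauss) \<dots>
        = emeasure (distr (\<Pi>\<^sub>M i\<in>UNIV. std_gauss) (\<Pi>\<^sub>M i\<in>J'. std_gauss) (\<lambda>x. restrict x J')) (householder J' w' -` B \<inter> space (\<Pi>\<^sub>M i\<in>J'. std_gauss))"
      using measurable_sets[OF Hm B] by (subst emeasure_distr) (auto simp: space_PiM)
    also have "\<dots> = emeasure (\<Pi>\<^sub>M i\<in>J'. std_gauss) (householder J' w' -` B \<inter> space (\<Pi>\<^sub>M i\<in>J'. std_gauss))"
      using J' by (subst G.distr_PiM_restrict_finite) auto
    also have "\<dots> = emeasure (distr (\<Pi>\<^sub>M i\<in>J'. std_gauss) (\<Pi>\<^sub>M i\<in>J'. std_gauss) (householder J' w')) B"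
      by (subst emeasure_distr) auto
    also have "\<dots> = emeasure (\<Pi>\<^sub>M i\<in>J'. std_gauss) B"
      by (subst distr_householder_finite_gauss[OF J']) simp
    also have "\<dots> = (\<Prod>j\<in>J. emeasure std_gauss (F j))"
      unfolding B_def using J F by (intro emeasure_PiM_emb prob_space_std_gauss) (auto simp: J'_def)
    finally show "emeasure (distr (\<Pi>\<^sub>M i\<in>UNIV. std_gauss) (\<Pi>\<^sub>M i\<in>UNIV. std_gauss) (householder S w)) ?E
       = (\<Prod>j\<in>J. emeasure std_gauss (F j))" .
  qed simp
qed

text \<open>The isometry is built one pair at a time: the reflection along the difference of the current
  image of \<open>a\<close> and \<open>b\<close> moves the former to the latter, and it fixes the images of the earlier pairs
  because these are orthogonal to the difference.\<close>

lemma gauss_isometry: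
  fixes P :: "(('i \<Rightarrow> real) \<times> ('i \<Rightarrow> real)) set"
  assumes S: "finite S" and "finite P"
    and "\<And>a b a' b'. (a, b) \<in> P \<Longrightarrow> (a', b') \<in> P \<Longrightarrow> ip S a a' = ip S b b'"
  shows "\<exists>T. T \<in> (\<Pi>\<^sub>M i\<in>UNIV. std_gauss) \<rightarrow>\<^sub>M (\<Pi>\<^sub>M i\<in>UNIV. std_gauss) \<and>
    distr (\<Pi>\<^sub>M i\<in>UNIV. std_gauss) (\<Pi>\<^sub>M i\<in>UNIV. std_gauss) T = (\<Pi>\<^sub>M i\<in>UNIV. std_gauss) \<and>
    (\<exists>U. (\<forall>a x. ip S a (T x) = ip S (U a) x) \<and> (\<forall>a b. ip S (U a) (U b) = ip S a b) \<and>
      (\<forall>(a, b)\<in>P. \<forall>i\<in>S. U a i = b i))"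
  using assms(2,3)
proof (induction P)
  case empty
  show ?case by (rule exI[of _ "\<lambda>x. x"]) (auto intro!: exI[of _ "\<lambda>a. a"])
next
  case (insert p P)
  let ?G = "(\<Pi>\<^sub>M i\<in>UNIV. std_gauss) :: ('i \<Rightarrow> real) measure"
  obtain a b where p: "p = (a, b)" by (cases p)
  have "\<exists>T. T \<in> ?G \<rightarrow>\<^sub>M ?G \<and> distr ?G ?G T = ?G \<and>
    (\<exists>U. (\<forall>a x. ip S a (T x) = ip S (U a) x) \<and> (\<forall>a b. ip S (U a) (U b) = ip S a b) \<and>
      (\<forall>(a, b)\<in>P. \<forall>i\<in>S. U a i = b i))"
    using insert.prems by (intro insert.IH) blast
  then obtain T U where T: "T \<in> ?G \<rightarrow>\<^sub>M ?G" "distr ?G ?G T = ?G"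
    and U: "\<And>a x. ip S a (T x) = ip S (U a) x" "\<And>a b. ip S (U a) (U b) = ip S a b"
    and UP: "\<And>a b i. (a, b) \<in> P \<Longrightarrow> i \<in> S \<Longrightarrow> U a i = b i"
    by fastforce
  define w where "w i = U a i - b i" for i
  let ?H = "householder S w"
  have H: "?H \<in> ?G \<rightarrow>\<^sub>M ?G" using S by (intro measurable_householder) auto
  have ip_cong: "ip S x y = ip S x' y'" if "\<And>i. i \<in> S \<Longrightarrow> x i = x' i" "\<And>i. i \<in> S \<Longrightarrow> y i = y' i" for x y x' y'
    unfolding ip_def using that by (intro sum.cong) auto
  have fixP: "?H (U a') i = b' i" if "(a', b') \<in> P" "i \<in> S" for a' b' i
  proof -
    have "ip S w (U a') = ip S (U a) (U a') - ip S b (U a')"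
      unfolding w_def by (rule ip_diff_left)
    also have "ip S b (U a') = ip S b b'" using UP that by (intro ip_cong) auto
    also have "\<dots> = ip S a a'" using insert.prems[of a b a' b'] that p by simp
    finally have "ip S w (U a') = 0" by (simp add: U)
    then show ?thesis using UP that by (simp add: householder_def)
  qed
  have fixp: "?H (U a) i = b i" if "i \<in> S" for i
  proof (cases "ip S w w = 0")
    case True
    then have "w i = 0" using that S by (simp add: ip_self_eq_0_iff)
    then show ?thesis using that by (simp add: householder_def w_def)
  next
    case False
    \<comment> \<open>Equal norms of \<open>U a\<close> and \<open>b\<close> make
      \<open>ip S w w\<close> twice \<open>ip S w (U a)\<close>, so the reflection subtracts exactly
      \<open>w\<close>.\<close>
    have nb: "ip S (U a) (U a) = ip S b b" using insert.prems[of a b a b] p by (simp add: U)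
    have "ip S w w = 2 * ip S w (U a)"
      unfolding w_def by (simp add: ip_diff_left ip_diff_right nb ip_commute)
    then show ?thesis using False that by (simp add: householder_def w_def)
  qed
  show ?case
  proof (rule exI[of _ "\<lambda>x. T (?H x)"], intro conjI)
    show "(\<lambda>x. T (?H x)) \<in> ?G \<rightarrow>\<^sub>M ?G" using T H by simp
    have "distr ?G ?G (\<lambda>x. T (?H x)) = distr (distr ?G ?G ?H) ?G T"
      using T H by (subst distr_distr) (auto simp: comp_def)
    then show "distr ?G ?G (\<lambda>x. T (?H x)) = ?G"
      using T distr_householder_gauss[OF S, of w] by simp
    show "\<exists>U. (\<forall>a x. ip S a (T (?H x)) = ip S (U a) x) \<and> (\<forall>a b. ip S (U a) (U b) = ip S a b) \<and>
      (\<forall>(a, b)\<in>insert p P. \<forall>i\<in>S. U a i = b i)"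
    proof (rule exI[of _ "\<lambda>a. ?H (U a)"], intro conjI allI)
      show "ip S a (T (?H x)) = ip S (?H (U a)) x" for a x
        by (simp only: U(1) ip_householder_adjoint)
      show "ip S (?H (U a)) (?H (U b)) = ip S a b" for a b
        by (simp only: ip_householder_householder[OF S] U(2))
      show "\<forall>(a, b)\<in>insert p P. \<forall>i\<in>S. ?H (U a) i = b i"
        using fixp fixP by (auto simp: p)
    qed
  qed
qed

corollary gauss_isometry_ip:
  fixes P :: "(('i \<Rightarrow> real) \<times> ('i \<Rightarrow> real)) set"
  assumes "finite S" "finite P"
    and "\<And>a b a' b'. (a, b) \<in> P \<Longrightarrow> (a', b') \<in> P \<Longrightarrow> ip S a a' = ip S b b'"
  obtains T where "T \<in> (\<Pi>\<^sub>M i\<in>UNIV. std_gauss) \<rightarrow>\<^sub>M (\<Pi>\<^sub>M i\<in>UNIV. std_gauss)"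
    "distr (\<Pi>\<^sub>M i\<in>UNIV. std_gauss) (\<Pi>\<^sub>M i\<in>UNIV. std_gauss) T = (\<Pi>\<^sub>M i\<in>UNIV. std_gauss)"
    "\<And>a b x. (a, b) \<in> P \<Longrightarrow> ip S a (T x) = ip S b x"
proof -
  from gauss_isometry[OF assms] obtain T U where T: "T \<in> (\<Pi>\<^sub>M i\<in>UNIV. std_gauss) \<rightarrow>\<^sub>M (\<Pi>\<^sub>M i\<in>UNIV. std_gauss)"
    "distr (\<Pi>\<^sub>M i\<in>UNIV. std_gauss) (\<Pi>\<^sub>M i\<in>UNIV. std_gauss) T = (\<Pi>\<^sub>M i\<in>UNIV. std_gauss)"
    and U: "\<And>a x. ip S a (T x) = ip S (U a) x" "\<And>a b i. (a, b) \<in> P \<Longrightarrow> i \<in> S \<Longrightarrow> U a i = b i"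
    by fastforce
  show thesis
  proof (rule that[OF T])
    fix a b x assume "(a, b) \<in> P"
    with U(2) show "ip S a (T x) = ip S b x"
      unfolding U(1) by (auto simp: ip_def intro!: sum.cong)
  qed
qed

text \<open>Each \<open>T c\<close> respects the event \<open>p x = c\<close>. The preimage of
  \<open>A\<close> under the combined map is therefore a disjoint union of preimages, under the
  single \<open>T c\<close>, of the part of \<open>A\<close> where \<open>p\<close> is
  \<open>c\<close>.\<close>

lemma distr_piecewise:
  assumes fin: "finite C" and p [measurable]: "p \<in> M \<rightarrow>\<^sub>M count_space UNIV"
    and pC: "\<And>x. x \<in> space M \<Longrightarrow> p x \<in> C"
    and T [measurable]: "\<And>c. c \<in> C \<Longrightarrow> T c \<in> M \<rightarrow>\<^sub>M M"
    and inv: "\<And>c. c \<in> C \<Longrightarrow> distr M M (T c) = M"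
    and comm: "\<And>c x. c \<in> C \<Longrightarrow> x \<in> space M \<Longrightarrow> p (T c x) = c \<longleftrightarrow> p x = c"
  shows "(\<lambda>x. T (p x) x) \<in> M \<rightarrow>\<^sub>M M" and "distr M M (\<lambda>x. T (p x) x) = M"
proof -
  have pc [measurable]: "p -` {c} \<inter> space M \<in> sets M" for c
    by (rule measurable_sets[OF p]) simp
  show m [measurable]: "(\<lambda>x. T (p x) x) \<in> M \<rightarrow>\<^sub>M M"
  proof (rule measurableI)
    fix x assume "x \<in> space M"
    then show "T (p x) x \<in> space M" using pC T measurable_space by metis
  next
    fix A assume A [measurable]: "A \<in> sets M"
    have "(\<lambda>x. T (p x) x) -` A \<inter> space M = (\<Union>c\<in>C. (T c -` A \<inter> space M) \<inter> (p -` {c} \<inter> space M))"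
      using pC by auto
    also have "\<dots> \<in> sets M"
      using fin A T pc by (intro sets.finite_UN) (auto intro!: sets.Int[OF _ pc] measurable_sets)
    finally show "(\<lambda>x. T (p x) x) -` A \<inter> space M \<in> sets M" .
  qed
  show "distr M M (\<lambda>x. T (p x) x) = M"
  proof (rule measure_eqI)
    fix A assume "A \<in> sets (distr M M (\<lambda>x. T (p x) x))"
    then have A [measurable]: "A \<in> sets M" by simp
    have "emeasure (distr M M (\<lambda>x. T (p x) x)) A = emeasure M ((\<lambda>x. T (p x) x) -` A \<inter> space M)"
      by (simp add: emeasure_distr)
    also have "(\<lambda>x. T (p x) x) -` A \<inter> space M = (\<Union>c\<in>C. (T c -` (A \<inter> (p -` {c} \<inter> space M)) \<inter> space M))"
      using pC comm measurable_space[OF T] by auto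
    also have "emeasure M \<dots> = (\<Sum>c\<in>C. emeasure M (T c -` (A \<inter> (p -` {c} \<inter> space M)) \<inter> space M))"
    proof (rule sum_emeasure[symmetric])
      show "(\<lambda>c. T c -` (A \<inter> (p -` {c} \<inter> space M)) \<inter> space M) ` C \<subseteq> sets M"
        using sets.Int[OF A pc] measurable_sets[OF T] by blast
      show "disjoint_family_on (\<lambda>c. T c -` (A \<inter> (p -` {c} \<inter> space M)) \<inter> space M) C"
        using comm by (auto simp: disjoint_family_on_def)
    qed (rule fin)
    also have "\<dots> = (\<Sum>c\<in>C. emeasure (distr M M (T c)) (A \<inter> (p -` {c} \<inter> space M)))"
      using T by (intro sum.cong refl emeasure_distr[symmetric]) auto
    also have "\<dots> = (\<Sum>c\<in>C. emeasure M (A \<inter> (p -` {c} \<inter> space M)))"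
      using inv by simp
    also have "\<dots> = emeasure M (\<Union>c\<in>C. A \<inter> (p -` {c} \<inter> space M))"
      using fin by (intro sum_emeasure) (auto simp: disjoint_family_on_def)
    also have "(\<Union>c\<in>C. A \<inter> (p -` {c} \<inter> space M)) = A"
      using pC sets.sets_into_space[OF A] by auto
    finally show "emeasure (distr M M (\<lambda>x. T (p x) x)) A = emeasure M A" .
  qed simp
qed

section \<open>Positive semidefinite matrices\<close>

text \<open>A positive definite matrix has trivial kernel, hence nonzero determinant. This
  guarantees that the choice made in \<open>lin_solve\<close> is a genuine solution.\<close>

lemma positive_definite_solvable:
  fixes M :: "nat \<Rightarrow> nat \<Rightarrow> real"
  assumes pd: "\<And>x. \<exists>a<n. x a \<noteq> 0 \<Longrightarrow> (\<Sum>a<n. \<Sum>b<n. x a * M a b * x b) > 0"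
  shows "\<exists>x. \<forall>a<n. (\<Sum>b<n. M a b * x b) = v a"
proof -
  define A where "A = Matrix.mat n n (\<lambda>(a, b). M a b)"
  have A: "A \<in> carrier_mat n n" by (simp add: A_def)
  have mv: "vec_index (A *\<^sub>v x) a = (\<Sum>b<n. M a b * (vec_index x b))" if "x \<in> carrier_vec n" "a < n" for x a
    using that by (simp add: A_def scalar_prod_def lessThan_atLeast0)
  have "Determinant.det A \<noteq> 0"
  proof
    assume "Determinant.det A = 0"
    then obtain x where x: "x \<in> carrier_vec n" "x \<noteq> 0\<^sub>v n" "A *\<^sub>v x = 0\<^sub>v n"
      using det_0_iff_vec_prod_zero_field[OF A] by auto
    have "\<exists>a<n. vec_index x a \<noteq> 0" using x(1,2) by (auto simp: vec_eq_iff)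
    from pd[OF this] have "(\<Sum>a<n. vec_index x a * (\<Sum>b<n. M a b * (vec_index x b))) > 0"
      by (simp add: sum_distrib_left mult.assoc)
    moreover have "(\<Sum>b<n. M a b * (vec_index x b)) = 0" if "a < n" for a
      using mv[OF x(1) that] x(3) that by simp
    ultimately show False by simp
  qed
  then have "A \<in> Units (ring_mat TYPE(real) n ())" by (rule det_non_zero_imp_unit[OF A])
  then obtain B where B: "B \<in> carrier_mat n n" "A * B = 1\<^sub>m n"
    by (auto simp: Units_def ring_mat_def)
  define x where "x = B *\<^sub>v Matrix.vec n v"
  have x: "x \<in> carrier_vec n" using B by (auto simp: x_def)
  have "A *\<^sub>v x = Matrix.vec n v"
    unfolding x_def using A B by (subst assoc_mult_mat_vec[symmetric]) auto
  then have "\<forall>a<n. (\<Sum>b<n. M a b * (vec_index x b)) = v a"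
    using mv[OF x] by auto
  then show ?thesis by blast
qed

text \<open>Schur complement formula, with a solution \<open>\<beta>\<close> of the linear system in
  place of an inverse block: the unipotent matrix \<open>U\<close> subtracts the combination
  \<open>\<beta>\<close> of the first \<open>n\<close> columns from the last one, which leaves a
  block triangular matrix.\<close>

lemma det_border:
  fixes M :: "nat \<Rightarrow> nat \<Rightarrow> real"
  assumes "\<And>a. a < n \<Longrightarrow> (\<Sum>b<n. M a b * \<beta> b) = M a n"
  shows "Determinant.det (Matrix.mat (Suc n) (Suc n) (\<lambda>(a, b). M a b))
       = Determinant.det (Matrix.mat n n (\<lambda>(a, b). M a b)) * (M n n - (\<Sum>b<n. M n b * \<beta> b))"
proof -
  define A where "A = Matrix.mat (Suc n) (Suc n) (\<lambda>(a, b). M a b)"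
  define U where "U = Matrix.mat (Suc n) (Suc n)
    (\<lambda>(i, j). if j = n then (if i = n then 1 else - \<beta> i) else if i = j then 1 else (0::real))"
  define s where "s = M n n - (\<Sum>b<n. M n b * \<beta> b)"
  have AU: "A \<in> carrier_mat (Suc n) (Suc n)" "U \<in> carrier_mat (Suc n) (Suc n)"
    by (simp_all add: A_def U_def)
  have "Determinant.det U = prod_list (diag_mat U)"
    using AU(2) by (intro det_upper_triangular[of _ "Suc n"]) (auto simp: upper_triangular_def U_def)
  also have "\<dots> = 1"
    by (auto simp: prod_list_diag_prod U_def)
  finally have dU: "Determinant.det U = 1" .
  have "A * U = four_block_mat (Matrix.mat n n (\<lambda>(a, b). M a b)) (0\<^sub>m n 1)
      (Matrix.mat 1 n (\<lambda>(a, b). M n b)) (Matrix.mat 1 1 (\<lambda>_. s))"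
  proof (rule eq_matI)
    fix i j assume ij: "i < dim_row (four_block_mat (Matrix.mat n n (\<lambda>(a, b). M a b)) (0\<^sub>m n 1)
      (Matrix.mat 1 n (\<lambda>(a, b). M n b)) (Matrix.mat 1 1 (\<lambda>_. s)))"
      "j < dim_col (four_block_mat (Matrix.mat n n (\<lambda>(a, b). M a b)) (0\<^sub>m n 1)
      (Matrix.mat 1 n (\<lambda>(a, b). M n b)) (Matrix.mat 1 1 (\<lambda>_. s)))"
    then have ij': "i < Suc n" "j < Suc n" by auto
    have "(A * U) $$ (i, j) = (\<Sum>l<Suc n. M i l * U $$ (l, j))"
      using ij' AU by (auto simp: scalar_prod_def A_def lessThan_atLeast0 intro!: sum.cong)
    also have "\<dots> = (if j = n then M i n - (\<Sum>l<n. M i l * \<beta> l) else M i j)"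
    proof (cases "j = n")
      case True
      then show ?thesis by (simp add: U_def sum_negf)
    next
      case False
      then have "(\<Sum>l<Suc n. M i l * U $$ (l, j)) = (\<Sum>l<Suc n. if l = j then M i l else 0)"
        using ij' by (intro sum.cong) (auto simp: U_def)
      then show ?thesis using False ij' by simp
    qed
    finally show "(A * U) $$ (i, j) = four_block_mat (Matrix.mat n n (\<lambda>(a, b). M a b)) (0\<^sub>m n 1)
      (Matrix.mat 1 n (\<lambda>(a, b). M n b)) (Matrix.mat 1 1 (\<lambda>_. s)) $$ (i, j)"
      using ij' assms[of i] by (auto simp: s_def less_Suc_eq)
  qed (use AU in auto)
  then have "Determinant.det (A * U) = Determinant.det (Matrix.mat n n (\<lambda>(a, b). M a b)) * Determinant.det (Matrix.mat 1 1 (\<lambda>_. s))"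
    by (simp, intro det_four_block_mat_upper_right_zero_col) auto
  moreover have "Determinant.det (A * U) = Determinant.det A"
    using det_mult[OF AU] dU by simp
  moreover have "Determinant.det (Matrix.mat 1 1 (\<lambda>_. s)) = s"
    by (subst det_single) auto
  ultimately show ?thesis by (simp add: A_def s_def)
qed

text \<open>Cholesky elimination of one index at a time: the Schur complement \<open>Q'\<close> of
  the entry \<open>Q x x\<close> is again positive semidefinite. If that entry is \<open>0\<close>,
  its row vanishes too, and division by zero leaves \<open>Q\<close> unchanged.\<close>

lemma psd_sqrt_exists:
  fixes Q :: "'i \<Rightarrow> 'i \<Rightarrow> real"
  assumes "finite X" "\<And>a b. a \<in> X \<Longrightarrow> b \<in> X \<Longrightarrow> Q a b = Q b a"
    "\<And>c. (\<Sum>a\<in>X. \<Sum>b\<in>X. c a * c b * Q a b) \<ge> 0"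
  shows "\<exists>A. \<forall>a\<in>X. \<forall>b\<in>X. (\<Sum>c\<in>X. A a c * A b c) = Q a b"
  using assms
proof (induction X arbitrary: Q)
  case empty
  show ?case by simp
next
  case (insert x X)
  have sym: "Q a b = Q b a" if "a \<in> insert x X" "b \<in> insert x X" for a b
    using insert.prems(1) that by blast
  have form: "0 \<le> c x * c x * Q x x + 2 * c x * (\<Sum>a\<in>X. c a * Q a x) + (\<Sum>a\<in>X. \<Sum>b\<in>X. c a * c b * Q a b)" for c
  proof -
    have "(\<Sum>b\<in>X. c x * c b * Q x b) = c x * (\<Sum>a\<in>X. c a * Q a x)"
      using sym by (auto simp: sum_distrib_left mult.assoc intro!: sum.cong)
    moreover have "(\<Sum>a\<in>X. c a * c x * Q a x) = c x * (\<Sum>a\<in>X. c a * Q a x)"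
      by (auto simp: sum_distrib_left intro!: sum.cong)
    ultimately have "(\<Sum>a\<in>insert x X. \<Sum>b\<in>insert x X. c a * c b * Q a b) =
       c x * c x * Q x x + 2 * c x * (\<Sum>a\<in>X. c a * Q a x) + (\<Sum>a\<in>X. \<Sum>b\<in>X. c a * c b * Q a b)"
      using insert.hyps by (simp add: sum.distrib)
    then show ?thesis using insert.prems(2)[of c] by simp
  qed
  have form1: "0 \<le> t * t * Q x x + 2 * t * Q a x + Q a a" if "a \<in> X" for a t
  proof -
    define c where "c b = (if b = x then t else if b = a then 1 else 0)" for b
    have "(\<Sum>a'\<in>X. c a' * Q a' x) = (\<Sum>a'\<in>X. if a' = a then Q a' x else 0)"
      using insert.hyps by (intro sum.cong) (auto simp: c_def)
    moreover have "(\<Sum>a'\<in>X. \<Sum>b\<in>X. c a' * c b * Q a' b) = (\<Sum>a'\<in>X. if a' = a then Q a a else 0)"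
    proof (intro sum.cong refl)
      fix a' assume "a' \<in> X"
      have "(\<Sum>b\<in>X. c a' * c b * Q a' b) = (\<Sum>b\<in>X. if b = a then (if a' = a then Q a a else 0) else 0)"
        using insert.hyps \<open>a' \<in> X\<close> by (intro sum.cong) (auto simp: c_def)
      also have "\<dots> = (if a' = a then Q a a else 0)" using insert.hyps that by simp
      finally show "(\<Sum>b\<in>X. c a' * c b * Q a' b) = (if a' = a then Q a a else 0)" .
    qed
    moreover have "c x = t" by (simp add: c_def)
    ultimately show ?thesis using form[of c] insert.hyps that by simp
  qed
  have diag: "0 \<le> Q x x"
  proof -
    have z: "(\<Sum>a\<in>X. (if a = x then 1 else 0) * Q a x) = 0"
      "(\<Sum>a\<in>X. \<Sum>b\<in>X. (if a = x then 1 else 0) * (if b = x then 1 else 0) * Q a b) = 0"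
      using insert.hyps by (auto intro!: sum.neutral)
    show ?thesis using form[of "\<lambda>b. if b = x then 1 else 0"] unfolding z by simp
  qed
  define Q' where "Q' a b = Q a b - Q a x * Q b x / Q x x" for a b
  have "0 \<le> (\<Sum>a\<in>X. \<Sum>b\<in>X. c a * c b * Q' a b)" for c
  proof -
    define p where "p = (\<Sum>a\<in>X. c a * Q a x)"
    \<comment> \<open>For nonzero \<open>Q x x\<close>, the value at \<open>x\<close> that minimises
      the form once the other coefficients are given; the minimum is the form of
      \<open>Q'\<close>.\<close>
    define c' where "c' = c(x := - p / Q x x)"
    have cX: "c' a = c a" if "a \<in> X" for a using that insert.hyps by (auto simp: c'_def)
    have "(\<Sum>a\<in>X. \<Sum>b\<in>X. c a * c b * Q' a b)
      = (\<Sum>a\<in>X. \<Sum>b\<in>X. c a * c b * Q a b) - (\<Sum>a\<in>X. \<Sum>b\<in>X. (c a * Q a x) * (c b * Q b x) / Q x x)"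
      by (simp add: Q'_def right_diff_distrib sum_subtractf mult_ac)
    also have "(\<Sum>a\<in>X. \<Sum>b\<in>X. (c a * Q a x) * (c b * Q b x) / Q x x) = p * p / Q x x"
      by (simp add: p_def sum_product sum_divide_distrib)
    also have "(\<Sum>a\<in>X. \<Sum>b\<in>X. c a * c b * Q a b) - p * p / Q x x
       = c' x * c' x * Q x x + 2 * c' x * p + (\<Sum>a\<in>X. \<Sum>b\<in>X. c a * c b * Q a b)"
      by (cases "Q x x = 0") (simp_all add: c'_def field_simps)
    also have "\<dots> \<ge> 0"
      using form[of c'] by (simp add: cX p_def cong: sum.cong)
    finally show ?thesis .
  qed
  moreover have "Q' a b = Q' b a" if "a \<in> X" "b \<in> X" for a b
    using that sym[of a b] by (simp add: Q'_def mult.commute)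
  ultimately obtain A where A: "\<And>a b. a \<in> X \<Longrightarrow> b \<in> X \<Longrightarrow> (\<Sum>c\<in>X. A a c * A b c) = Q' a b"
    using insert.IH[of Q'] by blast
  have zero: "Q a x = 0" if "a \<in> X" "Q x x = 0" for a
  proof (rule ccontr)
    assume "Q a x \<noteq> 0"
    \<comment> \<open>With \<open>Q x x = 0\<close> the form in \<open>form1\<close> is affine in
      \<open>t\<close>, and this \<open>t\<close> makes it equal to \<open>- 1\<close>.\<close>
    then show False using form1[OF that(1), of "- (Q a a + 1) / (2 * Q a x)"] that(2)
      by (simp add: field_simps)
  qed
  define A' where "A' a c = (if c = x then Q a x / sqrt (Q x x) else if a = x then 0 else A a c)" for a c
  have "(\<Sum>c\<in>insert x X. A' a c * A' b c) = Q a b" if ab: "a \<in> insert x X" "b \<in> insert x X" for a b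
  proof -
    have "(\<Sum>c\<in>insert x X. A' a c * A' b c) = Q a x * Q b x / Q x x + (\<Sum>c\<in>X. A' a c * A' b c)"
      using insert.hyps diag by (simp add: A'_def)
    also have "(\<Sum>c\<in>X. A' a c * A' b c) = (if a = x \<or> b = x then 0 else (\<Sum>c\<in>X. A a c * A b c))"
    proof -
      have "(\<Sum>c\<in>X. A' a c * A' b c) = (\<Sum>c\<in>X. if a = x \<or> b = x then 0 else A a c * A b c)"
        using insert.hyps by (intro sum.cong) (auto simp: A'_def)
      then show ?thesis by auto
    qed
    also have "Q a x * Q b x / Q x x + \<dots> = Q a b"
      using ab A zero sym by (cases "Q x x = 0") (auto simp: Q'_def)
    finally show ?thesis .
  qed
  then show ?case by blast
qed

lemma mat_sqrt_works:
  assumes "\<And>a b. a \<le> zmax \<Longrightarrow> b \<le> zmax \<Longrightarrow> Q a b = Q b a"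
    and "\<And>c. (\<Sum>a\<le>zmax. \<Sum>b\<le>zmax. c a * c b * Q a b) \<ge> 0"
    and "a \<le> zmax" "b \<le> zmax"
  shows "(\<Sum>c\<le>zmax. mat_sqrt zmax Q a c * mat_sqrt zmax Q b c) = Q a b"
proof -
  have "\<exists>A. \<forall>a\<in>{..zmax}. \<forall>b\<in>{..zmax}. (\<Sum>c\<le>zmax. A a c * A b c) = Q a b"
    using assms by (intro psd_sqrt_exists) auto
  then have "\<exists>A. \<forall>a\<le>zmax. \<forall>b\<le>zmax. (\<Sum>c\<le>zmax. A a c * A b c) = Q a b" by auto
  from someI_ex[OF this] show ?thesis using assms(3,4) unfolding mat_sqrt_def by blast
qed

section \<open>Gaussian process posteriors and information gain\<close>

locale gp_kernel =
  fixes zmax :: nat and k :: "nat \<Rightarrow> nat \<Rightarrow> real" and \<sigma> :: real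
  assumes valid: "valid_kernel zmax k" and \<sigma>_pos: "\<sigma> > 0"
begin

text \<open>Rows of the chosen square root of \<open>k\<close> act as feature vectors. The same root
  generates \<open>rb_f\<close>, so they are also the coefficients of a recovery value in the
  Gaussian coordinates.\<close>

definition feat :: "nat \<Rightarrow> nat \<Rightarrow> real" where
  "feat = mat_sqrt zmax k"

lemma kernel_sym: "a \<le> zmax \<Longrightarrow> b \<le> zmax \<Longrightarrow> k a b = k b a"
  using valid by (auto simp: valid_kernel_def)

lemma kernel_feat: "a \<le> zmax \<Longrightarrow> b \<le> zmax \<Longrightarrow> (\<Sum>c\<le>zmax. feat a c * feat b c) = k a b"
  unfolding feat_def using valid by (intro mat_sqrt_works) (auto simp: valid_kernel_def)

definition obs_ok :: "(nat \<times> real) list \<Rightarrow> bool" where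
  "obs_ok obs \<longleftrightarrow> (\<forall>a<length obs. fst (obs ! a) \<le> zmax)"

text \<open>The noisy Gram matrix is a Gram matrix of features plus \<open>\<sigma>\<^sup>2\<close>
  times the identity, which makes it positive definite.\<close>

lemma gram_form:
  assumes "obs_ok obs" "n = length obs"
  shows "(\<Sum>a<n. \<Sum>b<n. x a * gram_noise k \<sigma> obs a b * y b)
     = (\<Sum>c\<le>zmax. (\<Sum>a<n. x a * feat (fst (obs ! a)) c) * (\<Sum>a<n. y a * feat (fst (obs ! a)) c))
       + \<sigma>\<^sup>2 * (\<Sum>a<n. x a * y a)"
proof -
  have "(\<Sum>a<n. \<Sum>b<n. x a * gram_noise k \<sigma> obs a b * y b)
      = (\<Sum>a<n. \<Sum>b<n. (\<Sum>c\<le>zmax. x a * feat (fst (obs ! a)) c * (y b * feat (fst (obs ! b)) c)) + (if a = b then \<sigma>\<^sup>2 * (x a * y a) else 0))"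
    using assms by (intro sum.cong refl)
      (auto simp: gram_noise_def obs_ok_def kernel_feat[symmetric] sum_distrib_left sum_distrib_right algebra_simps)
  also have "\<dots> = (\<Sum>a<n. \<Sum>b<n. \<Sum>c\<le>zmax. x a * feat (fst (obs ! a)) c * (y b * feat (fst (obs ! b)) c)) + \<sigma>\<^sup>2 * (\<Sum>a<n. x a * y a)"
    by (simp add: sum.distrib sum_distrib_left)
  also have "(\<Sum>a<n. \<Sum>b<n. \<Sum>c\<le>zmax. x a * feat (fst (obs ! a)) c * (y b * feat (fst (obs ! b)) c))
      = (\<Sum>c\<le>zmax. \<Sum>a<n. \<Sum>b<n. x a * feat (fst (obs ! a)) c * (y b * feat (fst (obs ! b)) c))"
    by (simp only: sum.swap[of _ "{..zmax}" "{..<n}"])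
  finally show ?thesis by (simp add: sum_product)
qed

lemma gram_solve:
  assumes "obs_ok obs" "a < length obs"
  shows "(\<Sum>b<length obs. gram_noise k \<sigma> obs a b * lin_solve (gram_noise k \<sigma> obs) (length obs) v b) = v a"
proof -
  let ?n = "length obs"
  have "\<exists>x. \<forall>a<?n. (\<Sum>b<?n. gram_noise k \<sigma> obs a b * x b) = v a"
  proof (rule positive_definite_solvable)
    fix x :: "nat \<Rightarrow> real" assume "\<exists>a<?n. x a \<noteq> 0"
    then obtain a where "a < ?n" "x a \<noteq> 0" by blast
    then have "0 < (\<Sum>a<?n. x a * x a)" by (intro sum_pos2[of _ a]) (auto simp: zero_less_mult_iff)
    then have "0 < \<sigma>\<^sup>2 * (\<Sum>a<?n. x a * x a)" using \<sigma>_pos by simp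
    moreover have "0 \<le> (\<Sum>c\<le>zmax. (\<Sum>a<?n. x a * feat (fst (obs ! a)) c) * (\<Sum>a<?n. x a * feat (fst (obs ! a)) c))"
      by (intro sum_nonneg) simp
    ultimately show "0 < (\<Sum>a<?n. \<Sum>b<?n. x a * gram_noise k \<sigma> obs a b * x b)"
      unfolding gram_form[OF assms(1) refl] by linarith
  qed
  from someI_ex[OF this] show ?thesis using assms(2) unfolding lin_solve_def by blast
qed

text \<open>Coefficients of the posterior mean as a linear combination of the observed values. They
  depend on the played z-values only.\<close>

definition weights :: "(nat \<times> real) list \<Rightarrow> nat \<Rightarrow> nat \<Rightarrow> real" where
  "weights obs z = lin_solve (gram_noise k \<sigma> obs) (length obs) (\<lambda>a. k (fst (obs ! a)) z)"

lemma weights_solve: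
  "obs_ok obs \<Longrightarrow> a < length obs \<Longrightarrow>
    (\<Sum>b<length obs. gram_noise k \<sigma> obs a b * weights obs z b) = k (fst (obs ! a)) z"
  unfolding weights_def by (rule gram_solve)

lemma gram_sym:
  "obs_ok obs \<Longrightarrow> a < length obs \<Longrightarrow> b < length obs \<Longrightarrow> gram_noise k \<sigma> obs a b = gram_noise k \<sigma> obs b a"
  by (auto simp: gram_noise_def obs_ok_def kernel_sym)

lemma post_cov_weights:
  "post_cov k \<sigma> obs z z' = k z z' - (\<Sum>a<length obs. k z (fst (obs ! a)) * weights obs z' a)"
  by (simp add: post_cov_def weights_def Let_def)

text \<open>Symmetry of the noisy Gram matrix moves its inverse from the data to the vector of
  kernel values, which makes the posterior mean explicitly linear in the data.\<close>

lemma post_mean_weights: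
  assumes ok: "obs_ok obs" and z: "z \<le> zmax"
  shows "post_mean k \<sigma> obs z = (\<Sum>a<length obs. weights obs z a * snd (obs ! a))"
proof -
  let ?n = "length obs" and ?M = "gram_noise k \<sigma> obs"
  define \<beta> where "\<beta> = lin_solve ?M ?n (\<lambda>a. snd (obs ! a))"
  have "post_mean k \<sigma> obs z = (\<Sum>a<?n. k (fst (obs ! a)) z * \<beta> a)"
    unfolding post_mean_def Let_def \<beta>_def using ok z
    by (intro sum.cong) (auto simp: obs_ok_def kernel_sym)
  also have "\<dots> = (\<Sum>a<?n. \<Sum>b<?n. ?M a b * weights obs z b * \<beta> a)"
    by (intro sum.cong refl) (simp add: weights_solve[OF ok, symmetric] sum_distrib_right)
  also have "\<dots> = (\<Sum>b<?n. \<Sum>a<?n. ?M a b * weights obs z b * \<beta> a)"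
    by (rule sum.swap)
  also have "\<dots> = (\<Sum>b<?n. weights obs z b * (\<Sum>a<?n. ?M b a * \<beta> a))"
    using gram_sym[OF ok] by (intro sum.cong refl) (auto simp: sum_distrib_left mult_ac intro!: sum.cong)
  also have "\<dots> = (\<Sum>b<?n. weights obs z b * snd (obs ! b))"
    unfolding \<beta>_def by (intro sum.cong refl) (simp add: gram_solve[OF ok])
  finally show ?thesis .
qed

text \<open>The posterior variance is the mean square error of the best linear predictor.\<close>

definition lin_err :: "(nat \<times> real) list \<Rightarrow> nat \<Rightarrow> (nat \<Rightarrow> real) \<Rightarrow> real" where
  "lin_err obs z x = (\<Sum>c\<le>zmax. (feat z c - (\<Sum>a<length obs. x a * feat (fst (obs ! a)) c))\<^sup>2)
     + \<sigma>\<^sup>2 * (\<Sum>a<length obs. (x a)\<^sup>2)"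

lemma lin_err_nonneg: "0 \<le> lin_err obs z x"
  unfolding lin_err_def by (intro add_nonneg_nonneg sum_nonneg mult_nonneg_nonneg) auto

lemma lin_err_eq:
  assumes ok: "obs_ok obs" and z: "z \<le> zmax"
  shows "lin_err obs z x = k z z - 2 * (\<Sum>a<length obs. x a * k (fst (obs ! a)) z)
     + (\<Sum>a<length obs. \<Sum>b<length obs. x a * gram_noise k \<sigma> obs a b * x b)"
proof -
  let ?n = "length obs"
  define F where "F c = (\<Sum>a<?n. x a * feat (fst (obs ! a)) c)" for c
  have "(\<Sum>c\<le>zmax. feat z c * F c) = (\<Sum>a<?n. x a * (\<Sum>c\<le>zmax. feat (fst (obs ! a)) c * feat z c))"
    unfolding F_def sum_distrib_left by (subst sum.swap) (simp add: mult_ac)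
  also have "\<dots> = (\<Sum>a<?n. x a * k (fst (obs ! a)) z)"
    using ok z by (intro sum.cong refl) (auto simp: obs_ok_def kernel_feat)
  finally have 1: "(\<Sum>c\<le>zmax. feat z c * F c) = (\<Sum>a<?n. x a * k (fst (obs ! a)) z)" .
  have "lin_err obs z x = (\<Sum>c\<le>zmax. feat z c * feat z c) - 2 * (\<Sum>c\<le>zmax. feat z c * F c)
      + (\<Sum>c\<le>zmax. F c * F c) + \<sigma>\<^sup>2 * (\<Sum>a<?n. x a * x a)"
    unfolding lin_err_def F_def[symmetric]
    by (simp add: power2_eq_square algebra_simps sum.distrib sum_subtractf sum_distrib_left)
  then show ?thesis
    unfolding 1 gram_form[OF ok refl] F_def[symmetric] using z by (simp add: kernel_feat)
qed

lemma gram_weights: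
  assumes ok: "obs_ok obs"
  shows "(\<Sum>a<length obs. \<Sum>b<length obs. x a * gram_noise k \<sigma> obs a b * weights obs z b)
     = (\<Sum>a<length obs. x a * k (fst (obs ! a)) z)"
  by (intro sum.cong refl) (simp add: weights_solve[OF ok, symmetric] sum_distrib_left mult_ac)

lemma post_var_eq:
  assumes ok: "obs_ok obs" and z: "z \<le> zmax"
  shows "post_cov k \<sigma> obs z z = k z z - (\<Sum>a<length obs. weights obs z a * k (fst (obs ! a)) z)"
  unfolding post_cov_weights using ok z
  by (auto simp: obs_ok_def kernel_sym mult.commute intro!: sum.cong)

lemma lin_err_weights:
  assumes ok: "obs_ok obs" and z: "z \<le> zmax"
  shows "lin_err obs z (weights obs z) = post_cov k \<sigma> obs z z"
  unfolding lin_err_eq[OF assms] post_var_eq[OF assms] gram_weights[OF ok] by simp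

text \<open>Completing the square: the excess error of a linear predictor over the optimal one is
  the Gram form of the difference of their coefficients.\<close>

lemma post_var_le_lin_err:
  assumes ok: "obs_ok obs" and z: "z \<le> zmax"
  shows "post_cov k \<sigma> obs z z \<le> lin_err obs z x"
proof -
  let ?n = "length obs" and ?M = "gram_noise k \<sigma> obs" and ?w = "weights obs z"
  have sw: "(\<Sum>a<?n. \<Sum>b<?n. ?w a * ?M a b * x b) = (\<Sum>a<?n. x a * k (fst (obs ! a)) z)"
    unfolding gram_weights[OF ok, of x z, symmetric]
    by (subst sum.swap) (auto simp: gram_sym[OF ok] mult_ac intro!: sum.cong)
  have "0 \<le> (\<Sum>a<?n. \<Sum>b<?n. (x a - ?w a) * ?M a b * (x b - ?w b))"
    unfolding gram_form[OF ok refl]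
    by (intro add_nonneg_nonneg sum_nonneg mult_nonneg_nonneg[of "\<sigma>\<^sup>2"]) auto
  also have "\<dots> = (\<Sum>a<?n. \<Sum>b<?n. x a * ?M a b * x b) - (\<Sum>a<?n. \<Sum>b<?n. x a * ?M a b * ?w b)
     - (\<Sum>a<?n. \<Sum>b<?n. ?w a * ?M a b * x b) + (\<Sum>a<?n. \<Sum>b<?n. ?w a * ?M a b * ?w b)"
    by (simp add: left_diff_distrib right_diff_distrib sum_subtractf)
  also have "\<dots> = lin_err obs z x - post_cov k \<sigma> obs z z"
    unfolding sw gram_weights[OF ok] lin_err_eq[OF assms] post_var_eq[OF assms] by simp
  finally show ?thesis by simp
qed

lemma post_var_nonneg: "obs_ok obs \<Longrightarrow> z \<le> zmax \<Longrightarrow> 0 \<le> post_cov k \<sigma> obs z z"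
  using lin_err_nonneg[of obs z "weights obs z"] by (simp add: lin_err_weights)

lemma post_var_le_prior:
  assumes ok: "obs_ok obs" and z: "z \<le> zmax"
  shows "post_cov k \<sigma> obs z z \<le> k z z"
  using post_var_le_lin_err[OF assms, of "\<lambda>_. 0"] unfolding lin_err_eq[OF assms] by simp

text \<open>Observed values enter the posterior mean only. Hence covariance and weights are
  constants once the arm sequence is fixed.\<close>

lemma post_cov_cong:
  assumes "map fst obs = map fst obs'"
  shows "post_cov k \<sigma> obs = post_cov k \<sigma> obs'" "weights obs = weights obs'"
proof -
  have l: "length obs = length obs'" using assms by (metis length_map)
  have n: "fst (obs ! a) = fst (obs' ! a)" if "a < length obs'" for a
    using assms that l by (metis nth_map)
  have "lin_solve (gram_noise k \<sigma> obs) (length obs') (\<lambda>a. k (fst (obs ! a)) z)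
      = lin_solve (gram_noise k \<sigma> obs') (length obs') (\<lambda>a. k (fst (obs' ! a)) z)" for z
  proof -
    \<comment> \<open>The two linear systems have the same solutions, so the choice operator in
      \<open>lin_solve\<close> returns the same one.\<close>
    have "(\<forall>a<length obs'. (\<Sum>b<length obs'. gram_noise k \<sigma> obs a b * x b) = k (fst (obs ! a)) z)
       \<longleftrightarrow> (\<forall>a<length obs'. (\<Sum>b<length obs'. gram_noise k \<sigma> obs' a b * x b) = k (fst (obs' ! a)) z)" for x
      using n by (auto simp: gram_noise_def)
    then show ?thesis unfolding lin_solve_def by simp
  qed
  then show w: "weights obs = weights obs'" by (simp add: weights_def l fun_eq_iff)
  show "post_cov k \<sigma> obs = post_cov k \<sigma> obs'"
    by (intro ext) (simp add: post_cov_weights w l n)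
qed

text \<open>The zeros are placeholders: no observed value enters a posterior covariance.\<close>

definition pvar :: "nat list \<Rightarrow> nat \<Rightarrow> real" where
  "pvar xs z = post_cov k \<sigma> (map (\<lambda>x. (x, 0)) xs) z z"

lemma post_var_eq_pvar: "post_cov k \<sigma> obs z z = pvar (map fst obs) z"
  unfolding pvar_def by (rule arg_cong[of _ _ "\<lambda>f. f z z"], rule post_cov_cong) (simp add: comp_def)

lemma obs_ok_map: "set xs \<subseteq> {..zmax} \<Longrightarrow> obs_ok (map (\<lambda>x. (x, 0)) xs)"
  by (auto simp: obs_ok_def dest!: nth_mem)

lemma pvar_nonneg: "set xs \<subseteq> {..zmax} \<Longrightarrow> z \<le> zmax \<Longrightarrow> 0 \<le> pvar xs z"
  unfolding pvar_def by (intro post_var_nonneg obs_ok_map)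

lemma pvar_le_prior: "set xs \<subseteq> {..zmax} \<Longrightarrow> z \<le> zmax \<Longrightarrow> pvar xs z \<le> k z z"
  unfolding pvar_def by (intro post_var_le_prior obs_ok_map)

lemma pvar_Nil: "pvar [] z = k z z"
  by (simp add: pvar_def post_cov_weights)

lemma subseq_index_embedding:
  assumes "subseq xs ys"
  obtains \<iota> where "inj_on \<iota> {..<length xs}" "\<iota> ` {..<length xs} \<subseteq> {..<length ys}"
    "\<And>a. a < length xs \<Longrightarrow> ys ! \<iota> a = xs ! a"
proof -
  from assms have "\<exists>\<iota>. inj_on \<iota> {..<length xs} \<and> \<iota> ` {..<length xs} \<subseteq> {..<length ys} \<and>
    (\<forall>a<length xs. ys ! \<iota> a = xs ! a)"
  proof (induction rule: list_emb.induct)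
    case (list_emb_Nil ys)
    then show ?case by auto
  next
    case (list_emb_Cons xs ys y)
    then obtain \<iota> where "inj_on \<iota> {..<length xs}" "\<iota> ` {..<length xs} \<subseteq> {..<length ys}"
      "\<forall>a<length xs. ys ! \<iota> a = xs ! a" by auto
    then show ?case by (intro exI[of _ "Suc \<circ> \<iota>"]) (auto simp: inj_on_def)
  next
    case (list_emb_Cons2 x y xs ys)
    then obtain \<iota> where "inj_on \<iota> {..<length xs}" "\<iota> ` {..<length xs} \<subseteq> {..<length ys}"
      "\<forall>a<length xs. ys ! \<iota> a = xs ! a" by auto
    then show ?case using list_emb_Cons2.hyps
      by (intro exI[of _ "\<lambda>a. case a of 0 \<Rightarrow> 0 | Suc a \<Rightarrow> Suc (\<iota> a)"])
         (auto simp: inj_on_def less_Suc_eq_0_disj image_subset_iff split: nat.splits)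
  qed
  then show thesis using that by blast
qed

text \<open>A predictor from the data \<open>xs\<close> is a predictor from \<open>ys\<close> with
  weight \<open>0\<close> on the additional observations, and the posterior variance is the least
  error of all linear predictors.\<close>

lemma pvar_subseq:
  assumes sub: "subseq xs ys" and ys: "set ys \<subseteq> {..zmax}" and z: "z \<le> zmax"
  shows "pvar ys z \<le> pvar xs z"
proof -
  obtain \<iota> where inj: "inj_on \<iota> {..<length xs}" and im: "\<iota> ` {..<length xs} \<subseteq> {..<length ys}"
    and nth: "\<And>a. a < length xs \<Longrightarrow> ys ! \<iota> a = xs ! a"
    using subseq_index_embedding[OF sub] by blast
  have xs: "set xs \<subseteq> {..zmax}"
  proof
    fix x assume "x \<in> set xs"
    then obtain a where a: "a < length xs" "x = xs ! a" by (auto simp: in_set_conv_nth)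
    with im have "ys ! \<iota> a \<in> set ys" by (intro nth_mem) auto
    with a nth ys show "x \<in> {..zmax}" by auto
  qed
  let ?ox = "map (\<lambda>x. (x, 0::real)) xs" and ?oy = "map (\<lambda>x. (x, 0::real)) ys"
  define w where "w = weights ?ox z"
  define x where "x b = (if b \<in> \<iota> ` {..<length xs} then w (the_inv_into {..<length xs} \<iota> b) else 0)" for b
  have push: "(\<Sum>b<length ys. g b) = (\<Sum>a<length xs. g (\<iota> a))" if "\<And>b. b \<notin> \<iota> ` {..<length xs} \<Longrightarrow> g b = 0" for g :: "nat \<Rightarrow> real"
  proof -
    have "(\<Sum>b<length ys. g b) = (\<Sum>b\<in>\<iota> ` {..<length xs}. g b)"
      using im that by (intro sum.mono_neutral_right) auto
    then show ?thesis by (simp add: sum.reindex[OF inj])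
  qed
  have inv: "the_inv_into {..<length xs} \<iota> (\<iota> a) = a" if "a < length xs" for a
    using that the_inv_into_f_f[OF inj] by auto
  have xi: "x (\<iota> a) = w a" if "a < length xs" for a
    using that by (simp add: x_def inv)
  have x0: "x b = 0" if "b \<notin> \<iota> ` {..<length xs}" for b
    using that by (simp add: x_def)
  have "lin_err ?oy z x = lin_err ?ox z w"
  proof -
    have "(\<Sum>b<length ys. x b * feat (fst (?oy ! b)) c) = (\<Sum>a<length xs. w a * feat (fst (?ox ! a)) c)" for c
      using im by (subst push) (auto simp: xi x0 nth image_subset_iff intro!: sum.cong)
    moreover have "(\<Sum>b<length ys. (x b)\<^sup>2) = (\<Sum>a<length xs. (w a)\<^sup>2)"
      by (subst push) (auto simp: xi x0)
    ultimately show ?thesis by (simp add: lin_err_def)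
  qed
  then show ?thesis
    using post_var_le_lin_err[OF obs_ok_map[OF ys] z, of x] lin_err_weights[OF obs_ok_map[OF xs] z]
    by (simp add: pvar_def w_def)
qed

section \<open>Information gain and sums of posterior variances\<close>

definition gain :: "nat list \<Rightarrow> real" where
  "gain xs = 1 / 2 * ln (Determinant.det (Matrix.mat (length xs) (length xs)
     (\<lambda>(a, b). (if a = b then 1 else 0) + k (xs ! a) (xs ! b) / \<sigma>\<^sup>2)))"

text \<open>The weights of \<open>z\<close> solve the bordered system, so the Schur complement of
  the new diagonal entry is a rescaled posterior variance plus \<open>1\<close>. This is what makes
  the logarithm of the determinant telescope.\<close>

lemma det_snoc:
  assumes xs: "set xs \<subseteq> {..zmax}" and z: "z \<le> zmax"
  defines "D \<equiv> \<lambda>xs. Determinant.det (Matrix.mat (length xs) (length xs)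
     (\<lambda>(a, b). (if a = b then 1 else 0) + k (xs ! a) (xs ! b) / \<sigma>\<^sup>2))"
  shows "D (xs @ [z]) = D xs * (1 + pvar xs z / \<sigma>\<^sup>2)"
proof -
  let ?n = "length xs" and ?o = "map (\<lambda>x. (x, 0::real)) xs"
  define M where "M a b = (if a = b then 1 else 0) + k ((xs @ [z]) ! a) ((xs @ [z]) ! b) / \<sigma>\<^sup>2" for a b
  define \<beta> where "\<beta> = weights ?o z"
  have ok: "obs_ok ?o" by (rule obs_ok_map[OF xs])
  have Mn: "M a b = gram_noise k \<sigma> ?o a b / \<sigma>\<^sup>2" if "a < ?n" "b < ?n" for a b
    using that \<sigma>_pos by (simp add: M_def gram_noise_def nth_append field_simps)
  have "(\<Sum>b<?n. M a b * \<beta> b) = M a ?n" if "a < ?n" for a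
  proof -
    have "(\<Sum>b<?n. M a b * \<beta> b) = (\<Sum>b<?n. gram_noise k \<sigma> ?o a b * \<beta> b) / \<sigma>\<^sup>2"
      using that by (simp add: Mn sum_divide_distrib)
    also have "\<dots> = k (xs ! a) z / \<sigma>\<^sup>2"
      using weights_solve[OF ok, of a z] that by (simp add: \<beta>_def)
    finally show ?thesis using that by (simp add: M_def nth_append)
  qed
  from det_border[of ?n M \<beta>, OF this]
  have "D (xs @ [z]) = Determinant.det (Matrix.mat ?n ?n (\<lambda>(a, b). M a b)) * (M ?n ?n - (\<Sum>b<?n. M ?n b * \<beta> b))"
    by (simp add: D_def M_def)
  also have "Matrix.mat ?n ?n (\<lambda>(a, b). M a b) = Matrix.mat ?n ?n
     (\<lambda>(a, b). (if a = b then 1 else 0) + k (xs ! a) (xs ! b) / \<sigma>\<^sup>2)"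
    by (intro eq_matI) (auto simp: M_def nth_append)
  also have "M ?n ?n - (\<Sum>b<?n. M ?n b * \<beta> b) = 1 + pvar xs z / \<sigma>\<^sup>2"
  proof -
    have "(\<Sum>b<?n. M ?n b * \<beta> b) = (\<Sum>b<?n. k z (fst (?o ! b)) * \<beta> b) / \<sigma>\<^sup>2"
      by (auto simp: M_def nth_append sum_divide_distrib intro!: sum.cong)
    then show ?thesis
      by (simp add: M_def pvar_def post_cov_weights \<beta>_def diff_divide_distrib)
  qed
  finally show ?thesis by (simp add: D_def)
qed

lemma gain_Nil [simp]: "gain [] = 0"
  by (simp add: gain_def)

lemma det_pos:
  assumes "set xs \<subseteq> {..zmax}"
  shows "0 < Determinant.det (Matrix.mat (length xs) (length xs)
     (\<lambda>(a, b). (if a = b then 1 else 0) + k (xs ! a) (xs ! b) / \<sigma>\<^sup>2))"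
  using assms
proof (induction xs rule: rev_induct)
  case (snoc z xs)
  then have "0 < 1 + pvar xs z / \<sigma>\<^sup>2"
    using pvar_nonneg[of xs z] by (intro add_pos_nonneg divide_nonneg_nonneg) auto
  then show ?case using snoc by (subst det_snoc) auto
qed simp

lemma gain_snoc:
  assumes xs: "set xs \<subseteq> {..zmax}" and z: "z \<le> zmax"
  shows "gain (xs @ [z]) = gain xs + 1 / 2 * ln (1 + pvar xs z / \<sigma>\<^sup>2)"
proof -
  have "0 < 1 + pvar xs z / \<sigma>\<^sup>2"
    using pvar_nonneg[OF assms] by (intro add_pos_nonneg divide_nonneg_nonneg) auto
  then show ?thesis
    unfolding gain_def det_snoc[OF assms] by (subst ln_mult_pos[OF det_pos[OF xs]], assumption) (rule distrib_left)
qed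

lemma gain_append_mono:
  assumes "set (xs @ ys) \<subseteq> {..zmax}"
  shows "gain xs \<le> gain (xs @ ys)"
  using assms
proof (induction ys rule: rev_induct)
  case (snoc z ys)
  have "0 \<le> pvar (xs @ ys) z / \<sigma>\<^sup>2" using snoc.prems by (intro divide_nonneg_nonneg pvar_nonneg) auto
  then have "0 \<le> ln (1 + pvar (xs @ ys) z / \<sigma>\<^sup>2)" by simp
  then show ?case
    using snoc gain_snoc[of "xs @ ys" z] by simp
qed simp

text \<open>A shorter sequence is padded with the z-value \<open>0\<close> up to length
  \<open>T\<close>; a further observation never lowers the gain.\<close>

lemma gain_le_info_gain:
  assumes xs: "set xs \<subseteq> {..zmax}" and len: "length xs \<le> T"
  shows "gain xs \<le> info_gain zmax k \<sigma> T"
proof -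
  define ys where "ys = xs @ replicate (T - length xs) 0"
  have ys: "set ys \<subseteq> {..zmax}" "length ys = T" using assms by (auto simp: ys_def)
  have "gain xs \<le> gain ys" unfolding ys_def using ys by (intro gain_append_mono) (simp add: ys_def)
  also have "\<dots> \<le> info_gain zmax k \<sigma> T"
    unfolding info_gain_def
  proof (rule Max_ge)
    let ?F = "{zs. \<forall>i. (i < T \<longrightarrow> zs i \<le> zmax) \<and> (T \<le> i \<longrightarrow> zs i = (0::nat))}"
    have "?F = {zs. \<forall>i. (i \<in> {..<T} \<longrightarrow> zs i \<in> {..zmax}) \<and> (i \<notin> {..<T} \<longrightarrow> zs i = 0)}"
      by (rule Collect_cong) (simp add: not_less)
    moreover have "finite {zs. \<forall>i. (i \<in> {..<T} \<longrightarrow> zs i \<in> {..zmax}) \<and> (i \<notin> {..<T} \<longrightarrow> zs i = (0::nat))}"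
      by (rule finite_set_of_finite_funs) auto
    ultimately have "finite ?F" by (rule ssubst)
    then show "finite ((\<lambda>zs. (1/2) * ln (Determinant.det (Matrix.mat T T (\<lambda>(a,b).
              (if a = b then 1 else 0) + k (zs a) (zs b) / \<sigma>\<^sup>2)))) ` ?F)" by simp
    define zs where "zs i = (if i < T then ys ! i else 0)" for i
    have "ys ! i \<le> zmax" if "i < T" for i
      using ys that by (metis atMost_iff nth_mem subsetD)
    then have "zs \<in> ?F" by (auto simp: zs_def)
    moreover have "Matrix.mat T T (\<lambda>(a,b). (if a = b then 1 else 0) + k (zs a) (zs b) / \<sigma>\<^sup>2)
       = Matrix.mat T T (\<lambda>(a,b). (if a = b then 1 else 0) + k (ys ! a) (ys ! b) / \<sigma>\<^sup>2)"
      by (intro eq_matI) (auto simp: zs_def)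
    ultimately show "gain ys \<in> ((\<lambda>zs. (1/2) * ln (Determinant.det (Matrix.mat T T (\<lambda>(a,b).
              (if a = b then 1 else 0) + k (zs a) (zs b) / \<sigma>\<^sup>2)))) ` ?F)"
      unfolding gain_def ys(2) by (intro image_eqI[of _ _ zs]) simp_all
  qed
  finally show ?thesis .
qed

lemma info_gain_nonneg: "0 \<le> info_gain zmax k \<sigma> T"
  using gain_le_info_gain[of "[]" T] by simp

text \<open>The argument lists the played values with the most recent play first.\<close>

primrec vsum :: "nat list \<Rightarrow> real" where
  "vsum [] = 0"
| "vsum (z # ws) = vsum ws + pvar (rev ws) z"

end

locale gp_kernel_bounded = gp_kernel +
  assumes bounded: "\<And>z. z \<le> zmax \<Longrightarrow> k z z \<le> 1"
begin

text \<open>The logarithm lies above its chord between \<open>1\<close> and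
  \<open>1 + 1 / \<sigma>\<^sup>2\<close>. Posterior variances are in the range of \<open>v\<close>
  because prior variances are at most \<open>1\<close>.\<close>

lemma le_ln_scaled:
  assumes "0 \<le> v" "v \<le> 1"
  shows "v * ln (1 + 1 / \<sigma>\<^sup>2) \<le> ln (1 + v / \<sigma>\<^sup>2)"
proof -
  have "concave_on {0<..} (ln :: real \<Rightarrow> real)" by (rule ln_concave)
  from concave_onD[OF this, of v 1 "1 + 1 / \<sigma>\<^sup>2"] assms
  have "(1 - v) * ln 1 + v * ln (1 + 1 / \<sigma>\<^sup>2) \<le> ln ((1 - v) *\<^sub>R 1 + v *\<^sub>R (1 + 1 / \<sigma>\<^sup>2))"
    using \<sigma>_pos by (simp add: add_pos_nonneg)
  then show ?thesis by (simp add: algebra_simps)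
qed

lemma vsum_le_gain:
  assumes "set ws \<subseteq> {..zmax}"
  shows "vsum ws * ln (1 + 1 / \<sigma>\<^sup>2) \<le> 2 * gain (rev ws)"
  using assms
proof (induction ws)
  case (Cons z ws)
  have "pvar (rev ws) z * ln (1 + 1 / \<sigma>\<^sup>2) \<le> ln (1 + pvar (rev ws) z / \<sigma>\<^sup>2)"
    using Cons.prems pvar_le_prior[of "rev ws" z] bounded[of z]
    by (intro le_ln_scaled pvar_nonneg) auto
  then show ?case using Cons by (simp add: gain_snoc algebra_simps)
qed simp

text \<open>For \<open>d = 1\<close> the regret sums over \<open>T + 1\<close> blocks, one play more
  than a gain of length \<open>T\<close> covers. The latest play is therefore bounded separately by
  the gain of a single observation, which turns the factor \<open>2\<close> into
  \<open>4\<close>.\<close>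

lemma vsum_le_info_gain:
  assumes ws: "set ws \<subseteq> {..zmax}" and len: "length ws \<le> Suc T" and T: "1 \<le> T"
  shows "vsum ws \<le> 4 / ln (1 + 1 / \<sigma>\<^sup>2) * info_gain zmax k \<sigma> T"
proof -
  have lpos: "0 < ln (1 + 1 / \<sigma>\<^sup>2)" using \<sigma>_pos by (intro ln_gt_zero) simp
  have "vsum ws * ln (1 + 1 / \<sigma>\<^sup>2) \<le> 4 * info_gain zmax k \<sigma> T"
  proof (cases ws)
    case Nil
    then show ?thesis using info_gain_nonneg by simp
  next
    case (Cons z vs)
    have vs: "set vs \<subseteq> {..zmax}" and z: "z \<le> zmax" using ws Cons by auto
    have "vsum vs * ln (1 + 1 / \<sigma>\<^sup>2) \<le> 2 * gain (rev vs)" by (rule vsum_le_gain[OF vs])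
    also have "gain (rev vs) \<le> info_gain zmax k \<sigma> T"
      using vs len Cons by (intro gain_le_info_gain) auto
    finally have 1: "vsum vs * ln (1 + 1 / \<sigma>\<^sup>2) \<le> 2 * info_gain zmax k \<sigma> T" by simp
    have "pvar (rev vs) z \<le> pvar [] z"
      unfolding pvar_Nil using vs z by (intro pvar_le_prior) auto
    also have "\<dots> = vsum [z]" by simp
    finally have "pvar (rev vs) z * ln (1 + 1 / \<sigma>\<^sup>2) \<le> vsum [z] * ln (1 + 1 / \<sigma>\<^sup>2)"
      using lpos by (intro mult_right_mono) auto
    also have "\<dots> \<le> 2 * gain [z]" using vsum_le_gain[of "[z]"] z by simp
    also have "gain [z] \<le> info_gain zmax k \<sigma> T" using z T by (intro gain_le_info_gain) auto
    finally have 2: "pvar (rev vs) z * ln (1 + 1 / \<sigma>\<^sup>2) \<le> 2 * info_gain zmax k \<sigma> T" by simp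
    show ?thesis using 1 2 Cons by (simp add: algebra_simps)
  qed
  then show ?thesis using lpos by (simp add: field_simps)
qed

end

section \<open>Trajectories\<close>

fun leaf_path :: "nat \<Rightarrow> (nat \<Rightarrow> nat) \<Rightarrow> nat list \<Rightarrow> (nat \<times> nat) list" where
  "leaf_path zmax Zs [] = []"
| "leaf_path zmax Zs (j # js) = (j, Zs j) # leaf_path zmax (rb_step zmax Zs j) js"

text \<open>Counterpart of \<open>play_leaf\<close> that records round numbers instead of observed
  values, so that the result depends on the arm sequence but not on \<open>\<omega>\<close>;
  \<open>obs_of\<close> puts the values back.\<close>

fun play_times :: "nat \<Rightarrow> nat \<Rightarrow> nat list \<Rightarrow> (nat \<Rightarrow> nat) \<times> (nat \<Rightarrow> (nat \<times> nat) list)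
     \<Rightarrow> (nat \<Rightarrow> nat) \<times> (nat \<Rightarrow> (nat \<times> nat) list)" where
  "play_times zmax t0 [] st = st"
| "play_times zmax t0 (j # js) (Zs, r) =
     play_times zmax (Suc t0) js (rb_step zmax Zs j, r(j := r j @ [(Zs j, t0)]))"

definition obs_of :: "real \<Rightarrow> (nat \<Rightarrow> nat \<Rightarrow> real) \<Rightarrow> (rnd_idx \<Rightarrow> real) \<Rightarrow> (nat \<Rightarrow> (nat \<times> nat) list)
     \<Rightarrow> nat \<Rightarrow> (nat \<times> real) list" where
  "obs_of \<sigma> f \<omega> r j = map (\<lambda>(z, t). (z, f j z + \<sigma> * \<omega> (NoiseR t))) (r j)"

lemma play_leaf_obs_of:
  "play_leaf zmax \<sigma> f \<omega> t0 js (Zs, obs_of \<sigma> f \<omega> r)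
     = (fst (play_times zmax t0 js (Zs, r)), obs_of \<sigma> f \<omega> (snd (play_times zmax t0 js (Zs, r))))"
proof (induction js arbitrary: t0 Zs r)
  case (Cons j js)
  have "(obs_of \<sigma> f \<omega> r)(j := obs_of \<sigma> f \<omega> r j @ [(Zs j, f j (Zs j) + \<sigma> * \<omega> (NoiseR t0))])
      = obs_of \<sigma> f \<omega> (r(j := r j @ [(Zs j, t0)]))"
    by (auto simp: obs_of_def fun_eq_iff)
  then show ?case by (simp only: play_leaf.simps play_times.simps Cons.IH)
qed simp

lemma play_times_append:
  "play_times zmax t0 (js @ js') st = play_times zmax (t0 + length js) js' (play_times zmax t0 js st)"
proof (induction js arbitrary: t0 st)
  case (Cons j js)
  then show ?case by (cases st) simp
qed simp

lemma length_leaf_path [simp]: "length (leaf_path zmax Zs js) = length js"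
  by (induction js arbitrary: Zs) auto

lemma leaf_path_append:
  "leaf_path zmax Zs (js @ js') = leaf_path zmax Zs js @ leaf_path zmax (fst (play_times zmax t0 js (Zs, r))) js'"
  by (induction js arbitrary: Zs t0 r) auto

lemma leaf_val_leaf_path:
  "leaf_val zmax f Zs js = (\<Sum>l<length js. f (fst (leaf_path zmax Zs js ! l)) (snd (leaf_path zmax Zs js ! l)))"
  by (induction js arbitrary: Zs) (simp_all add: sum.lessThan_Suc_shift del: sum.lessThan_Suc)

lemma rb_step_le: "(\<And>j. Zs j \<le> zmax) \<Longrightarrow> rb_step zmax Zs j i \<le> zmax"
  by (simp add: rb_step_def)

lemma leaf_path_set:
  assumes "set js \<subseteq> {..<K}" "\<And>j. Zs j \<le> zmax"
  shows "set (leaf_path zmax Zs js) \<subseteq> {..<K} \<times> {..zmax}"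
  using assms
proof (induction js arbitrary: Zs)
  case (Cons j js)
  have "set (leaf_path zmax (rb_step zmax Zs j) js) \<subseteq> {..<K} \<times> {..zmax}"
    using Cons.prems by (intro Cons.IH rb_step_le) auto
  then show ?case using Cons.prems by simp
qed simp

lemma fst_play_times_le:
  "(\<And>j. Zs j \<le> zmax) \<Longrightarrow> fst (play_times zmax t0 js (Zs, r)) i \<le> zmax"
proof (induction js arbitrary: t0 Zs r)
  case (Cons j js)
  show ?case using Cons.prems by (simp, intro Cons.IH rb_step_le)
qed simp

lemma map_fst_play_times:
  "map fst (snd (play_times zmax t0 js (Zs, r)) j)
     = map fst (r j) @ map snd (filter (\<lambda>q. fst q = j) (leaf_path zmax Zs js))"
  by (induction js arbitrary: t0 Zs r) auto

text \<open>A round number occurs at most once over all arms, so each observation has a noise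
  coordinate of its own; this confines the noise variance to the diagonal of the Gram
  matrix.\<close>

definition times_ok :: "nat \<Rightarrow> nat \<Rightarrow> nat \<Rightarrow> (nat \<Rightarrow> (nat \<times> nat) list) \<Rightarrow> bool" where
  "times_ok zmax K t0 r \<longleftrightarrow> (\<forall>j. \<forall>q\<in>set (r j). fst q \<le> zmax \<and> snd q < t0) \<and>
     (\<forall>j. distinct (map snd (r j))) \<and>
     (\<forall>j j'. j \<noteq> j' \<longrightarrow> snd ` set (r j) \<inter> snd ` set (r j') = {}) \<and>
     (\<forall>j\<ge>K. r j = [])"

lemma times_ok_play_times:
  assumes "times_ok zmax K t0 r" "\<And>j. Zs j \<le> zmax" "set js \<subseteq> {..<K}"
  shows "times_ok zmax K (t0 + length js) (snd (play_times zmax t0 js (Zs, r)))"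
  using assms
proof (induction js arbitrary: t0 Zs r)
  case (Cons j js)
  have "times_ok zmax K (Suc t0) (r(j := r j @ [(Zs j, t0)]))"
    using Cons.prems unfolding times_ok_def
    by (auto simp: less_Suc_eq; fastforce)
  then have "times_ok zmax K (Suc t0 + length js)
      (snd (play_times zmax (Suc t0) js (rb_step zmax Zs j, r(j := r j @ [(Zs j, t0)]))))"
    using Cons.prems by (intro Cons.IH[OF \<open>times_ok zmax K (Suc t0) (r(j := r j @ [(Zs j, t0)]))\<close> rb_step_le]) simp_all
  then show ?case by simp
qed simp

lemma set_play_times_mono:
  "set (r j) \<subseteq> set (snd (play_times zmax t0 js (Zs, r)) j)"
proof (induction js arbitrary: t0 Zs r)
  case (Cons i js)
  have "set (r j) \<subseteq> set ((r(i := r i @ [(Zs i, t0)])) j)" by auto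
  also have "\<dots> \<subseteq> set (snd (play_times zmax (Suc t0) js (rb_step zmax Zs i, r(i := r i @ [(Zs i, t0)]))) j)"
    by (rule Cons.IH)
  finally show ?case by simp
qed simp

lemma leaf_val_mono:
  assumes "\<And>j z. j < K \<Longrightarrow> z \<le> zmax \<Longrightarrow> f j z \<le> g j z" "set js \<subseteq> {..<K}" "\<And>j. Zs j \<le> zmax"
  shows "leaf_val zmax f Zs js \<le> leaf_val zmax g Zs js"
  using assms(2,3)
proof (induction js arbitrary: Zs)
  case (Cons j js)
  have "leaf_val zmax f (rb_step zmax Zs j) js \<le> leaf_val zmax g (rb_step zmax Zs j) js"
    using Cons.prems by (intro Cons.IH rb_step_le) auto
  then show ?case using Cons.prems assms(1) by (simp add: add_mono)
qed simp

lemma leaf_val_cong: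
  assumes "\<And>j z. j < K \<Longrightarrow> z \<le> zmax \<Longrightarrow> f j z = g j z" "set js \<subseteq> {..<K}" "\<And>j. Zs j \<le> zmax"
  shows "leaf_val zmax f Zs js = leaf_val zmax g Zs js"
  using leaf_val_mono[of K zmax f g js Zs] leaf_val_mono[of K zmax g f js Zs] assms by force

lemma leaf_val_linear:
  "leaf_val zmax (\<lambda>j z. a * f j z + b * g j z + c) Zs js
     = a * leaf_val zmax f Zs js + b * leaf_val zmax g Zs js + c * length js"
  by (simp add: leaf_val_leaf_path sum.distrib sum_distrib_left)

lemma leaves_finite [simp]: "finite (leaves K d)"
proof -
  have "leaves K d = {js. set js \<subseteq> {..<K} \<and> length js = d}" by (auto simp: leaves_def)
  then show ?thesis by (simp add: finite_lists_length_eq)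
qed

lemma leaves_nonempty: "K \<ge> 1 \<Longrightarrow> leaves K d \<noteq> {}"
proof -
  assume "K \<ge> 1"
  then have "replicate d 0 \<in> leaves K d" by (auto simp: leaves_def)
  then show ?thesis by blast
qed

lemma Mstar_cong:
  assumes "\<And>j z. j < K \<Longrightarrow> z \<le> zmax \<Longrightarrow> f j z = g j z" "\<And>j. Zs j \<le> zmax"
  shows "Mstar K d zmax f Zs = Mstar K d zmax g Zs"
proof -
  have "leaf_val zmax f Zs ` leaves K d = leaf_val zmax g Zs ` leaves K d"
    using assms by (intro image_cong refl leaf_val_cong[where K=K]) (auto simp: leaves_def)
  then show ?thesis by (simp add: Mstar_def)
qed

lemma subseq_strided:
  assumes "l < d" "H * d \<le> length p"
  shows "subseq (map (\<lambda>h. p ! (h * d + l)) [0..<H]) (take (H * d) p)"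
  using assms(2)
proof (induction H)
  case (Suc H)
  have "Suc H * d = H * d + d" by simp
  then have tk: "take (Suc H * d) p = take (H * d) p @ take d (drop (H * d) p)"
    by (simp only: take_add)
  have "take d (drop (H * d) p) ! l = p ! (H * d + l)" using Suc.prems assms(1) by simp
  moreover have "l < length (take d (drop (H * d) p))" using Suc.prems assms(1) by simp
  ultimately have "p ! (H * d + l) \<in> set (take d (drop (H * d) p))" by (metis nth_mem)
  then have "subseq [p ! (H * d + l)] (take d (drop (H * d) p))" by (simp add: subseq_singleton_left)
  then show ?case using Suc unfolding tk by (simp add: list_emb_append_mono)
qed simp

context gp_kernel_bounded
begin

text \<open>\<open>ws H j\<close> lists the plays of arm \<open>j\<close> at position
  \<open>l\<close> of the first \<open>H\<close> blocks, latest first. They lie in completed blocks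
  and so are among the data behind the posterior of block \<open>H\<close>, whose variance is
  therefore at most the one added in \<open>vsum\<close>.\<close>

lemma strided_pvar_sum:
  fixes p :: "(nat \<times> nat) list"
  assumes p: "set p \<subseteq> {..<K} \<times> {..zmax}" and l: "l < d" and len: "H * d \<le> length p"
  defines "ws \<equiv> \<lambda>H j. rev (map snd (filter (\<lambda>q. fst q = j) (map (\<lambda>h. p ! (h * d + l)) [0..<H])))"
  shows "(\<Sum>h<H. pvar (map snd (filter (\<lambda>q. fst q = fst (p ! (h * d + l))) (take (h * d) p))) (snd (p ! (h * d + l))))
     \<le> (\<Sum>j<K. vsum (ws H j))"
  using len
proof (induction H)
  case 0
  show ?case by (simp add: ws_def)
next
  case (Suc H)
  define q where "q = p ! (H * d + l)"
  have "q \<in> set p" unfolding q_def using Suc.prems l by (intro nth_mem) simp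
  then have q: "fst q < K" "snd q \<le> zmax" using p by auto
  have ws: "ws (Suc H) j = (if fst q = j then snd q # ws H j else ws H j)" for j
    by (simp add: ws_def q_def)
  have sub: "subseq (rev (ws H (fst q))) (map snd (filter (\<lambda>q'. fst q' = fst q) (take (H * d) p)))"
    unfolding ws_def using l Suc.prems by (auto intro!: subseq_map subseq_filter subseq_strided)
  have "set (map snd (filter (\<lambda>q'. fst q' = fst q) (take (H * d) p))) \<subseteq> {..zmax}"
    using p set_take_subset[of "H * d" p] by fastforce
  from pvar_subseq[OF sub this q(2)]
  have "pvar (map snd (filter (\<lambda>q'. fst q' = fst q) (take (H * d) p))) (snd q) \<le> pvar (rev (ws H (fst q))) (snd q)" .
  moreover have "(\<Sum>j<K. vsum (ws (Suc H) j)) = (\<Sum>j<K. vsum (ws H j)) + pvar (rev (ws H (fst q))) (snd q)"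
  proof -
    have "(\<Sum>j<K. vsum (ws (Suc H) j)) = (\<Sum>j<K. vsum (ws H j) + (if fst q = j then pvar (rev (ws H j)) (snd q) else 0))"
      by (intro sum.cong) (auto simp: ws)
    also have "\<dots> = (\<Sum>j<K. vsum (ws H j)) + (\<Sum>j<K. if fst q = j then pvar (rev (ws H j)) (snd q) else 0)"
      by (rule sum.distrib)
    also have "(\<Sum>j<K. if fst q = j then pvar (rev (ws H j)) (snd q) else 0) = pvar (rev (ws H (fst q))) (snd q)"
      using q by (subst sum.delta') auto
    finally show ?thesis .
  qed
  ultimately show ?case using Suc by (simp add: q_def)
qed

text \<open>Each of the \<open>d\<close> positions and \<open>K\<close> arms yields a sequence with
  at most one play per block, to which the bound for a single sequence applies.\<close>

lemma block_pvar_sum: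
  fixes p :: "(nat \<times> nat) list"
  assumes p: "set p \<subseteq> {..<K} \<times> {..zmax}" and len: "H * d \<le> length p" and H: "H \<le> Suc T" and T: "1 \<le> T"
  shows "(\<Sum>h<H. \<Sum>l<d. pvar (map snd (filter (\<lambda>q. fst q = fst (p ! (h * d + l))) (take (h * d) p))) (snd (p ! (h * d + l))))
     \<le> real d * real K * (4 / ln (1 + 1 / \<sigma>\<^sup>2) * info_gain zmax k \<sigma> T)"
proof -
  define ws where "ws l j = rev (map snd (filter (\<lambda>q. fst q = j) (map (\<lambda>h. p ! (h * d + l)) [0..<H])))" for l j
  have "vsum (ws l j) \<le> 4 / ln (1 + 1 / \<sigma>\<^sup>2) * info_gain zmax k \<sigma> T" if l: "l < d" for l j
  proof (rule vsum_le_info_gain[OF _ _ T])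
    have "set (ws l j) \<subseteq> snd ` set p"
    proof -
      have "p ! (h * d + l) \<in> set p" if "h < H" for h
      proof (rule nth_mem)
        have "h * d + l < Suc h * d" using l by simp
        also have "\<dots> \<le> H * d" using that by (intro mult_right_mono) auto
        finally show "h * d + l < length p" using len by simp
      qed
      then show ?thesis by (auto simp: ws_def)
    qed
    then show "set (ws l j) \<subseteq> {..zmax}" using p by fastforce
    have "length (ws l j) \<le> H"
      unfolding ws_def by (simp, rule le_trans[OF length_filter_le]) simp
    then show "length (ws l j) \<le> Suc T" using H by simp
  qed
  then have "(\<Sum>l<d. \<Sum>j<K. vsum (ws l j)) \<le> (\<Sum>l<d. \<Sum>j<K. 4 / ln (1 + 1 / \<sigma>\<^sup>2) * info_gain zmax k \<sigma> T)"
    by (intro sum_mono) auto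
  moreover have "(\<Sum>l<d. \<Sum>h<H. pvar (map snd (filter (\<lambda>q. fst q = fst (p ! (h * d + l))) (take (h * d) p))) (snd (p ! (h * d + l))))
     \<le> (\<Sum>l<d. \<Sum>j<K. vsum (ws l j))"
    unfolding ws_def using strided_pvar_sum[OF p _ len] by (intro sum_mono) auto
  ultimately show ?thesis by (subst sum.swap) (simp add: mult.assoc)
qed

end

section \<open>Histories of the algorithm\<close>

locale bandit = gp_kernel_bounded +
  fixes K d :: nat and sel :: "(nat \<Rightarrow> nat) \<Rightarrow> (nat list \<Rightarrow> real) \<Rightarrow> nat list" and Z0 :: "nat \<Rightarrow> nat"
  assumes K_pos: "K \<ge> 1" and d_pos: "d \<ge> 1" and Z0_le: "\<And>j. Z0 j \<le> zmax"
    and tie: "tie_rule K d sel"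
begin

text \<open>\<open>state\<close> and \<open>plays\<close> are functions of the arm sequence alone.
  Randomness sits in the values that \<open>obs\<close> fills in and in which sequence
  occurs.\<close>

definition state :: "nat list \<Rightarrow> nat \<Rightarrow> nat" where
  "state js = fst (play_times zmax 0 js (Z0, \<lambda>_. []))"

definition plays :: "nat list \<Rightarrow> nat \<Rightarrow> (nat \<times> nat) list" where
  "plays js = snd (play_times zmax 0 js (Z0, \<lambda>_. []))"

definition obs :: "nat list \<Rightarrow> (rnd_idx \<Rightarrow> real) \<Rightarrow> nat \<Rightarrow> (nat \<times> real) list" where
  "obs js \<omega> = obs_of \<sigma> (rb_f zmax k \<omega>) \<omega> (plays js)"

text \<open>Defined for every \<open>js\<close>, whether or not the run follows it: the leaf that
  would be chosen in block \<open>h\<close> after \<open>js\<close>. This permits comparing two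
  outcomes along a fixed sequence.\<close>

definition choice :: "nat \<Rightarrow> nat list \<Rightarrow> (rnd_idx \<Rightarrow> real) \<Rightarrow> nat list" where
  "choice h js \<omega> = ts_choice K d zmax k \<sigma> sel \<omega> h (state js, obs js \<omega>)"

primrec hist :: "nat \<Rightarrow> (rnd_idx \<Rightarrow> real) \<Rightarrow> nat list" where
  "hist 0 \<omega> = []"
| "hist (Suc h) \<omega> = hist h \<omega> @ choice h (hist h \<omega>) \<omega>"

definition hists :: "nat \<Rightarrow> nat list set" where
  "hists h = {js. set js \<subseteq> {..<K} \<and> length js = h * d}"

lemma finite_hists: "finite (hists h)"
  unfolding hists_def by (simp add: finite_lists_length_eq)

lemma choice_leaves: "choice h js \<omega> \<in> leaves K d"
  using tie by (auto simp: choice_def ts_choice_def tie_rule_def)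

lemma choice_set: "set (choice h js \<omega>) \<subseteq> {..<K}" and length_choice [simp]: "length (choice h js \<omega>) = d"
  using choice_leaves[of h js \<omega>] by (auto simp: leaves_def)

lemma choice_max:
  assumes "i \<in> leaves K d"
  shows "leaf_val zmax (ts_sample zmax k \<sigma> \<omega> h (obs js \<omega>)) (state js) i
     \<le> leaf_val zmax (ts_sample zmax k \<sigma> \<omega> h (obs js \<omega>)) (state js) (choice h js \<omega>)"
proof -
  define \<eta> where "\<eta> = restrict (leaf_val zmax (ts_sample zmax k \<sigma> \<omega> h (obs js \<omega>)) (state js)) (leaves K d)"
  have c: "choice h js \<omega> = sel (state js) \<eta>" by (simp add: choice_def ts_choice_def \<eta>_def)
  have "\<eta> i \<le> \<eta> (choice h js \<omega>)" unfolding c using tie assms by (simp add: tie_rule_def)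
  then show ?thesis using assms choice_leaves[of h js \<omega>] by (simp add: \<eta>_def)
qed

lemma hist_hists: "hist h \<omega> \<in> hists h"
  using choice_set by (induction h) (auto simp: hists_def)

lemma hist_set: "set (hist h \<omega>) \<subseteq> {..<K}" and length_hist [simp]: "length (hist h \<omega>) = h * d"
  using hist_hists[of h \<omega>] by (auto simp: hists_def)

lemma state_le: "state js i \<le> zmax"
  unfolding state_def by (rule fst_play_times_le[OF Z0_le])

lemma plays_append: "play_times zmax (length js) js' (state js, plays js) = (state (js @ js'), plays (js @ js'))"
  by (simp add: state_def plays_def play_times_append)

lemma ts_run_hist: "ts_run K d zmax k \<sigma> sel Z0 \<omega> h = (state (hist h \<omega>), obs (hist h \<omega>) \<omega>)"
proof (induction h)
  case 0
  show ?case by (simp add: state_def obs_def plays_def obs_of_def fun_eq_iff)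
next
  case (Suc h)
  let ?js = "hist h \<omega>"
  have "ts_run K d zmax k \<sigma> sel Z0 \<omega> (Suc h)
      = play_leaf zmax \<sigma> (rb_f zmax k \<omega>) \<omega> (length ?js) (choice h ?js \<omega>) (state ?js, obs ?js \<omega>)"
    by (simp add: Suc choice_def Let_def)
  also have "\<dots> = (state (hist (Suc h) \<omega>), obs (hist (Suc h) \<omega>) \<omega>)"
    unfolding obs_def play_leaf_obs_of plays_append by simp
  finally show ?case .
qed

lemma times_ok_plays: "set js \<subseteq> {..<K} \<Longrightarrow> times_ok zmax K (length js) (plays js)"
  using times_ok_play_times[of zmax K 0 "\<lambda>_. []" Z0 js] Z0_le
  by (simp add: plays_def times_ok_def)

lemma plays_mono: "set (plays js j) \<subseteq> set (plays (js @ js') j)"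
  using set_play_times_mono[of "plays js" j zmax "length js" js' "state js"] by (simp add: plays_append)

lemma map_fst_plays: "map fst (plays js j) = map snd (filter (\<lambda>q. fst q = j) (leaf_path zmax Z0 js))"
  unfolding plays_def map_fst_play_times by simp

lemma leaf_path_snoc: "leaf_path zmax Z0 (js @ js') = leaf_path zmax Z0 js @ leaf_path zmax (state js) js'"
  unfolding state_def by (rule leaf_path_append)

text \<open>The data along \<open>js\<close> with placeholder values: enough for covariances and
  weights, and free of \<open>\<omega>\<close>.\<close>

definition base :: "nat list \<Rightarrow> nat \<Rightarrow> (nat \<times> real) list" where
  "base js j = map (\<lambda>q. (fst q, 0)) (plays js j)"

lemma length_base [simp]: "length (base js j) = length (plays js j)"
  by (simp add: base_def)

lemma fst_base [simp]: "a < length (plays js j) \<Longrightarrow> fst (base js j ! a) = fst (plays js j ! a)"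
  by (simp add: base_def)

lemma map_fst_obs: "map fst (obs js \<omega> j) = map fst (base js j)"
  by (simp add: obs_def obs_of_def base_def split_def comp_def)

lemma length_obs [simp]: "length (obs js \<omega> j) = length (plays js j)"
  by (simp add: obs_def obs_of_def)

lemma snd_obs: "a < length (plays js j) \<Longrightarrow> snd (obs js \<omega> j ! a)
    = rb_f zmax k \<omega> j (fst (plays js j ! a)) + \<sigma> * \<omega> (NoiseR (snd (plays js j ! a)))"
  by (simp add: obs_def obs_of_def split_def)

lemmas post_cov_obs = post_cov_cong(1)[OF map_fst_obs]
  and weights_obs = post_cov_cong(2)[OF map_fst_obs]

lemma plays_le: "set js \<subseteq> {..<K} \<Longrightarrow> q \<in> set (plays js j) \<Longrightarrow> fst q \<le> zmax \<and> snd q < length js"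
  using times_ok_plays[of js] by (auto simp: times_ok_def)

lemma obs_ok_base: "set js \<subseteq> {..<K} \<Longrightarrow> obs_ok (base js j)"
  using plays_le[OF _ nth_mem] by (auto simp: obs_ok_def)

lemma obs_ok_obs: "set js \<subseteq> {..<K} \<Longrightarrow> obs_ok (obs js \<omega> j)"
  using plays_le[of js _ j] by (auto simp: obs_ok_def obs_def obs_of_def split_def)

lemma post_mean_obs:
  assumes "set js \<subseteq> {..<K}" "z \<le> zmax"
  shows "post_mean k \<sigma> (obs js \<omega> j) z = (\<Sum>a<length (plays js j). weights (base js j) z a *
    (rb_f zmax k \<omega> j (fst (plays js j ! a)) + \<sigma> * \<omega> (NoiseR (snd (plays js j ! a)))))"
  unfolding post_mean_weights[OF obs_ok_obs[OF assms(1)] assms(2)] weights_obs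
  by (simp add: snd_obs)

lemma ts_sample_obs:
  "ts_sample zmax k \<sigma> \<omega> h (obs js \<omega>) j z = post_mean k \<sigma> (obs js \<omega> j) z +
     (\<Sum>c\<le>zmax. mat_sqrt zmax (post_cov k \<sigma> (base js j)) z c * \<omega> (SampR h j c))"
  unfolding ts_sample_def post_cov_obs ..

section \<open>Measurability along the history\<close>

lemma space_rb_space [simp]: "space rb_space = UNIV"
  by (simp add: rb_space_def space_PiM)

lemma measurable_coord [measurable]: "(\<lambda>\<omega>. \<omega> i) \<in> borel_measurable rb_space"
proof -
  have "(\<lambda>\<omega>. \<omega> i) \<in> rb_space \<rightarrow>\<^sub>M std_gauss"
    unfolding rb_space_def by (rule measurable_component_singleton) simp
  then show ?thesis using measurable_cong_sets[OF refl sets_std_gauss] by blast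
qed

lemma measurable_rb_f [measurable]: "(\<lambda>\<omega>. rb_f zmax k \<omega> j z) \<in> borel_measurable rb_space"
  unfolding rb_f_def by measurable

lemma measurable_post_mean:
  assumes "set js \<subseteq> {..<K}" "z \<le> zmax"
  shows "(\<lambda>\<omega>. post_mean k \<sigma> (obs js \<omega> j) z) \<in> borel_measurable rb_space"
  unfolding post_mean_obs[OF assms] by measurable

lemma measurable_ts_sample:
  assumes "set js \<subseteq> {..<K}" "z \<le> zmax"
  shows "(\<lambda>\<omega>. ts_sample zmax k \<sigma> \<omega> h (obs js \<omega>) j z) \<in> borel_measurable rb_space"
  using measurable_post_mean[OF assms] unfolding ts_sample_obs by measurable

lemma measurable_leaf_val:
  assumes "\<And>j z. j < K \<Longrightarrow> z \<le> zmax \<Longrightarrow> (\<lambda>\<omega>. f \<omega> j z) \<in> borel_measurable M"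
    and "set js \<subseteq> {..<K}" and "\<And>j. Zs j \<le> zmax"
  shows "(\<lambda>\<omega>. leaf_val zmax (f \<omega>) Zs js) \<in> borel_measurable M"
  using assms(2,3)
proof (induction js arbitrary: Zs)
  case (Cons j js)
  have "(\<lambda>\<omega>. leaf_val zmax (f \<omega>) (rb_step zmax Zs j) js) \<in> borel_measurable M"
    using Cons.prems by (intro Cons.IH rb_step_le) auto
  then show ?case using Cons.prems assms(1)[of j "Zs j"] by simp
qed simp

lemma measurable_choice:
  assumes "set js \<subseteq> {..<K}"
  shows "choice h js \<in> rb_space \<rightarrow>\<^sub>M count_space UNIV"
proof -
  have "(\<lambda>\<omega>. restrict (leaf_val zmax (ts_sample zmax k \<sigma> \<omega> h (obs js \<omega>)) (state js)) (leaves K d))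
     \<in> rb_space \<rightarrow>\<^sub>M (\<Pi>\<^sub>M i\<in>leaves K d. borel)"
    using assms by (intro measurable_restrict measurable_leaf_val measurable_ts_sample state_le) (auto simp: leaves_def)
  moreover have "sel (state js) \<in> (\<Pi>\<^sub>M i\<in>leaves K d. borel) \<rightarrow>\<^sub>M count_space UNIV"
    using tie by (auto simp: tie_rule_def)
  ultimately have "(\<lambda>\<omega>. sel (state js) (restrict (leaf_val zmax (ts_sample zmax k \<sigma> \<omega> h (obs js \<omega>)) (state js)) (leaves K d)))
     \<in> rb_space \<rightarrow>\<^sub>M count_space UNIV" by (rule measurable_compose)
  then show ?thesis by (simp add: choice_def[abs_def] ts_choice_def)
qed

text \<open>There are countably many arm sequences, so the value at the random history is measurable
  piece by piece. Sequences with an invalid arm never occur and get a constant.\<close>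

lemma measurable_at_hist:
  assumes h: "hist h \<in> rb_space \<rightarrow>\<^sub>M count_space UNIV"
    and f: "\<And>js. set js \<subseteq> {..<K} \<Longrightarrow> f js \<in> rb_space \<rightarrow>\<^sub>M N" and N: "space N \<noteq> {}"
  shows "(\<lambda>\<omega>. f (hist h \<omega>) \<omega>) \<in> rb_space \<rightarrow>\<^sub>M N"
proof -
  obtain c where c: "c \<in> space N" using N by blast
  define F where "F js = (if set js \<subseteq> {..<K} then f js else (\<lambda>_. c))" for js
  have "F js \<in> rb_space \<rightarrow>\<^sub>M N" for js
    using f c by (cases "set js \<subseteq> {..<K}") (simp_all add: F_def)
  then have "(\<lambda>\<omega>. F (hist h \<omega>) \<omega>) \<in> rb_space \<rightarrow>\<^sub>M N"
    by (rule measurable_compose_countable[OF _ h])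
  then show ?thesis by (simp add: F_def hist_set)
qed

lemma measurable_hist [measurable]: "hist h \<in> rb_space \<rightarrow>\<^sub>M count_space UNIV"
proof (induction h)
  case (Suc h)
  have "(\<lambda>\<omega>. js @ choice h js \<omega>) \<in> rb_space \<rightarrow>\<^sub>M count_space UNIV" if "set js \<subseteq> {..<K}" for js
    by (rule measurable_compose[OF measurable_choice[OF that]]) simp
  from measurable_at_hist[of h "\<lambda>js \<omega>. js @ choice h js \<omega>", OF Suc this]
  show ?case by simp
qed simp

lemma choice_cong:
  assumes "obs js \<omega> = obs js \<omega>'" "\<And>j c. j < K \<Longrightarrow> c \<le> zmax \<Longrightarrow> \<omega> (SampR h j c) = \<omega>' (SampR h j c)"
  shows "choice h js \<omega> = choice h js \<omega>'"
proof -
  have "leaf_val zmax (ts_sample zmax k \<sigma> \<omega> h (obs js \<omega>)) (state js) i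
     = leaf_val zmax (ts_sample zmax k \<sigma> \<omega>' h (obs js \<omega>')) (state js) i" if "i \<in> leaves K d" for i
    using that assms(2)
    by (intro leaf_val_cong[where K=K] state_le) (auto simp: leaves_def ts_sample_def assms(1))
  then have "restrict (leaf_val zmax (ts_sample zmax k \<sigma> \<omega> h (obs js \<omega>)) (state js)) (leaves K d)
     = restrict (leaf_val zmax (ts_sample zmax k \<sigma> \<omega>' h (obs js \<omega>')) (state js)) (leaves K d)"
    by (intro restrict_ext)
  then show ?thesis by (simp only: choice_def ts_choice_def fst_conv snd_conv)
qed

end

definition coord :: "'i \<Rightarrow> 'i \<Rightarrow> real" where
  "coord i = (\<lambda>i'. if i' = i then 1 else 0)"

lemma ip_coord: "finite S \<Longrightarrow> i \<in> S \<Longrightarrow> ip S (coord i) v = v i"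
  unfolding ip_def coord_def by (subst sum.remove[of _ i]) (auto intro!: sum.neutral)

text \<open>A substitute for conditioning on the functionals in \<open>X\<close>: pairing each
  \<open>x\<close> with itself and \<open>a r\<close> with \<open>b r\<close> meets the Gram
  condition, the mixed products being equal by \<open>fixed\<close>.\<close>

lemma isometry_fixing:
  fixes a b :: "'r \<Rightarrow> 'i \<Rightarrow> real"
  assumes "finite S" "finite X" "finite R"
    and fixed: "\<And>x r. x \<in> X \<Longrightarrow> r \<in> R \<Longrightarrow> ip S x (a r) = ip S x (b r)"
    and gram: "\<And>r r'. r \<in> R \<Longrightarrow> r' \<in> R \<Longrightarrow> ip S (a r) (a r') = ip S (b r) (b r')"
  obtains T where "T \<in> (\<Pi>\<^sub>M i\<in>UNIV. std_gauss) \<rightarrow>\<^sub>M (\<Pi>\<^sub>M i\<in>UNIV. std_gauss)"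
    "distr (\<Pi>\<^sub>M i\<in>UNIV. std_gauss) (\<Pi>\<^sub>M i\<in>UNIV. std_gauss) T = (\<Pi>\<^sub>M i\<in>UNIV. std_gauss)"
    "\<And>x \<omega>. x \<in> X \<Longrightarrow> ip S x (T \<omega>) = ip S x \<omega>"
    "\<And>r \<omega>. r \<in> R \<Longrightarrow> ip S (a r) (T \<omega>) = ip S (b r) \<omega>"
proof -
  have fixed': "ip S (a r) x = ip S (b r) x" if "x \<in> X" "r \<in> R" for x r
    using fixed[OF that] by (simp add: ip_commute)
  define P where "P = (\<lambda>x. (x, x)) ` X \<union> (\<lambda>r. (a r, b r)) ` R"
  have fin: "finite P" using assms by (simp add: P_def)
  have gramP: "ip S u u' = ip S v v'" if "(u, v) \<in> P" "(u', v') \<in> P" for u v u' v'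
    using that unfolding P_def by (elim UnE imageE Pair_inject; hypsubst; simp only: fixed fixed' gram)
  show thesis
  proof (rule gauss_isometry_ip[OF assms(1) fin gramP])
    fix T :: "('i \<Rightarrow> real) \<Rightarrow> 'i \<Rightarrow> real"
    assume T: "T \<in> (\<Pi>\<^sub>M i\<in>UNIV. std_gauss) \<rightarrow>\<^sub>M (\<Pi>\<^sub>M i\<in>UNIV. std_gauss)"
      "distr (\<Pi>\<^sub>M i\<in>UNIV. std_gauss) (\<Pi>\<^sub>M i\<in>UNIV. std_gauss) T = (\<Pi>\<^sub>M i\<in>UNIV. std_gauss)"
      "\<And>u v \<omega>. (u, v) \<in> P \<Longrightarrow> ip S u (T \<omega>) = ip S v \<omega>"
    show thesis
      by (rule that[OF T(1,2)]; rule T(3)) (simp_all add: P_def)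
  qed
qed

section \<open>The Gram matrix of observations and recovery functions\<close>

text \<open>A fixed arm sequence of \<open>h\<close> blocks turns every observation into a fixed
  linear functional of \<open>\<omega>\<close>.\<close>

locale design = bandit +
  fixes h :: nat and js :: "nat list"
  assumes js: "js \<in> hists h"
begin

lemma js_set: "set js \<subseteq> {..<K}" and js_len: "length js = h * d"
  using js by (auto simp: hists_def)

text \<open>The coordinates that matter up to the choice in block \<open>h\<close>: the prior, the
  noise of the rounds before that block, and the samples including its own.\<close>

definition idx :: "rnd_idx set" where
  "idx = (\<lambda>(j, c). PriorR j c) ` ({..<K} \<times> {..zmax}) \<union> NoiseR ` {..<length js}
     \<union> (\<lambda>(h', j, c). SampR h' j c) ` ({..h} \<times> {..<K} \<times> {..zmax})"

lemma finite_idx [simp]: "finite idx"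
  by (simp add: idx_def)

lemma PriorR_idx [simp]: "PriorR j c \<in> idx \<longleftrightarrow> j < K \<and> c \<le> zmax"
  and NoiseR_idx [simp]: "NoiseR t \<in> idx \<longleftrightarrow> t < length js"
  and SampR_idx [simp]: "SampR h' j c \<in> idx \<longleftrightarrow> h' \<le> h \<and> j < K \<and> c \<le> zmax"
  by (auto simp: idx_def image_iff)

lemma ip_coord_idx [simp]: "i \<in> idx \<Longrightarrow> ip idx (coord i) v = v i"
  by (rule ip_coord) simp_all

text \<open>\<open>fvec\<close>, \<open>yvec\<close> and \<open>mvec\<close> are the coefficient
  vectors of a recovery value, an observation and a posterior mean; \<open>gvec\<close> is that of
  the sample of block \<open>h\<close> minus the posterior mean.\<close>

definition fvec :: "nat \<Rightarrow> nat \<Rightarrow> rnd_idx \<Rightarrow> real" where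
  "fvec j z = (\<lambda>i. \<Sum>c\<le>zmax. feat z c * coord (PriorR j c) i)"

definition yvec :: "nat \<Rightarrow> nat \<times> nat \<Rightarrow> rnd_idx \<Rightarrow> real" where
  "yvec j q = (\<lambda>i. fvec j (fst q) i + \<sigma> * coord (NoiseR (snd q)) i)"

definition mvec :: "nat \<Rightarrow> nat \<Rightarrow> rnd_idx \<Rightarrow> real" where
  "mvec j z = (\<lambda>i. \<Sum>a<length (plays js j). weights (base js j) z a * yvec j (plays js j ! a) i)"

definition gvec :: "nat \<Rightarrow> nat \<Rightarrow> rnd_idx \<Rightarrow> real" where
  "gvec j z = (\<lambda>i. \<Sum>c\<le>zmax. mat_sqrt zmax (post_cov k \<sigma> (base js j)) z c * coord (SampR h j c) i)"

lemma ip_fvec: "j < K \<Longrightarrow> ip idx (fvec j z) v = (\<Sum>c\<le>zmax. feat z c * v (PriorR j c))"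
  unfolding fvec_def ip_sum_left ip_scale_left by (intro sum.cong) auto

lemma ip_yvec: "j < K \<Longrightarrow> snd q < length js \<Longrightarrow> ip idx (yvec j q) v = ip idx (fvec j (fst q)) v + \<sigma> * v (NoiseR (snd q))"
  unfolding yvec_def ip_add_left ip_scale_left by simp

lemma ip_mvec: "ip idx (mvec j z) v = (\<Sum>a<length (plays js j). weights (base js j) z a * ip idx (yvec j (plays js j ! a)) v)"
  unfolding mvec_def ip_sum_left ip_scale_left ..

lemma ip_gvec: "j < K \<Longrightarrow> ip idx (gvec j z) v = (\<Sum>c\<le>zmax. mat_sqrt zmax (post_cov k \<sigma> (base js j)) z c * v (SampR h j c))"
  unfolding gvec_def ip_sum_left ip_scale_left by (intro sum.cong) auto

lemma fvec_PriorR: "fvec j z (PriorR j' c) = (if j = j' \<and> c \<le> zmax then feat z c else 0)"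
proof -
  have "fvec j z (PriorR j' c) = (\<Sum>c'\<le>zmax. if c' = c then (if j = j' then feat z c else 0) else 0)"
    unfolding fvec_def coord_def by (intro sum.cong) auto
  then show ?thesis by simp
qed

lemma fvec_other [simp]: "fvec j z (NoiseR t) = 0" "fvec j z (SampR h' j' c) = 0"
  by (auto simp: fvec_def coord_def)

lemma yvec_other [simp]: "yvec j q (SampR h' j' c) = 0" "yvec j q (NoiseR t) = (if t = snd q then \<sigma> else 0)"
    "yvec j q (PriorR j' c) = fvec j (fst q) (PriorR j' c)"
  by (auto simp: yvec_def coord_def)

lemma mvec_SampR [simp]: "mvec j z (SampR h' j' c) = 0"
  by (simp add: mvec_def)

lemma gvec_other [simp]: "gvec j z (NoiseR t) = 0" "gvec j z (PriorR j' c) = 0"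
  by (auto simp: gvec_def coord_def)

lemma gvec_SampR: "gvec j z (SampR h' j' c) =
    (if h' = h \<and> j = j' \<and> c \<le> zmax then mat_sqrt zmax (post_cov k \<sigma> (base js j)) z c else 0)"
proof -
  have "gvec j z (SampR h' j' c) = (\<Sum>c'\<le>zmax. if c' = c then
     (if h' = h \<and> j = j' then mat_sqrt zmax (post_cov k \<sigma> (base js j)) z c else 0) else 0)"
    unfolding gvec_def coord_def by (intro sum.cong) auto
  then show ?thesis by simp
qed

lemma ip_fvec_fvec:
  assumes "j < K" "z \<le> zmax" "z' \<le> zmax"
  shows "ip idx (fvec j z) (fvec j' z') = (if j = j' then k z z' else 0)"
  using assms by (simp add: ip_fvec fvec_PriorR kernel_feat)

lemma ip_fvec_yvec:
  assumes "j < K" "z \<le> zmax" "fst q \<le> zmax"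
  shows "ip idx (fvec j z) (yvec j' q) = (if j = j' then k z (fst q) else 0)"
  using assms ip_fvec_fvec[of j z "fst q" j'] by (simp add: ip_fvec)

lemma plays_nth_le:
  assumes "a < length (plays js j)"
  shows "fst (plays js j ! a) \<le> zmax" "snd (plays js j ! a) < length js"
  using plays_le[OF js_set nth_mem[OF assms]] by auto

lemma snd_plays_eq_iff:
  assumes "a < length (plays js j)" "b < length (plays js j')"
  shows "snd (plays js j ! a) = snd (plays js j' ! b) \<longleftrightarrow> j = j' \<and> a = b"
proof -
  have t: "times_ok zmax K (length js) (plays js)" by (rule times_ok_plays[OF js_set])
  show ?thesis
  proof (cases "j = j'")
    case True
    have "distinct (map snd (plays js j))" using t by (simp add: times_ok_def)
    then show ?thesis using True assms nth_eq_iff_index_eq[of "map snd (plays js j)" a b] by simp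
  next
    case False
    then have "snd ` set (plays js j) \<inter> snd ` set (plays js j') = {}" using t by (simp add: times_ok_def)
    then have "snd (plays js j ! a) \<noteq> snd (plays js j' ! b)"
      using nth_mem[OF assms(1)] nth_mem[OF assms(2)] by fastforce
    then show ?thesis using False by simp
  qed
qed

lemma ip_yvec_yvec:
  assumes j: "j < K" and a: "a < length (plays js j)" and b: "b < length (plays js j')"
  shows "ip idx (yvec j (plays js j ! a)) (yvec j' (plays js j' ! b))
     = (if j = j' then gram_noise k \<sigma> (base js j) a b else 0)"
  using j a b plays_nth_le[OF a] plays_nth_le[OF b] snd_plays_eq_iff[OF a b]
  by (auto simp: ip_yvec ip_fvec_yvec gram_noise_def power2_eq_square)

text \<open>The normal equations: \<open>fvec j z\<close> minus \<open>mvec j z\<close> is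
  orthogonal to every observation. For observations of another arm both products vanish.\<close>

lemma ip_mvec_yvec:
  assumes j: "j < K" and z: "z \<le> zmax" and b: "b < length (plays js j')"
  shows "ip idx (mvec j z) (yvec j' (plays js j' ! b)) = ip idx (fvec j z) (yvec j' (plays js j' ! b))"
proof (cases "j = j'")
  case False
  then show ?thesis using j z b plays_nth_le[OF b]
    by (simp add: ip_mvec ip_yvec_yvec ip_fvec_yvec)
next
  case True
  note ok = obs_ok_base[OF js_set, of j]
  have sym: "gram_noise k \<sigma> (base js j') a b = gram_noise k \<sigma> (base js j') b a"
    if "a < length (plays js j')" for a
    using gram_sym[OF ok, of a b] that b True by simp
  have "ip idx (mvec j z) (yvec j' (plays js j' ! b))
      = (\<Sum>a<length (base js j). gram_noise k \<sigma> (base js j) b a * weights (base js j) z a)"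
    using j b True by (auto simp: ip_mvec ip_yvec_yvec sym mult.commute intro!: sum.cong)
  also have "\<dots> = k (fst (plays js j ! b)) z"
    using weights_solve[OF ok, of b z] b True by simp
  also have "\<dots> = ip idx (fvec j z) (yvec j' (plays js j' ! b))"
    using True j z b plays_nth_le[OF b] by (simp add: ip_fvec_yvec kernel_sym)
  finally show ?thesis .
qed

lemma ip_fvec_mvec:
  assumes j: "j < K" "j' < K" and z: "z \<le> zmax" "z' \<le> zmax"
  shows "ip idx (fvec j z) (mvec j' z') = (if j = j' then k z z' - post_cov k \<sigma> (base js j) z z' else 0)"
proof -
  have "ip idx (fvec j z) (mvec j' z') = (\<Sum>a<length (plays js j'). weights (base js j') z' a * ip idx (fvec j z) (yvec j' (plays js j' ! a)))"
    unfolding mvec_def ip_sum_right ip_scale_right ..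
  also have "\<dots> = (if j = j' then \<Sum>a<length (plays js j'). k z (fst (plays js j' ! a)) * weights (base js j') z' a else 0)"
    using j z plays_nth_le by (auto simp: ip_fvec_yvec intro!: sum.cong)
  finally show ?thesis by (auto simp: post_cov_weights)
qed

text \<open>\<open>mvec\<close> is a combination of observations, to which the residual is
  orthogonal.\<close>

lemma ip_mvec_mvec:
  assumes j: "j < K" "j' < K" and z: "z \<le> zmax" "z' \<le> zmax"
  shows "ip idx (mvec j z) (mvec j' z') = ip idx (fvec j z) (mvec j' z')"
proof -
  have e: "ip idx v (mvec j' z') = (\<Sum>a<length (plays js j'). weights (base js j') z' a * ip idx v (yvec j' (plays js j' ! a)))" for v
    unfolding mvec_def ip_sum_right ip_scale_right ..
  show ?thesis unfolding e using j z by (intro sum.cong refl) (simp add: ip_mvec_yvec)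
qed

definition rvec :: "nat \<Rightarrow> nat \<Rightarrow> rnd_idx \<Rightarrow> real" where
  "rvec j z = (\<lambda>i. fvec j z i - mvec j z i)"

lemma ip_rvec_rvec:
  assumes "j < K" "z \<le> zmax" "z' \<le> zmax"
  shows "ip idx (rvec j z) (rvec j z') = post_cov k \<sigma> (base js j) z z'"
  unfolding rvec_def ip_diff_left ip_diff_right
  using assms by (simp add: ip_mvec_mvec ip_fvec_mvec ip_fvec_fvec ip_commute[of idx "mvec j z" "fvec j z'"])
     (metis assms ip_commute ip_fvec_mvec ip_mvec_mvec diff_eq_eq add.commute kernel_sym)

text \<open>As the Gram matrix of the residuals, the posterior covariance is symmetric and positive
  semidefinite, so the square root used for sampling exists.\<close>

lemma post_cov_sqrt:
  assumes "j < K" "z \<le> zmax" "z' \<le> zmax"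
  shows "(\<Sum>c\<le>zmax. mat_sqrt zmax (post_cov k \<sigma> (base js j)) z c * mat_sqrt zmax (post_cov k \<sigma> (base js j)) z' c)
     = post_cov k \<sigma> (base js j) z z'"
proof (rule mat_sqrt_works)
  show "post_cov k \<sigma> (base js j) a b = post_cov k \<sigma> (base js j) b a" if "a \<le> zmax" "b \<le> zmax" for a b
    using that assms by (simp flip: ip_rvec_rvec add: ip_commute)
  fix c :: "nat \<Rightarrow> real"
  have "0 \<le> ip idx (\<lambda>i. \<Sum>a\<le>zmax. c a * rvec j a i) (\<lambda>i. \<Sum>a\<le>zmax. c a * rvec j a i)"
    by (rule ip_self_nonneg)
  also have "\<dots> = (\<Sum>a\<le>zmax. \<Sum>b\<le>zmax. c a * c b * post_cov k \<sigma> (base js j) a b)"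
    unfolding ip_sum_left ip_sum_right ip_scale_left ip_scale_right
    using assms by (auto simp: ip_rvec_rvec sum_distrib_left mult.assoc intro!: sum.cong)
  finally show "0 \<le> (\<Sum>a\<le>zmax. \<Sum>b\<le>zmax. c a * c b * post_cov k \<sigma> (base js j) a b)" .
qed (use assms in auto)

lemma ip_gvec_gvec:
  assumes "j < K" "z \<le> zmax" "z' \<le> zmax"
  shows "ip idx (gvec j z) (gvec j' z') = (if j = j' then post_cov k \<sigma> (base js j) z z' else 0)"
  using assms by (simp add: ip_gvec gvec_SampR post_cov_sqrt)

text \<open>The functionals in \<open>past h\<close> determine whether the first \<open>h\<close> blocks are played along \<open>js\<close>;
  those in \<open>past (Suc h)\<close> determine the choice in block \<open>h\<close> as well.\<close>

definition past :: "nat \<Rightarrow> (rnd_idx \<Rightarrow> real) set" where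
  "past m = (\<Union>j<K. (\<lambda>a. yvec j (plays js j ! a)) ` {..<length (plays js j)})
     \<union> (\<lambda>(h', j, c). coord (SampR h' j c)) ` ({..<m} \<times> {..<K} \<times> {..zmax})"

lemma finite_past: "finite (past m)"
  by (simp add: past_def)

lemma pastE:
  assumes "x \<in> past m"
  obtains (obs) j a where "j < K" "a < length (plays js j)" "x = yvec j (plays js j ! a)"
    | (samp) h' j c where "h' < m" "j < K" "c \<le> zmax" "x = coord (SampR h' j c)"
  using assms by (auto simp: past_def)

definition preserves_past :: "nat \<Rightarrow> ((rnd_idx \<Rightarrow> real) \<Rightarrow> rnd_idx \<Rightarrow> real) \<Rightarrow> bool" where
  "preserves_past m T \<longleftrightarrow> T \<in> rb_space \<rightarrow>\<^sub>M rb_space \<and> distr rb_space rb_space T = rb_space \<and>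
     (\<forall>x\<in>past m. \<forall>\<omega>. ip idx x (T \<omega>) = ip idx x \<omega>)"

lemma ip_fvec_eq_rb_f: "j < K \<Longrightarrow> ip idx (fvec j z) \<omega> = rb_f zmax k \<omega> j z"
  by (simp add: ip_fvec rb_f_def feat_def)

lemma ip_mvec_eq_post_mean:
  assumes "j < K" "z \<le> zmax"
  shows "ip idx (mvec j z) \<omega> = post_mean k \<sigma> (obs js \<omega> j) z"
  using assms plays_nth_le
  by (auto simp: ip_mvec post_mean_obs[OF js_set] ip_yvec ip_fvec_eq_rb_f intro!: sum.cong)

lemma ip_gvec_eq: "j < K \<Longrightarrow> z \<le> zmax \<Longrightarrow>
    ip idx (gvec j z) \<omega> = ts_sample zmax k \<sigma> \<omega> h (obs js \<omega>) j z - post_mean k \<sigma> (obs js \<omega> j) z"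
  by (simp add: ip_gvec ts_sample_obs)

context
  fixes m T assumes T: "preserves_past m T" and m: "h \<le> m" "m \<le> Suc h"
begin

text \<open>Stated for prefixes of \<open>js\<close>, since the choices of earlier blocks were made
  on the data available then.\<close>

lemma obs_prefix_preserved:
  assumes "js = js1 @ js2"
  shows "obs js1 (T \<omega>) = obs js1 \<omega>"
proof
  fix j
  show "obs js1 (T \<omega>) j = obs js1 \<omega> j"
  proof (cases "j < K")
    case False
    have "times_ok zmax K (length js1) (plays js1)"
      using js_set assms by (intro times_ok_plays) auto
    then have "plays js1 j = []" using False by (auto simp: times_ok_def)
    then show ?thesis by (simp add: obs_def obs_of_def)
  next
    case True
    show ?thesis unfolding obs_def obs_of_def
    proof (rule map_cong[OF refl])
      fix q assume "q \<in> set (plays js1 j)"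
      then have "q \<in> set (plays js j)" using plays_mono[of js1 j js2] assms by auto
      then obtain a where a: "a < length (plays js j)" "q = plays js j ! a"
        by (auto simp: in_set_conv_nth)
      then have "yvec j q \<in> past m" using True by (force simp: past_def)
      then have "ip idx (yvec j q) (T \<omega>) = ip idx (yvec j q) \<omega>"
        using T by (auto simp: preserves_past_def)
      then show "(case q of (z, t) \<Rightarrow> (z, rb_f zmax k (T \<omega>) j z + \<sigma> * T \<omega> (NoiseR t)))
          = (case q of (z, t) \<Rightarrow> (z, rb_f zmax k \<omega> j z + \<sigma> * \<omega> (NoiseR t)))"
        using True plays_nth_le[OF a(1)] a(2) by (simp add: split_def ip_yvec ip_fvec_eq_rb_f)
    qed
  qed
qed

lemma samp_preserved:
  assumes "h' < m" "j < K" "c \<le> zmax"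
  shows "T \<omega> (SampR h' j c) = \<omega> (SampR h' j c)"
proof -
  have "coord (SampR h' j c) \<in> past m" using assms by (force simp: past_def)
  then have "ip idx (coord (SampR h' j c)) (T \<omega>) = ip idx (coord (SampR h' j c)) \<omega>"
    using T by (auto simp: preserves_past_def)
  then show ?thesis using assms m by simp
qed

lemma choice_prefix_preserved:
  assumes "js = js1 @ js2" "h' < m"
  shows "choice h' js1 (T \<omega>) = choice h' js1 \<omega>"
  using assms samp_preserved by (intro choice_cong obs_prefix_preserved) auto

text \<open>Induction on the blocks: while the run follows \<open>js\<close>, the next choice
  depends on the data along that prefix and on the samples of a block before \<open>h\<close>, all
  of which \<open>T\<close> keeps.\<close>

lemma hist_preserved: "hist h (T \<omega>) = js \<longleftrightarrow> hist h \<omega> = js"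
proof -
  have "hist h' (T \<omega>) = take (h' * d) js \<longleftrightarrow> hist h' \<omega> = take (h' * d) js" if "h' \<le> h" for h'
    using that
  proof (induction h')
    case (Suc h')
    let ?t = "take (h' * d) js"
    have "(h' + 1) * d \<le> h * d" using Suc.prems by (intro mult_right_mono) auto
    then have len: "length ?t = h' * d" using js_len by simp
    have split: "take (Suc h' * d) js = ?t @ take d (drop (h' * d) js)"
      by (simp add: take_add[symmetric] add.commute)
    have eq: "hist (Suc h') \<omega>' = take (Suc h' * d) js
        \<longleftrightarrow> hist h' \<omega>' = ?t \<and> choice h' ?t \<omega>' = take d (drop (h' * d) js)" for \<omega>'
      unfolding split hist.simps by (subst append_eq_append_conv) (use len in auto)
    have "choice h' ?t (T \<omega>) = choice h' ?t \<omega>"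
      using Suc.prems m by (intro choice_prefix_preserved[of ?t "drop (h' * d) js"]) auto
    then show ?case unfolding eq using Suc by auto
  qed simp
  from this[of h] show ?thesis using js_len by simp
qed

end

end

section \<open>Symmetries of the posterior\<close>

context bandit
begin

definition symmetry :: "nat \<Rightarrow> nat list \<Rightarrow> ((rnd_idx \<Rightarrow> real) \<Rightarrow> rnd_idx \<Rightarrow> real) \<Rightarrow> bool" where
  "symmetry h js T \<longleftrightarrow> T \<in> rb_space \<rightarrow>\<^sub>M rb_space \<and> distr rb_space rb_space T = rb_space \<and>
     (\<forall>\<omega>. hist h (T \<omega>) = js \<longleftrightarrow> hist h \<omega> = js) \<and> (\<forall>\<omega>. obs js (T \<omega>) = obs js \<omega>)"

text \<open>Each map leaves the event that the history is \<open>js\<close> invariant, so the map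
  may be selected by the actual history, of which there are finitely many.\<close>

lemma symmetry_glue:
  assumes ex: "\<And>js. js \<in> hists h \<Longrightarrow> \<exists>T. symmetry h js T \<and> (\<forall>\<omega>. Q js \<omega> (T \<omega>))"
  shows "\<exists>\<tau>. \<tau> \<in> rb_space \<rightarrow>\<^sub>M rb_space \<and> distr rb_space rb_space \<tau> = rb_space \<and>
    (\<forall>\<omega>. hist h (\<tau> \<omega>) = hist h \<omega>) \<and> (\<forall>\<omega>. Q (hist h \<omega>) \<omega> (\<tau> \<omega>))"
proof -
  define T where "T js = (SOME T. symmetry h js T \<and> (\<forall>\<omega>. Q js \<omega> (T \<omega>)))" for js
  have TQ: "symmetry h js (T js) \<and> (\<forall>\<omega>. Q js \<omega> (T js \<omega>))" if "js \<in> hists h" for js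
    unfolding T_def by (rule someI_ex[OF ex[OF that]])
  then have T: "symmetry h js (T js)" if "js \<in> hists h" for js using that by blast
  have Q: "Q (hist h \<omega>) \<omega> (T (hist h \<omega>) \<omega>)" for \<omega> using TQ[OF hist_hists] by blast
  have m: "T js \<in> rb_space \<rightarrow>\<^sub>M rb_space" "distr rb_space rb_space (T js) = rb_space"
    "hist h (T js \<omega>) = js \<longleftrightarrow> hist h \<omega> = js" if "js \<in> hists h" for js \<omega>
    using T[OF that] by (simp_all add: symmetry_def)
  have d: "(\<lambda>\<omega>. T (hist h \<omega>) \<omega>) \<in> rb_space \<rightarrow>\<^sub>M rb_space"
    "distr rb_space rb_space (\<lambda>\<omega>. T (hist h \<omega>) \<omega>) = rb_space"
    using distr_piecewise[of "hists h" "hist h" rb_space T] finite_hists measurable_hist hist_hists m by auto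
  have "hist h (T (hist h \<omega>) \<omega>) = hist h \<omega>" for \<omega>
    using T[OF hist_hists[of h \<omega>]] by (simp add: symmetry_def)
  with d Q show ?thesis by (intro exI[of _ "\<lambda>\<omega>. T (hist h \<omega>) \<omega>"]) simp
qed

end

context design
begin

lemma preserves_past_symmetry:
  assumes "preserves_past m T" "h \<le> m" "m \<le> Suc h"
  shows "symmetry h js T"
  using assms hist_preserved[OF assms] obs_prefix_preserved[OF assms, of js "[]"]
  by (auto simp: symmetry_def preserves_past_def)

text \<open>By the normal equations, observations do not distinguish a recovery value from its
  posterior mean; sample coordinates are orthogonal to both.\<close>

lemma past_mvec:
  assumes "x \<in> past m" "j < K" "z \<le> zmax" "m \<le> Suc h"
  shows "ip idx x (mvec j z) = ip idx x (fvec j z)"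
  using assms(1)
proof (cases rule: pastE)
  case (obs j' a)
  then show ?thesis using assms
    by (simp add: ip_mvec_yvec ip_commute[of idx "yvec j' (plays js j' ! a)"])
next
  case (samp h' j' c)
  then show ?thesis using assms by simp
qed

text \<open>The sample coordinates of block \<open>h\<close> are absent from \<open>past h\<close>,
  though not from \<open>past (Suc h)\<close>.\<close>

lemma past_gvec:
  assumes "x \<in> past h" "j < K"
  shows "ip idx x (gvec j z) = 0"
  using assms(1)
proof (cases rule: pastE)
  case (obs j' a)
  then show ?thesis using plays_nth_le[of a j'] by (simp add: ip_yvec ip_fvec)
next
  case (samp h' j' c)
  then show ?thesis by (simp add: gvec_SampR)
qed

lemma ip_mvec_gvec: "j < K \<Longrightarrow> ip idx (mvec j z) (gvec j' z') = 0"
  using plays_nth_le by (simp add: ip_mvec ip_yvec ip_fvec)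

lemma preserves_past_of_gram:
  fixes a b :: "'r \<Rightarrow> rnd_idx \<Rightarrow> real"
  assumes "finite R" "\<And>x r. x \<in> past m \<Longrightarrow> r \<in> R \<Longrightarrow> ip idx x (a r) = ip idx x (b r)"
    "\<And>r r'. r \<in> R \<Longrightarrow> r' \<in> R \<Longrightarrow> ip idx (a r) (a r') = ip idx (b r) (b r')"
  obtains T where "preserves_past m T" "\<And>r \<omega>. r \<in> R \<Longrightarrow> ip idx (a r) (T \<omega>) = ip idx (b r) \<omega>"
proof (rule isometry_fixing[OF finite_idx finite_past assms])
  fix T :: "(rnd_idx \<Rightarrow> real) \<Rightarrow> rnd_idx \<Rightarrow> real"
  assume T: "T \<in> (\<Pi>\<^sub>M i\<in>UNIV. std_gauss) \<rightarrow>\<^sub>M (\<Pi>\<^sub>M i\<in>UNIV. std_gauss)"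
    "distr (\<Pi>\<^sub>M i\<in>UNIV. std_gauss) (\<Pi>\<^sub>M i\<in>UNIV. std_gauss) T = (\<Pi>\<^sub>M i\<in>UNIV. std_gauss)"
    "\<And>x \<omega>. x \<in> past m \<Longrightarrow> ip idx x (T \<omega>) = ip idx x \<omega>"
    "\<And>r \<omega>. r \<in> R \<Longrightarrow> ip idx (a r) (T \<omega>) = ip idx (b r) \<omega>"
  have "preserves_past m T" unfolding preserves_past_def rb_space_def using T(1,2,3) by blast
  then show thesis using T(4) by (rule that)
qed

text \<open>The covariance of the posterior means plus the posterior covariance is the prior
  covariance, and the two parts are orthogonal.\<close>

lemma ip_rows_add:
  assumes "j < K" "j' < K" "z \<le> zmax" "z' \<le> zmax"
  shows "ip idx (\<lambda>i. mvec j z i + gvec j z i) (\<lambda>i. mvec j' z' i + gvec j' z' i) = ip idx (fvec j z) (fvec j' z')"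
  unfolding ip_add_left ip_add_right using assms
  by (simp add: ip_mvec_gvec ip_commute[of idx "gvec j z" "mvec j' z'"] ip_gvec_gvec ip_mvec_mvec ip_fvec_mvec ip_fvec_fvec)

text \<open>Subtracting \<open>fvec\<close> from twice its projection only changes the sign of the
  residual, which is orthogonal to all projections.\<close>

lemma ip_rows_reflect:
  assumes "j < K" "j' < K" "z \<le> zmax" "z' \<le> zmax"
  shows "ip idx (\<lambda>i. 2 * mvec j z i - fvec j z i) (\<lambda>i. 2 * mvec j' z' i - fvec j' z' i) = ip idx (fvec j z) (fvec j' z')"
proof -
  have "ip idx (mvec j z) (fvec j' z') = ip idx (mvec j z) (mvec j' z')"
    using assms by (simp add: ip_commute[of idx "mvec j z"] ip_mvec_mvec)
  then show ?thesis
    unfolding ip_diff_left ip_diff_right ip_scale_left ip_scale_right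
    using assms by (simp add: ip_mvec_mvec)
qed

lemma past_rows_add:
  "x \<in> past h \<Longrightarrow> j < K \<Longrightarrow> z \<le> zmax \<Longrightarrow> ip idx x (\<lambda>i. mvec j z i + gvec j z i) = ip idx x (fvec j z)"
  by (simp add: ip_add_right past_mvec past_gvec)

lemma past_rows_reflect:
  "x \<in> past (Suc h) \<Longrightarrow> j < K \<Longrightarrow> z \<le> zmax \<Longrightarrow> ip idx x (\<lambda>i. 2 * mvec j z i - fvec j z i) = ip idx x (fvec j z)"
  by (simp add: ip_diff_right ip_scale_right past_mvec)

text \<open>Given the history, the recovery functions and the posterior sample have the same law.
  Only \<open>past h\<close> is fixed, because the sample of block \<open>h\<close> is itself the
  target of the map.\<close>

lemma posterior_swap:
  "\<exists>T. symmetry h js T \<and> (\<forall>\<omega>. \<forall>j<K. \<forall>z\<le>zmax. rb_f zmax k (T \<omega>) j z = ts_sample zmax k \<sigma> \<omega> h (obs js \<omega>) j z)"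
proof (rule preserves_past_of_gram[where R="{..<K} \<times> {..zmax}" and m=h
      and a="\<lambda>(j, z). fvec j z" and b="\<lambda>(j, z). (\<lambda>i. mvec j z i + gvec j z i)"])
  fix T assume T: "preserves_past h T" "\<And>r \<omega>. r \<in> {..<K} \<times> {..zmax} \<Longrightarrow>
    ip idx (case r of (j, z) \<Rightarrow> fvec j z) (T \<omega>) = ip idx (case r of (j, z) \<Rightarrow> (\<lambda>i. mvec j z i + gvec j z i)) \<omega>"
  have "rb_f zmax k (T \<omega>) j z = ts_sample zmax k \<sigma> \<omega> h (obs js \<omega>) j z" if "j < K" "z \<le> zmax" for \<omega> j z
    using T(2)[of "(j, z)" \<omega>] that by (simp add: ip_add_left ip_fvec_eq_rb_f ip_mvec_eq_post_mean ip_gvec_eq)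
  then show ?thesis using preserves_past_symmetry[OF T(1)] by auto
qed (auto simp: past_rows_add ip_rows_add)

text \<open>Fixing \<open>past (Suc h)\<close> keeps the leaf of block \<open>h\<close>, which
  depends on the sample, while the residual changes sign. Averaging over both signs leaves the
  posterior mean.\<close>

lemma posterior_reflect:
  "\<exists>T. symmetry h js T \<and> (\<forall>\<omega>. choice h js (T \<omega>) = choice h js \<omega> \<and>
    (\<forall>j<K. \<forall>z\<le>zmax. rb_f zmax k (T \<omega>) j z = 2 * post_mean k \<sigma> (obs js \<omega> j) z - rb_f zmax k \<omega> j z))"
proof (rule preserves_past_of_gram[where R="{..<K} \<times> {..zmax}" and m="Suc h"
      and a="\<lambda>(j, z). fvec j z" and b="\<lambda>(j, z). (\<lambda>i. 2 * mvec j z i - fvec j z i)"])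
  fix T assume T: "preserves_past (Suc h) T" "\<And>r \<omega>. r \<in> {..<K} \<times> {..zmax} \<Longrightarrow>
    ip idx (case r of (j, z) \<Rightarrow> fvec j z) (T \<omega>) = ip idx (case r of (j, z) \<Rightarrow> (\<lambda>i. 2 * mvec j z i - fvec j z i)) \<omega>"
  have "rb_f zmax k (T \<omega>) j z = 2 * post_mean k \<sigma> (obs js \<omega> j) z - rb_f zmax k \<omega> j z" if "j < K" "z \<le> zmax" for \<omega> j z
    using T(2)[of "(j, z)" \<omega>] that by (simp add: ip_diff_left ip_scale_left ip_fvec_eq_rb_f ip_mvec_eq_post_mean)
  moreover have "choice h js (T \<omega>) = choice h js \<omega>" for \<omega>
    by (rule choice_prefix_preserved[OF T(1), of js "[]"]) auto
  ultimately show ?thesis using preserves_past_symmetry[OF T(1)] by auto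
qed (auto simp: past_rows_reflect ip_rows_reflect)

text \<open>The deviation divided by its standard deviation is a unit functional orthogonal to
  \<open>past h\<close>, hence exchangeable for a single coordinate. The division takes place for
  each history separately, where the variance is a constant.\<close>

lemma sample_normalize:
  assumes j: "j < K" and z: "z \<le> zmax"
  shows "\<exists>T. symmetry h js T \<and> (\<forall>\<omega>. ts_sample zmax k \<sigma> \<omega> h (obs js \<omega>) j z - post_mean k \<sigma> (obs js \<omega> j) z
     = sqrt (post_cov k \<sigma> (base js j) z z) * T \<omega> (SampR h j 0))"
proof -
  define v where "v = post_cov k \<sigma> (base js j) z z"
  \<comment> \<open>At variance \<open>0\<close> the functional \<open>gvec j z\<close> vanishes,
    and any unit functional orthogonal to \<open>past h\<close> will do.\<close>
  define u where "u = (if v = 0 then coord (SampR h j 0) else (\<lambda>i. inverse (sqrt v) * gvec j z i))"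
  have v: "0 \<le> v" unfolding v_def by (rule post_var_nonneg[OF obs_ok_base[OF js_set] z])
  have gg: "ip idx (gvec j z) (gvec j z) = v" using j z by (simp add: ip_gvec_gvec v_def)
  have scale: "ip idx (gvec j z) \<omega> = sqrt v * ip idx u \<omega>" for \<omega>
  proof (cases "v = 0")
    case True
    then have "\<forall>i\<in>idx. gvec j z i = 0" using gg ip_self_eq_0_iff[OF finite_idx] by auto
    then show ?thesis using True by (simp add: ip_def)
  next
    case False
    then show ?thesis using v by (simp add: u_def ip_scale_left)
  qed
  have uu: "ip idx u u = 1"
  proof (cases "v = 0")
    case True
    then show ?thesis using j by (simp add: u_def) (simp add: coord_def)
  next
    case False
    then have "ip idx u u = inverse (sqrt v) * (inverse (sqrt v) * v)"
      by (simp add: u_def ip_scale_left ip_scale_right gg)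
    also have "\<dots> = v / (sqrt v * sqrt v)" by (simp add: field_simps)
    finally show ?thesis using False v by simp
  qed
  have pc: "ip idx x (coord (SampR h j 0)) = 0" if "x \<in> past h" for x
    using that
  proof (cases rule: pastE)
    case (obs j' a)
    then show ?thesis using j by (subst ip_commute) simp
  next
    case (samp h' j' c)
    then have "ip idx x (coord (SampR h j 0)) = coord (SampR h' j' c) (SampR h j 0)"
      using j by (subst ip_commute) simp
    also have "\<dots> = 0" using samp by (simp add: coord_def)
    finally show ?thesis .
  qed
  have pu: "ip idx x u = 0" if "x \<in> past h" for x
    using pc[OF that] past_gvec[OF that j] by (simp add: u_def ip_scale_right)
  have cc: "ip idx (coord (SampR h j 0)) (coord (SampR h j 0)) = 1"
    using j by simp (simp add: coord_def)
  show ?thesis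
  proof (rule preserves_past_of_gram[where R="{()}" and m=h and a="\<lambda>_. coord (SampR h j 0)" and b="\<lambda>_. u"])
    fix T assume T: "preserves_past h T" "\<And>r \<omega>. r \<in> {()} \<Longrightarrow> ip idx (coord (SampR h j 0)) (T \<omega>) = ip idx u \<omega>"
    have "ts_sample zmax k \<sigma> \<omega> h (obs js \<omega>) j z - post_mean k \<sigma> (obs js \<omega> j) z = sqrt v * T \<omega> (SampR h j 0)" for \<omega>
      using T(2)[of "()" \<omega>] j z scale[of \<omega>] by (simp add: ip_gvec_eq)
    then show ?thesis using preserves_past_symmetry[OF T(1)] by (auto simp: v_def)
  qed (auto simp: pc pu cc uu)
qed

end

context bandit
begin

lemma design_hists: "js \<in> hists h \<Longrightarrow> design zmax k \<sigma> K d sel Z0 h js"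
  by unfold_locales

lemma integral_invariant:
  fixes f :: "(rnd_idx \<Rightarrow> real) \<Rightarrow> real"
  assumes "\<tau> \<in> rb_space \<rightarrow>\<^sub>M rb_space" "distr rb_space rb_space \<tau> = rb_space" "f \<in> borel_measurable rb_space"
  shows "(\<integral>\<omega>. f (\<tau> \<omega>) \<partial>rb_space) = (\<integral>\<omega>. f \<omega> \<partial>rb_space)"
    and "integrable rb_space (\<lambda>\<omega>. f (\<tau> \<omega>)) \<longleftrightarrow> integrable rb_space f"
  using integral_distr[OF assms(1,3)] integrable_distr_eq[OF assms(1,3)] assms(2) by simp_all

end

section \<open>Moments of a single Gaussian coordinate\<close>

lemma prob_space_rb_space: "prob_space rb_space"
  unfolding rb_space_def by (rule prob_space_PiM) (rule prob_space_std_gauss)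

lemma distr_rb_space_coord: "distr rb_space std_gauss (\<lambda>\<omega>. \<omega> i) = std_gauss"
  unfolding rb_space_def by (rule distr_PiM_component) (auto simp: prob_space_std_gauss)

lemma rb_space_coord_integral:
  fixes f :: "real \<Rightarrow> real"
  assumes f [measurable]: "f \<in> borel_measurable borel"
  shows "integrable rb_space (\<lambda>\<omega>. f (\<omega> i)) \<longleftrightarrow> integrable lborel (\<lambda>x. std_normal_density x * f x)"
    and "(\<integral>\<omega>. f (\<omega> i) \<partial>rb_space) = (\<integral>x. std_normal_density x * f x \<partial>lborel)"
proof -
  have m: "(\<lambda>\<omega>. \<omega> i) \<in> rb_space \<rightarrow>\<^sub>M std_gauss"
    unfolding rb_space_def by (rule measurable_component_singleton) simp
  have f': "f \<in> borel_measurable std_gauss" using f measurable_cong_sets[OF sets_std_gauss refl] by blast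
  have "integrable rb_space (\<lambda>\<omega>. f (\<omega> i)) \<longleftrightarrow> integrable std_gauss f"
    using integrable_distr_eq[OF m f'] distr_rb_space_coord[of i] by simp
  then show "integrable rb_space (\<lambda>\<omega>. f (\<omega> i)) \<longleftrightarrow> integrable lborel (\<lambda>x. std_normal_density x * f x)"
    unfolding std_gauss_def by (simp add: integrable_density)
  have "(\<integral>\<omega>. f (\<omega> i) \<partial>rb_space) = (\<integral>x. f x \<partial>std_gauss)"
    using integral_distr[OF m f'] distr_rb_space_coord[of i] by simp
  then show "(\<integral>\<omega>. f (\<omega> i) \<partial>rb_space) = (\<integral>x. std_normal_density x * f x \<partial>lborel)"
    unfolding std_gauss_def by (simp add: integral_density)
qed

lemma integrable_rb_space_coord: "integrable rb_space (\<lambda>\<omega>. \<omega> i)"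
  using integrable_std_normal_moment[of 1] rb_space_coord_integral(1)[of "\<lambda>x. x" i] by simp

text \<open>The factor \<open>1 / 4\<close> is below \<open>1 / 2\<close>, so the exponential moment
  of the square is finite: the integrand is \<open>sqrt 2\<close> times the normal density of
  variance \<open>2\<close>.\<close>

lemma exp_square_gauss:
  "integrable rb_space (\<lambda>\<omega>. exp ((\<omega> i)\<^sup>2 / 4))" "(\<integral>\<omega>. exp ((\<omega> i)\<^sup>2 / 4) \<partial>rb_space) = sqrt 2"
proof -
  have "std_normal_density x * exp (x\<^sup>2 / 4) = sqrt 2 * normal_density 0 (sqrt 2) x" for x
  proof -
    have "- x\<^sup>2 / 2 + x\<^sup>2 / 4 = - x\<^sup>2 / 4" by simp
    then have "exp (- x\<^sup>2 / 2) * exp (x\<^sup>2 / 4) = exp (- x\<^sup>2 / 4)" by (simp add: exp_add[symmetric])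
    moreover have "1 / sqrt (2 * pi) = sqrt 2 * (1 / sqrt (2 * pi * (sqrt 2)\<^sup>2))"
      by (simp add: real_sqrt_mult field_simps)
    ultimately show ?thesis by (simp add: normal_density_def)
  qed
  then have e: "(\<lambda>x. std_normal_density x * exp (x\<^sup>2 / 4)) = (\<lambda>x. sqrt 2 * normal_density 0 (sqrt 2) x)" by auto
  show "integrable rb_space (\<lambda>\<omega>. exp ((\<omega> i)\<^sup>2 / 4))"
    by (subst rb_space_coord_integral(1)) (simp_all add: e)
  show "(\<integral>\<omega>. exp ((\<omega> i)\<^sup>2 / 4) \<partial>rb_space) = sqrt 2"
    by (subst rb_space_coord_integral(2)) (simp_all add: e)
qed

section \<open>The regret bound\<close>

context bandit
begin

abbreviation "now h \<omega> \<equiv> state (hist h \<omega>)"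
abbreviation "data h \<omega> \<equiv> obs (hist h \<omega>) \<omega>"
abbreviation "leaf h \<omega> \<equiv> choice h (hist h \<omega>) \<omega>"
abbreviation "sample h \<omega> \<equiv> ts_sample zmax k \<sigma> \<omega> h (data h \<omega>)"
abbreviation "pmean h \<omega> \<equiv> (\<lambda>j. post_mean k \<sigma> (data h \<omega> j))"

definition pv :: "nat \<Rightarrow> (rnd_idx \<Rightarrow> real) \<Rightarrow> nat \<Rightarrow> nat \<Rightarrow> real" where
  "pv h \<omega> j z = post_cov k \<sigma> (base (hist h \<omega>) j) z z"

text \<open>A sum of posterior variances rather than of standard deviations: these are what
  telescopes.\<close>

definition width :: "nat \<Rightarrow> (rnd_idx \<Rightarrow> real) \<Rightarrow> real" where
  "width h \<omega> = leaf_val zmax (pv h \<omega>) (now h \<omega>) (leaf h \<omega>)"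

definition gap :: "nat \<Rightarrow> (rnd_idx \<Rightarrow> real) \<Rightarrow> real" where
  "gap h \<omega> = Mstar K d zmax (rb_f zmax k \<omega>) (now h \<omega>) - leaf_val zmax (rb_f zmax k \<omega>) (now h \<omega>) (leaf h \<omega>)"

lemma ts_regret_gap: "ts_regret K d zmax k \<sigma> sel Z0 T = (\<Sum>h\<le>T div d. \<integral>\<omega>. gap h \<omega> \<partial>rb_space)"
  unfolding ts_regret_def ts_run_hist Let_def gap_def choice_def fst_conv ..

lemma measurable_at_leaf:
  fixes f :: "nat list \<Rightarrow> nat list \<Rightarrow> (rnd_idx \<Rightarrow> real) \<Rightarrow> real"
  assumes f: "\<And>js i. set js \<subseteq> {..<K} \<Longrightarrow> i \<in> leaves K d \<Longrightarrow> f js i \<in> borel_measurable rb_space"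
  shows "(\<lambda>\<omega>. f (hist h \<omega>) (leaf h \<omega>) \<omega>) \<in> borel_measurable rb_space"
proof (rule measurable_at_hist[of h "\<lambda>js \<omega>. f js (choice h js \<omega>) \<omega>"])
  fix js assume js: "set js \<subseteq> {..<K}"
  define F where "F i = (if i \<in> leaves K d then f js i else (\<lambda>_. 0))" for i
  have "F i \<in> borel_measurable rb_space" for i
    using f[OF js] by (cases "i \<in> leaves K d") (simp_all add: F_def)
  then have "(\<lambda>\<omega>. F (choice h js \<omega>) \<omega>) \<in> borel_measurable rb_space"
    by (rule measurable_compose_countable[OF _ measurable_choice[OF js]])
  then show "(\<lambda>\<omega>. f js (choice h js \<omega>) \<omega>) \<in> borel_measurable rb_space"
    by (simp add: F_def choice_leaves)
qed simp_all

lemma measurable_leaf_val_at: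
  assumes "\<And>js j z. set js \<subseteq> {..<K} \<Longrightarrow> j < K \<Longrightarrow> z \<le> zmax \<Longrightarrow> (\<lambda>\<omega>. g js \<omega> j z) \<in> borel_measurable rb_space"
  shows "(\<lambda>\<omega>. leaf_val zmax (g (hist h \<omega>) \<omega>) (now h \<omega>) (leaf h \<omega>)) \<in> borel_measurable rb_space"
  using assms
  by (intro measurable_at_leaf[of "\<lambda>js i \<omega>. leaf_val zmax (g js \<omega>) (state js) i"] measurable_leaf_val state_le)
     (auto simp: leaves_def)

lemma measurable_Mstar_now:
  "(\<lambda>\<omega>. Mstar K d zmax (rb_f zmax k \<omega>) (now h \<omega>)) \<in> borel_measurable rb_space"
proof (rule measurable_at_hist[of h "\<lambda>js \<omega>. Mstar K d zmax (rb_f zmax k \<omega>) (state js)"])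
  fix js
  show "(\<lambda>\<omega>. Mstar K d zmax (rb_f zmax k \<omega>) (state js)) \<in> borel_measurable rb_space"
    unfolding Mstar_def
    by (intro borel_measurable_Max measurable_leaf_val state_le measurable_rb_f leaves_finite) (auto simp: leaves_def)
qed simp_all

text \<open>An integrable bound for all recovery values at once, from which values at random leaves
  inherit integrability.\<close>

definition envelope :: "(rnd_idx \<Rightarrow> real) \<Rightarrow> real" where
  "envelope \<omega> = (\<Sum>j<K. \<Sum>z\<le>zmax. \<bar>rb_f zmax k \<omega> j z\<bar>)"

lemma integrable_envelope: "integrable rb_space envelope"
  unfolding envelope_def[abs_def] rb_f_def
  by (intro Bochner_Integration.integrable_sum integrable_abs integrable_mult_right integrable_rb_space_coord)

lemma rb_f_le_envelope:
  assumes "j < K" "z \<le> zmax"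
  shows "\<bar>rb_f zmax k \<omega> j z\<bar> \<le> envelope \<omega>"
proof -
  have "\<bar>rb_f zmax k \<omega> j z\<bar> \<le> (\<Sum>z\<le>zmax. \<bar>rb_f zmax k \<omega> j z\<bar>)"
    using assms by (intro member_le_sum) auto
  also have "\<dots> \<le> envelope \<omega>"
    unfolding envelope_def using assms
    by (intro member_le_sum[of j "{..<K}" "\<lambda>j. \<Sum>z\<le>zmax. \<bar>rb_f zmax k \<omega> j z\<bar>"]) (auto intro: sum_nonneg)
  finally show ?thesis .
qed

lemma leaf_val_const: "leaf_val zmax (\<lambda>_ _. c) Zs i = c * length i"
  by (simp add: leaf_val_leaf_path)

lemma leaf_val_envelope:
  assumes i: "i \<in> leaves K d"
  shows "\<bar>leaf_val zmax (rb_f zmax k \<omega>) (state js) i\<bar> \<le> d * envelope \<omega>"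
proof -
  have s: "set i \<subseteq> {..<K}" "length i = d" using i by (auto simp: leaves_def)
  have "leaf_val zmax (rb_f zmax k \<omega>) (state js) i \<le> leaf_val zmax (\<lambda>_ _. envelope \<omega>) (state js) i"
    using rb_f_le_envelope by (intro leaf_val_mono[OF _ s(1) state_le]) (simp add: abs_le_iff)
  moreover have "leaf_val zmax (\<lambda>_ _. - envelope \<omega>) (state js) i \<le> leaf_val zmax (rb_f zmax k \<omega>) (state js) i"
    using rb_f_le_envelope by (intro leaf_val_mono[OF _ s(1) state_le]) (simp add: abs_le_iff minus_le_iff)
  ultimately show ?thesis by (simp add: leaf_val_const s(2) abs_le_iff mult.commute)
qed

lemma Mstar_attained:
  obtains i where "i \<in> leaves K d" "Mstar K d zmax f Zs = leaf_val zmax f Zs i"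
proof -
  have "Mstar K d zmax f Zs \<in> leaf_val zmax f Zs ` leaves K d"
    unfolding Mstar_def using leaves_nonempty[OF K_pos] by (intro Max_in) auto
  then show thesis using that by auto
qed

lemma integrable_Mstar_now: "integrable rb_space (\<lambda>\<omega>. Mstar K d zmax (rb_f zmax k \<omega>) (now h \<omega>))"
proof (rule Bochner_Integration.integrable_bound[of _ "\<lambda>\<omega>. d * envelope \<omega>"])
  show "AE \<omega> in rb_space. norm (Mstar K d zmax (rb_f zmax k \<omega>) (now h \<omega>)) \<le> norm (d * envelope \<omega>)"
  proof (rule AE_I2)
    fix \<omega>
    obtain i where i: "i \<in> leaves K d" "Mstar K d zmax (rb_f zmax k \<omega>) (now h \<omega>) = leaf_val zmax (rb_f zmax k \<omega>) (now h \<omega>) i"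
      by (rule Mstar_attained)
    show "norm (Mstar K d zmax (rb_f zmax k \<omega>) (now h \<omega>)) \<le> norm (d * envelope \<omega>)"
      unfolding i(2) using leaf_val_envelope[OF i(1), of \<omega> "hist h \<omega>"] by simp
  qed
qed (use integrable_envelope measurable_Mstar_now in auto)

lemma integrable_leaf_now: "integrable rb_space (\<lambda>\<omega>. leaf_val zmax (rb_f zmax k \<omega>) (now h \<omega>) (leaf h \<omega>))"
proof (rule Bochner_Integration.integrable_bound[of _ "\<lambda>\<omega>. d * envelope \<omega>"])
  show "AE \<omega> in rb_space. norm (leaf_val zmax (rb_f zmax k \<omega>) (now h \<omega>) (leaf h \<omega>)) \<le> norm (d * envelope \<omega>)"
  proof (rule AE_I2)
    fix \<omega>
    show "norm (leaf_val zmax (rb_f zmax k \<omega>) (now h \<omega>) (leaf h \<omega>)) \<le> norm (d * envelope \<omega>)"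
      using leaf_val_envelope[OF choice_leaves[of h "hist h \<omega>" \<omega>], of \<omega> "hist h \<omega>"] by simp
  qed
qed (use integrable_envelope measurable_leaf_val_at[of "\<lambda>_ \<omega>. rb_f zmax k \<omega>" h] in auto)

lemma Mstar_sample: "Mstar K d zmax (sample h \<omega>) (now h \<omega>) = leaf_val zmax (sample h \<omega>) (now h \<omega>) (leaf h \<omega>)"
proof (rule antisym)
  obtain i where "i \<in> leaves K d" "Mstar K d zmax (sample h \<omega>) (now h \<omega>) = leaf_val zmax (sample h \<omega>) (now h \<omega>) i"
    by (rule Mstar_attained)
  then show "Mstar K d zmax (sample h \<omega>) (now h \<omega>) \<le> leaf_val zmax (sample h \<omega>) (now h \<omega>) (leaf h \<omega>)"
    using choice_max by simp
  show "leaf_val zmax (sample h \<omega>) (now h \<omega>) (leaf h \<omega>) \<le> Mstar K d zmax (sample h \<omega>) (now h \<omega>)"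
    unfolding Mstar_def using choice_leaves by (intro Max_ge) auto
qed

text \<open>The glued swap keeps the history, hence the state, and replaces the recovery functions
  by the sample, whose maximum over the leaves is attained at the chosen leaf.\<close>

lemma integral_Mstar_now:
  "(\<integral>\<omega>. Mstar K d zmax (rb_f zmax k \<omega>) (now h \<omega>) \<partial>rb_space)
     = (\<integral>\<omega>. leaf_val zmax (sample h \<omega>) (now h \<omega>) (leaf h \<omega>) \<partial>rb_space)" (is ?eq)
  and integrable_sample_leaf: "integrable rb_space (\<lambda>\<omega>. leaf_val zmax (sample h \<omega>) (now h \<omega>) (leaf h \<omega>))" (is ?int)
proof -
  obtain \<tau> where \<tau>: "\<tau> \<in> rb_space \<rightarrow>\<^sub>M rb_space" "distr rb_space rb_space \<tau> = rb_space"
    "\<And>\<omega>. hist h (\<tau> \<omega>) = hist h \<omega>"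
    and f: "\<And>\<omega>. \<forall>j<K. \<forall>z\<le>zmax. rb_f zmax k (\<tau> \<omega>) j z = sample h \<omega> j z"
    using symmetry_glue[of h "\<lambda>js \<omega> \<omega>'. \<forall>j<K. \<forall>z\<le>zmax. rb_f zmax k \<omega>' j z = ts_sample zmax k \<sigma> \<omega> h (obs js \<omega>) j z",
      OF design.posterior_swap[OF design_hists]] by blast
  have e: "Mstar K d zmax (rb_f zmax k (\<tau> \<omega>)) (now h (\<tau> \<omega>)) = leaf_val zmax (sample h \<omega>) (now h \<omega>) (leaf h \<omega>)" for \<omega>
    unfolding \<tau>(3) Mstar_sample[symmetric] using f by (intro Mstar_cong state_le) auto
  note inv = integral_invariant[OF \<tau>(1,2) measurable_Mstar_now[of h]]
  show ?eq using inv(1) by (simp add: e)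
  show ?int using inv(2) integrable_Mstar_now[of h] by (simp add: e)
qed

text \<open>The posterior mean of the chosen leaf is the midpoint of the leaf values before and
  after the glued reflection, and these have equal integrals.\<close>

lemma integral_leaf_now:
  "(\<integral>\<omega>. leaf_val zmax (rb_f zmax k \<omega>) (now h \<omega>) (leaf h \<omega>) \<partial>rb_space)
     = (\<integral>\<omega>. leaf_val zmax (pmean h \<omega>) (now h \<omega>) (leaf h \<omega>) \<partial>rb_space)" (is ?eq)
  and integrable_pmean_leaf: "integrable rb_space (\<lambda>\<omega>. leaf_val zmax (pmean h \<omega>) (now h \<omega>) (leaf h \<omega>))" (is ?int)
proof -
  obtain \<tau> where \<tau>: "\<tau> \<in> rb_space \<rightarrow>\<^sub>M rb_space" "distr rb_space rb_space \<tau> = rb_space"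
    "\<And>\<omega>. hist h (\<tau> \<omega>) = hist h \<omega>"
    and f: "\<And>\<omega>. choice h (hist h \<omega>) (\<tau> \<omega>) = leaf h \<omega> \<and>
      (\<forall>j<K. \<forall>z\<le>zmax. rb_f zmax k (\<tau> \<omega>) j z = 2 * pmean h \<omega> j z - rb_f zmax k \<omega> j z)"
    using symmetry_glue[of h "\<lambda>js \<omega> \<omega>'. choice h js \<omega>' = choice h js \<omega> \<and>
      (\<forall>j<K. \<forall>z\<le>zmax. rb_f zmax k \<omega>' j z = 2 * post_mean k \<sigma> (obs js \<omega> j) z - rb_f zmax k \<omega> j z)",
      OF design.posterior_reflect[OF design_hists]] by blast
  define B where "B \<omega> = leaf_val zmax (rb_f zmax k \<omega>) (now h \<omega>) (leaf h \<omega>)" for \<omega>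
  have "B (\<tau> \<omega>) = 2 * leaf_val zmax (pmean h \<omega>) (now h \<omega>) (leaf h \<omega>) - B \<omega>" for \<omega>
  proof -
    have lf: "choice h (hist h \<omega>) (\<tau> \<omega>) = leaf h \<omega>" using f by blast
    have "B (\<tau> \<omega>) = leaf_val zmax (\<lambda>j z. 2 * pmean h \<omega> j z + (-1) * rb_f zmax k \<omega> j z + 0) (now h \<omega>) (leaf h \<omega>)"
      unfolding B_def \<tau>(3) lf using f by (intro leaf_val_cong[OF _ choice_set state_le]) simp
    then show ?thesis unfolding leaf_val_linear B_def by simp
  qed
  then have e: "leaf_val zmax (pmean h \<omega>) (now h \<omega>) (leaf h \<omega>) = (B (\<tau> \<omega>) + B \<omega>) / 2" for \<omega> by simp
  have B: "B \<in> borel_measurable rb_space" "integrable rb_space B"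
    using integrable_leaf_now[of h] by (auto simp: B_def[abs_def])
  note inv = integral_invariant[OF \<tau>(1,2) B(1)]
  show ?int unfolding e using B(2) inv(2) by simp
  show ?eq unfolding e B_def[symmetric] using B(2) inv by simp
qed

lemma pv_bounds: "z \<le> zmax \<Longrightarrow> 0 \<le> pv h \<omega> j z" "z \<le> zmax \<Longrightarrow> pv h \<omega> j z \<le> 1"
  using post_var_nonneg[OF obs_ok_base[OF hist_set]] post_var_le_prior[OF obs_ok_base[OF hist_set], of z h \<omega> j] bounded[of z]
  by (auto simp: pv_def)

lemma width_bounds: "0 \<le> width h \<omega>" "width h \<omega> \<le> d"
proof -
  have "leaf_val zmax (\<lambda>_ _. 0) (now h \<omega>) (leaf h \<omega>) \<le> width h \<omega>"
    unfolding width_def using pv_bounds by (intro leaf_val_mono[OF _ choice_set state_le]) auto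
  then show "0 \<le> width h \<omega>" by (simp add: leaf_val_const)
  have "width h \<omega> \<le> leaf_val zmax (\<lambda>_ _. 1) (now h \<omega>) (leaf h \<omega>)"
    unfolding width_def using pv_bounds by (intro leaf_val_mono[OF _ choice_set state_le]) auto
  then show "width h \<omega> \<le> d" by (simp add: leaf_val_const)
qed

lemma integrable_width: "integrable rb_space (width h)"
proof -
  interpret prob_space rb_space by (rule prob_space_rb_space)
  have prob1: "prob UNIV = 1" using prob_space by simp
  have "width h \<in> borel_measurable rb_space"
    unfolding width_def[abs_def] pv_def[abs_def]
    by (rule measurable_leaf_val_at[of "\<lambda>js \<omega> j z. post_cov k \<sigma> (base js j) z z"]) simp
  then show ?thesis using width_bounds
    by (intro integrable_const_bound[where B=d]) auto
qed

text \<open>Holds for every outcome: the run traces one path \<open>p\<close> cut into blocks of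
  length \<open>d\<close>, and the data behind the posterior of block \<open>h\<close> are the first
  \<open>h * d\<close> entries of \<open>p\<close>.\<close>

lemma sum_width_le:
  assumes "H \<le> Suc T" "1 \<le> T"
  shows "(\<Sum>h<H. width h \<omega>) \<le> real d * real K * (4 / ln (1 + 1 / \<sigma>\<^sup>2) * info_gain zmax k \<sigma> T)"
proof -
  define p where "p = leaf_path zmax Z0 (hist H \<omega>)"
  have len: "length p = H * d" by (simp add: p_def)
  have p: "set p \<subseteq> {..<K} \<times> {..zmax}" unfolding p_def by (rule leaf_path_set[OF hist_set Z0_le])
  have pre: "\<exists>r. hist H \<omega> = hist h \<omega> @ r" if "h \<le> H" for h
    using that by (induction H) (auto simp: le_Suc_eq)
  have tk: "take (h * d) p = leaf_path zmax Z0 (hist h \<omega>)" if "h \<le> H" for h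
    using pre[OF that] by (auto simp: p_def leaf_path_snoc)
  have nth: "p ! (h * d + l) = leaf_path zmax (now h \<omega>) (leaf h \<omega>) ! l" if "h < H" "l < d" for h l
  proof -
    have "Suc h * d \<le> H * d" using that by (intro mult_right_mono) auto
    then have "p ! (h * d + l) = take (Suc h * d) p ! (h * d + l)" using that by simp
    also have "\<dots> = (leaf_path zmax Z0 (hist h \<omega>) @ leaf_path zmax (now h \<omega>) (leaf h \<omega>)) ! (h * d + l)"
      using tk[of "Suc h"] that by (simp add: leaf_path_snoc)
    finally show ?thesis by (simp add: nth_append)
  qed
  have "(\<Sum>h<H. width h \<omega>) = (\<Sum>h<H. \<Sum>l<d. pvar (map snd (filter (\<lambda>q. fst q = fst (p ! (h * d + l))) (take (h * d) p))) (snd (p ! (h * d + l))))"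
  proof (intro sum.cong refl)
    fix h assume h: "h \<in> {..<H}"
    have "pv h \<omega> j z = pvar (map snd (filter (\<lambda>q. fst q = j) (take (h * d) p))) z" for j z
      using h unfolding pv_def post_var_eq_pvar by (simp add: tk map_fst_plays[symmetric] base_def comp_def)
    then show "width h \<omega> = (\<Sum>l<d. pvar (map snd (filter (\<lambda>q. fst q = fst (p ! (h * d + l))) (take (h * d) p))) (snd (p ! (h * d + l))))"
      using h unfolding width_def leaf_val_leaf_path by (simp add: nth)
  qed
  also have "\<dots> \<le> real d * real K * (4 / ln (1 + 1 / \<sigma>\<^sup>2) * info_gain zmax k \<sigma> T)"
    by (rule block_pvar_sum[OF p _ assms]) (simp add: len)
  finally show ?thesis .
qed

text \<open>Logarithm of the expectation of the sum of \<open>exp (g\<^sup>2 / 4)\<close> over the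
  \<open>K * (zmax + 1)\<close> pairs of an arm and a z-value, each contributing
  \<open>sqrt 2\<close>.\<close>

definition arms_log :: real where
  "arms_log = ln (sqrt 2 * (real K * real (zmax + 1)))"

lemma integral_gap_le:
  assumes a: "a > 0"
  shows "(\<integral>\<omega>. gap h \<omega> \<partial>rb_space) \<le> a / 2 * (\<integral>\<omega>. width h \<omega> \<partial>rb_space) + 2 * real d * arms_log / a"
proof -
  interpret prob_space rb_space by (rule prob_space_rb_space)
  have prob1: "prob UNIV = 1" using prob_space by simp
  define N where "N = sqrt 2 * (real K * real (zmax + 1))"
  have N: "N > 0" using K_pos by (simp add: N_def)
  have L: "arms_log = ln N" by (simp add: arms_log_def N_def)
  \<comment> \<open>One measure-preserving map per arm and z-value; its coordinate
    \<open>SampR h j 0\<close> is standard normal and carries the deviation of the sample.\<close>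
  define P where "P j z \<tau> \<longleftrightarrow> \<tau> \<in> rb_space \<rightarrow>\<^sub>M rb_space \<and> distr rb_space rb_space \<tau> = rb_space \<and>
     (\<forall>\<omega>. sample h \<omega> j z - pmean h \<omega> j z = sqrt (pv h \<omega> j z) * \<tau> \<omega> (SampR h j 0))" for j z \<tau>
  define \<tau> where "\<tau> j z = (SOME t. P j z t)" for j z
  have exP: "\<exists>\<tau>. P j z \<tau>" if "j < K" "z \<le> zmax" for j z
  proof -
    have "\<exists>T. symmetry h js T \<and> (\<forall>\<omega>. ts_sample zmax k \<sigma> \<omega> h (obs js \<omega>) j z - post_mean k \<sigma> (obs js \<omega> j) z
       = sqrt (post_cov k \<sigma> (base js j) z z) * T \<omega> (SampR h j 0))" if "js \<in> hists h" for js
      using design.sample_normalize[OF design_hists[OF that] \<open>j < K\<close> \<open>z \<le> zmax\<close>] .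
    from symmetry_glue[of h "\<lambda>js \<omega> \<omega>'. ts_sample zmax k \<sigma> \<omega> h (obs js \<omega>) j z - post_mean k \<sigma> (obs js \<omega> j) z
       = sqrt (post_cov k \<sigma> (base js j) z z) * \<omega>' (SampR h j 0)", OF this]
    show ?thesis unfolding P_def pv_def by blast
  qed
  have "P j z (\<tau> j z)" if "j < K" "z \<le> zmax" for j z
    unfolding \<tau>_def by (rule someI_ex[OF exP[OF that]])
  then have \<tau>: "\<tau> j z \<in> rb_space \<rightarrow>\<^sub>M rb_space" "distr rb_space rb_space (\<tau> j z) = rb_space"
    and dev: "sample h \<omega> j z - pmean h \<omega> j z = sqrt (pv h \<omega> j z) * \<tau> j z \<omega> (SampR h j 0)"
    if "j < K" "z \<le> zmax" for j z \<omega>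
    using that by (simp_all add: P_def)
  define g where "g j z \<omega> = \<tau> j z \<omega> (SampR h j 0)" for j z \<omega>
  define E where "E \<omega> = (\<Sum>j<K. \<Sum>z\<le>zmax. exp ((g j z \<omega>)\<^sup>2 / 4))" for \<omega>
  have gE: "integrable rb_space (\<lambda>\<omega>. exp ((g j z \<omega>)\<^sup>2 / 4))" "(\<integral>\<omega>. exp ((g j z \<omega>)\<^sup>2 / 4) \<partial>rb_space) = sqrt 2"
    if "j < K" "z \<le> zmax" for j z
  proof -
    have m: "(\<lambda>\<omega>. exp ((\<omega> (SampR h j 0))\<^sup>2 / 4)) \<in> borel_measurable rb_space" by measurable
    note inv = integral_invariant[OF \<tau>(1)[OF that] \<tau>(2)[OF that] m]
    show "integrable rb_space (\<lambda>\<omega>. exp ((g j z \<omega>)\<^sup>2 / 4))"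
      unfolding g_def inv(2) by (rule exp_square_gauss)
    show "(\<integral>\<omega>. exp ((g j z \<omega>)\<^sup>2 / 4) \<partial>rb_space) = sqrt 2"
      unfolding g_def inv(1) by (rule exp_square_gauss)
  qed
  have E: "integrable rb_space E" "(\<integral>\<omega>. E \<omega> \<partial>rb_space) = N"
  proof -
    show "integrable rb_space E"
      unfolding E_def by (intro Bochner_Integration.integrable_sum) (auto intro: gE)
    have "(\<integral>\<omega>. E \<omega> \<partial>rb_space) = (\<Sum>j<K. \<Sum>z\<le>zmax. (\<integral>\<omega>. exp ((g j z \<omega>)\<^sup>2 / 4) \<partial>rb_space))"
      unfolding E_def by (subst Bochner_Integration.integral_sum; (intro Bochner_Integration.integrable_sum)?)
        (auto intro!: gE sum.cong Bochner_Integration.integral_sum)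
    then show "(\<integral>\<omega>. E \<omega> \<partial>rb_space) = N" by (simp add: gE N_def)
  qed
  \<comment> \<open>Dominates \<open>g\<^sup>2 / (2 * a)\<close> for all arms and z-values at once.
    In expectation the terms \<open>- 1\<close> and \<open>E \<omega> / N\<close> cancel, since
    \<open>E\<close> has mean \<open>N\<close>.\<close>
  define q where "q \<omega> = (4 * (arms_log - 1) + 4 * (E \<omega> / N)) / (2 * a)" for \<omega>
  have q: "(g j z \<omega>)\<^sup>2 / (2 * a) \<le> q \<omega>" if "j < K" "z \<le> zmax" for j z \<omega>
  proof -
    define y where "y = (g j z \<omega>)\<^sup>2 / 4"
    have "exp y \<le> (\<Sum>z\<le>zmax. exp ((g j z \<omega>)\<^sup>2 / 4))"
      unfolding y_def using that by (intro member_le_sum[of z "{..zmax}" "\<lambda>z. exp ((g j z \<omega>)\<^sup>2 / 4)"]) auto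
    also have "\<dots> \<le> E \<omega>"
      unfolding E_def using that
      by (intro member_le_sum[of j "{..<K}" "\<lambda>j. \<Sum>z\<le>zmax. exp ((g j z \<omega>)\<^sup>2 / 4)"]) (auto intro: sum_nonneg)
    finally have "exp y / N \<le> E \<omega> / N" using N by (intro divide_right_mono) auto
    \<comment> \<open>Tangent of the exponential at \<open>arms_log\<close>; integrating it plays
      the role of Jensen's inequality for the expected maximum.\<close>
    moreover have "1 + (y - arms_log) \<le> exp y / N"
      using exp_ge_add_one_self[of "y - arms_log"] N by (simp add: exp_diff L)
    ultimately have "(g j z \<omega>)\<^sup>2 \<le> 4 * (arms_log - 1) + 4 * (E \<omega> / N)" by (simp add: y_def)
    then show ?thesis unfolding q_def using a by (intro divide_right_mono) auto
  qed
  have step: "sample h \<omega> j z - pmean h \<omega> j z \<le> a / 2 * pv h \<omega> j z + q \<omega>" if "j < K" "z \<le> zmax" for j z \<omega>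
  proof -
    let ?s = "sqrt (pv h \<omega> j z)"
    have "0 \<le> (a * ?s - g j z \<omega>)\<^sup>2 / (2 * a)" using a by simp
    also have "\<dots> = a / 2 * (?s * ?s) - ?s * g j z \<omega> + (g j z \<omega>)\<^sup>2 / (2 * a)"
      using a by (simp add: power2_eq_square field_simps)
    finally have "?s * g j z \<omega> \<le> a / 2 * (?s * ?s) + (g j z \<omega>)\<^sup>2 / (2 * a)" by simp
    then show ?thesis using dev[OF that] q[OF that, of \<omega>] pv_bounds(1)[OF that(2), of h \<omega> j] by (simp add: g_def)
  qed
  have point: "leaf_val zmax (sample h \<omega>) (now h \<omega>) (leaf h \<omega>) - leaf_val zmax (pmean h \<omega>) (now h \<omega>) (leaf h \<omega>)
     \<le> a / 2 * width h \<omega> + real d * q \<omega>" for \<omega>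
  proof -
    have "leaf_val zmax (\<lambda>j z. 1 * sample h \<omega> j z + (-1) * pmean h \<omega> j z + 0) (now h \<omega>) (leaf h \<omega>)
       \<le> leaf_val zmax (\<lambda>j z. a / 2 * pv h \<omega> j z + 0 * pv h \<omega> j z + q \<omega>) (now h \<omega>) (leaf h \<omega>)"
      using step by (intro leaf_val_mono[OF _ choice_set state_le]) simp
    then show ?thesis unfolding leaf_val_linear by (simp add: width_def mult.commute)
  qed
  have qi: "integrable rb_space q" "(\<integral>\<omega>. q \<omega> \<partial>rb_space) = 2 * arms_log / a"
  proof -
    show "integrable rb_space q" unfolding q_def[abs_def] using E(1) by simp
    have "(\<integral>\<omega>. q \<omega> \<partial>rb_space) = (4 * (arms_log - 1) + 4 * ((\<integral>\<omega>. E \<omega> \<partial>rb_space) / N)) / (2 * a)"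
      unfolding q_def using E(1) by (simp add: prob1)
    also have "\<dots> = 2 * arms_log / a" using N a by (simp add: E(2) field_simps)
    finally show "(\<integral>\<omega>. q \<omega> \<partial>rb_space) = 2 * arms_log / a" .
  qed
  have "(\<integral>\<omega>. gap h \<omega> \<partial>rb_space) = (\<integral>\<omega>. leaf_val zmax (sample h \<omega>) (now h \<omega>) (leaf h \<omega>)
     - leaf_val zmax (pmean h \<omega>) (now h \<omega>) (leaf h \<omega>) \<partial>rb_space)"
    unfolding gap_def
    by (simp add: integrable_Mstar_now integrable_leaf_now integrable_sample_leaf integrable_pmean_leaf
        integral_Mstar_now integral_leaf_now)
  also have "\<dots> \<le> (\<integral>\<omega>. a / 2 * width h \<omega> + real d * q \<omega> \<partial>rb_space)"
    using point qi(1) integrable_width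
    by (intro integral_mono Bochner_Integration.integrable_diff Bochner_Integration.integrable_add
        integrable_sample_leaf integrable_pmean_leaf integrable_mult_right) auto
  also have "\<dots> = a / 2 * (\<integral>\<omega>. width h \<omega> \<partial>rb_space) + real d * (2 * arms_log / a)"
    using qi integrable_width by simp
  finally show ?thesis by (simp add: mult_ac)
qed

text \<open>With a common \<open>a\<close> for all blocks, the bound on the sum of the widths, valid
  for each outcome, can be used under the integral.\<close>

lemma ts_regret_le_tradeoff:
  assumes a: "a > 0" and T: "1 \<le> T"
  defines "V \<equiv> real d * real K * (4 / ln (1 + 1 / \<sigma>\<^sup>2) * info_gain zmax k \<sigma> T)"
  shows "ts_regret K d zmax k \<sigma> sel Z0 T \<le> a / 2 * V + 2 * (real (Suc (T div d)) * real d) * arms_log / a"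
proof -
  interpret prob_space rb_space by (rule prob_space_rb_space)
  have prob1: "prob UNIV = 1" using prob_space by simp
  let ?H = "Suc (T div d)"
  have "ts_regret K d zmax k \<sigma> sel Z0 T \<le> (\<Sum>h<?H. a / 2 * (\<integral>\<omega>. width h \<omega> \<partial>rb_space) + 2 * real d * arms_log / a)"
    unfolding ts_regret_gap lessThan_Suc_atMost by (intro sum_mono integral_gap_le a)
  also have "\<dots> = a / 2 * (\<Sum>h<?H. \<integral>\<omega>. width h \<omega> \<partial>rb_space) + real ?H * (2 * real d * arms_log / a)"
    by (simp only: sum.distrib sum_distrib_left[symmetric] sum_constant card_lessThan)
  also have "(\<Sum>h<?H. \<integral>\<omega>. width h \<omega> \<partial>rb_space) = (\<integral>\<omega>. (\<Sum>h<?H. width h \<omega>) \<partial>rb_space)"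
    using integrable_width by (intro Bochner_Integration.integral_sum[symmetric]) auto
  also have "\<dots> \<le> (\<integral>\<omega>. V \<partial>rb_space)"
    unfolding V_def using integrable_width T
    by (intro integral_mono sum_width_le Bochner_Integration.integrable_sum) auto
  also have "\<dots> = V" by (simp add: prob1)
  finally have "ts_regret K d zmax k \<sigma> sel Z0 T \<le> a / 2 * V + real ?H * (2 * real d * arms_log / a)"
    using a by simp
  also have "real ?H * (2 * real d * arms_log / a) = 2 * (real ?H * real d) * arms_log / a"
    by simp
  finally show ?thesis .
qed

end

text \<open>At \<open>a = 2 * sqrt M / sqrt V\<close> both terms equal \<open>sqrt (V * M)\<close>.
  If \<open>V\<close> or \<open>M\<close> is \<open>0\<close>, the infimum may be reached only in
  the limit of large or small \<open>a\<close>, whence the \<open>\<epsilon>\<close>.\<close>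

lemma le_sqrt_of_tradeoff:
  fixes x V M :: real
  assumes x: "\<And>a. a > 0 \<Longrightarrow> x \<le> a / 2 * V + 2 * M / a" and V: "0 \<le> V" and M: "0 \<le> M"
  shows "x \<le> 2 * sqrt (V * M)"
proof -
  have "x \<le> 2 * sqrt (V * M) + \<epsilon>" if \<epsilon>: "\<epsilon> > 0" for \<epsilon>
  proof (cases "V * M = 0")
    case False
    then have p: "V > 0" "M > 0" using V M by auto
    define a where "a = 2 * sqrt M / sqrt V"
    have "a / 2 * V = sqrt M * (V / sqrt V)" by (simp add: a_def)
    also have "V / sqrt V = sqrt V" using p by (simp add: real_div_sqrt)
    finally have 1: "a / 2 * V = sqrt (V * M)" by (simp add: real_sqrt_mult)
    have "2 * M / a = sqrt V * (M / sqrt M)" using p by (simp add: a_def)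
    also have "M / sqrt M = sqrt M" using p by (simp add: real_div_sqrt)
    finally have 2: "2 * M / a = sqrt (V * M)" by (simp add: real_sqrt_mult)
    have "a > 0" using p by (simp add: a_def)
    from x[OF this] show ?thesis using 1 2 \<epsilon> by simp
  next
    case True
    then consider "V = 0" "M > 0" | "M = 0" using M by fastforce
    then show ?thesis
    proof cases
      case 1
      then show ?thesis using x[of "2 * M / \<epsilon>"] \<epsilon> by simp
    next
      case 2
      have "\<epsilon> / (V + 1) / 2 * V \<le> \<epsilon>" using V \<epsilon> by (simp add: field_simps)
      moreover have "0 < \<epsilon> / (V + 1)" using V \<epsilon> by simp
      from x[OF this] have "x \<le> \<epsilon> / (V + 1) / 2 * V" using 2 by simp
      ultimately show ?thesis using 2 by simp
    qed
  qed
  then show ?thesis by (rule field_le_epsilon)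
qed

theorem theorem5:
  fixes \<sigma> :: real and d :: nat
  assumes "\<sigma> > 0" and "d \<ge> 1"
  shows "\<exists>C>0. \<forall>K zmax T k sel Z0.
           K \<ge> 1 \<longrightarrow> T \<ge> K * (zmax + 1) \<longrightarrow>
           valid_kernel zmax k \<longrightarrow> (\<forall>z\<le>zmax. k z z \<le> 1) \<longrightarrow>
           (\<forall>j. Z0 j \<le> zmax) \<longrightarrow> tie_rule K d sel \<longrightarrow>
           ts_regret K d zmax k \<sigma> sel Z0 T
             \<le> C * sqrt (real K * real T * info_gain zmax k \<sigma> T
                          * ln (real ((K * (zmax + 1)) ^ d * T)))"
proof -
  define c where "c = 4 / ln (1 + 1 / \<sigma>\<^sup>2)"
  \<comment> \<open>\<open>d * c\<close> comes from the sum of posterior variances,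
    \<open>1 + d\<close> from rounding up to full blocks, and the inner \<open>2\<close> from
    comparing \<open>arms_log\<close> with the logarithm in the bound.\<close>
  define C where "C = 2 * sqrt (d * c * (1 + d) * 2)"
  have "0 < ln (1 + 1 / \<sigma>\<^sup>2)" using assms(1) by (intro ln_gt_zero) simp
  then have c: "c > 0" by (simp add: c_def)
  have "C > 0" using c assms(2) by (simp add: C_def)
  moreover have "ts_regret K d zmax k \<sigma> sel Z0 T
             \<le> C * sqrt (real K * real T * info_gain zmax k \<sigma> T
                          * ln (real ((K * (zmax + 1)) ^ d * T)))"
    if K: "K \<ge> 1" and T: "T \<ge> K * (zmax + 1)" and k: "valid_kernel zmax k" "\<forall>z\<le>zmax. k z z \<le> 1"
      and Z0: "\<forall>j. Z0 j \<le> zmax" and tie: "tie_rule K d sel" for K zmax T k sel Z0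
  proof -
    interpret bandit zmax k \<sigma> K d sel Z0
      using assms K k Z0 tie by unfold_locales auto
    let ?\<gamma> = "info_gain zmax k \<sigma> T" and ?l = "ln (real ((K * (zmax + 1)) ^ d * T))"
    have \<gamma>: "0 \<le> ?\<gamma>" by (rule info_gain_nonneg)
    have "1 * 1 \<le> K * (zmax + 1)" using K by (intro mult_le_mono) auto
    then have T1: "1 \<le> T" using T by simp
    have "1 \<le> (K * (zmax + 1)) ^ d" using K by (intro one_le_power) simp
    then have l1: "1 \<le> (K * (zmax + 1)) ^ d * T" using T1 by simp
    then have "real 1 \<le> real ((K * (zmax + 1)) ^ d * T)" by (rule of_nat_mono)
    then have l: "0 \<le> ?l" by (intro ln_ge_zero) (simp only: of_nat_1)
    \<comment> \<open>For \<open>K = 1\<close>, \<open>zmax = 0\<close>, \<open>T = 1\<close> the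
      logarithm in the bound is \<open>0\<close> while \<open>arms_log\<close> is positive. A single
      arm leaves only one leaf, so the regret vanishes; otherwise \<open>K * (zmax + 1)\<close> is
      at least \<open>2\<close>.\<close>
    show ?thesis
    proof (cases "K = 1")
      case True
      have "gap h \<omega> = 0" for h \<omega>
      proof -
        have rep: "i = replicate d 0" if "i \<in> leaves K d" for i
          using that True by (intro replicate_eqI) (auto simp: leaves_def)
        have "i = leaf h \<omega>" if "i \<in> leaves K d" for i
          using rep[OF that] rep[OF choice_leaves[of h "hist h \<omega>" \<omega>]] by simp
        moreover obtain i where "i \<in> leaves K d"
            "Mstar K d zmax (rb_f zmax k \<omega>) (now h \<omega>) = leaf_val zmax (rb_f zmax k \<omega>) (now h \<omega>) i"
          by (rule Mstar_attained)
        ultimately show ?thesis by (simp add: gap_def)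
      qed
      then have "ts_regret K d zmax k \<sigma> sel Z0 T = 0" by (simp add: ts_regret_gap)
      moreover have "0 \<le> C * sqrt (real K * real T * ?\<gamma> * ?l)"
        using \<open>C > 0\<close> \<gamma> l by (intro mult_nonneg_nonneg real_sqrt_ge_zero) auto
      ultimately show ?thesis by simp
    next
      case False
      define n where "n = real (K * (zmax + 1))"
      define M where "M = real (Suc (T div d)) * real d * arms_log"
      have n: "2 \<le> n"
      proof -
        have "2 * 1 \<le> K * (zmax + 1)" using False K by (intro mult_le_mono) auto
        then have "real 2 \<le> n" unfolding n_def by (intro of_nat_mono) simp
        then show ?thesis by simp
      qed
      have A: "arms_log = ln (sqrt 2 * n)" by (simp only: arms_log_def n_def of_nat_mult)
      have sq: "1 \<le> sqrt 2" "sqrt 2 \<le> n" using n by (auto intro: order.trans[OF sqrt2_less_2[THEN less_imp_le]])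
      have A0: "0 \<le> arms_log" unfolding A
      proof (rule ln_ge_zero)
        have "1 * 1 \<le> sqrt 2 * n" using sq n by (intro mult_mono) auto
        then show "1 \<le> sqrt 2 * n" by simp
      qed
      \<comment> \<open>The constant \<open>sqrt 2\<close> is absorbed by a second factor
        \<open>n\<close>, at the price of a factor \<open>2\<close> in front of the
        logarithm.\<close>
      have "arms_log \<le> ln (n * n)"
        unfolding A using sq n by (intro ln_mono mult_right_mono) auto
      also have "\<dots> = 2 * ln n" using n by (simp add: ln_mult)
      also have "ln n \<le> ?l"
      proof (rule ln_mono)
        have "K * (zmax + 1) \<le> T" by (rule T)
        also have "\<dots> \<le> (K * (zmax + 1)) ^ d * T"
          using \<open>1 \<le> (K * (zmax + 1)) ^ d\<close> by simp
        finally show "n \<le> real ((K * (zmax + 1)) ^ d * T)" unfolding n_def by (rule of_nat_mono)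
      qed (use n in auto)
      finally have A2: "arms_log \<le> 2 * ?l" by simp
      have "ts_regret K d zmax k \<sigma> sel Z0 T \<le> 2 * sqrt ((real d * real K * (c * ?\<gamma>)) * M)"
      proof (rule le_sqrt_of_tradeoff)
        fix a :: real assume "a > 0"
        from ts_regret_le_tradeoff[OF this T1]
        show "ts_regret K d zmax k \<sigma> sel Z0 T \<le> a / 2 * (real d * real K * (c * ?\<gamma>)) + 2 * M / a"
          by (simp add: M_def c_def mult.assoc)
      qed (use c \<gamma> A0 in \<open>auto simp: M_def\<close>)
      also have "(real d * real K * (c * ?\<gamma>)) * M \<le> (real d * real K * (c * ?\<gamma>)) * ((1 + real d) * real T * (2 * ?l))"
      proof (rule mult_left_mono)
        \<comment> \<open>The regret counts \<open>T div d + 1\<close> blocks, which may reach up to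
          \<open>d\<close> rounds beyond \<open>T\<close>.\<close>
        have "Suc (T div d) * d \<le> T + d" by simp
        also have "\<dots> \<le> T + d * T" using T1 by simp
        finally have "real (Suc (T div d) * d) \<le> real (T + d * T)" by (rule of_nat_mono)
        then have "real (Suc (T div d)) * real d \<le> (1 + real d) * real T" by (simp add: algebra_simps)
        then show "M \<le> (1 + real d) * real T * (2 * ?l)"
          unfolding M_def by (rule mult_mono[OF _ A2 _ A0]) simp
      qed (use c \<gamma> in auto)
      also have "2 * sqrt ((real d * real K * (c * ?\<gamma>)) * ((1 + real d) * real T * (2 * ?l)))
         = C * sqrt (real K * real T * ?\<gamma> * ?l)"
        unfolding C_def by (simp add: real_sqrt_mult[symmetric] mult_ac)
      finally show ?thesis by simp
    qed
  qed
  ultimately show ?thesis by blast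
qed

end
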